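(* Let $\psi$ be an admissible wavelet such that $\|\psi\|_{2,\mu_\alpha}^2\le c_\psi$. Then for every nonzero $f\in L^2_\alpha(\mathbb R_+)$, $$-\int_{\mathcal R}|W_\psi f(a,x)|^2\ln\big(|W_\psi f(a,x)|^2\big)\,d\nu_\alpha(a,x)\ \ge\ \|f\|_{2,\mu_\alpha}^2\,\ln\!\left(\frac{c_\psi}{\|\psi\|_{2,\mu_\alpha}^2\,\|f\|_{2,\mu_\alpha}^2}\right)$$ (the left-hand side is well defined in $(-\infty,+\infty]$, with the convention $0\ln0=0$).
   Context: Fix a real number $\alpha>-1/2$. Let $\mu_\alpha$ be the measure on $\mathbb{R}_+=[0,\infty)$ given by $d\mu_\alpha(x)=\frac{x^{2\alpha+1}}{2^\alpha\Gamma(\alpha+1)}\,dx$; for $1\le p<\infty$ let $L^p_\alpha(\mathbb R_+)=L^p(\mathbb R_+,\mu_\alpha)$ with norm $\|f\|_{p,\mu_\alpha}=\left(\int_0^\infty|f|^p\,d\mu_\alpha\right)^{1/p}$, and let $L^\infty_\alpha(\mathbb R_+)$ be the essentially bounded functions. Let $j_\alpha(z)=\Gamma(\alpha+1)\sum_{n\ge0}\frac{(-1)^n}{n!\,\Gamma(n+\alpha+1)}(z/2)^{2n}$. The Hankel transform is $\mathcal H_\alpha f(\xi)=\int_0^\infty f(x)\,j_\alpha(x\xi)\,d\mu_\alpha(x)$ for $f\in L^1_\alpha(\mathbb R_+)$, extended to a unitary operator on $L^2_\alpha(\mathbb R_+)$. For $x\ge0$ the Hankel translation is $\tau_x^\alpha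 f(y)=\frac{\Gamma(\alpha+1)}{\Gamma(1/2)\Gamma(\alpha+1/2)}\int_0^\pi f\big(\sqrt{x^2+y^2+2xy\cos\theta}\big)\sin^{2\alpha}\theta\,d\theta$, and for $a>0$ the dilation is $D_af(x)=a^{\alpha+1}f(ax)$. A nonzero $\psi\in L^1_\alpha(\mathbb R_+)\cap L^\infty_\alpha(\mathbb R_+)$ is an admissible wavelet if $0<c_\psi:=\int_0^\infty|\mathcal H_\alpha\psi(a)|^2\,\frac{da}{a}<\infty$. For such $\psi$ and $f\in L^2_\alpha(\mathbb R_+)$, the Hankel wavelet transform is $W_\psi f(a,x)=c_\psi^{-1/2}\int_0^\infty f(t)\,\overline{\tau_x^\alpha(D_a\psi)(t)}\,d\mu_\alpha(t)$ for $(a,x)\in\mathcal R:=(0,\infty)\times[0,\infty)$. On $\mathcal R$ let $d\nu_\alpha(a,x)=a^{2\alpha+1}\,da\,d\mu_\alpha(x)$, $L^p_\alpha(\mathcal R)=L^p(\mathcal R,\nu_\alpha)$, with norm $\|F\|_{p,\nu_\alpha}$ (and $\|F\|_\infty$ the essential supremum). *)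

theory Defs
  imports "HOL-Analysis.Analysis"
begin

definition mu_alpha :: "real \<Rightarrow> real measure" where
  "mu_alpha \<alpha> = density lborel
     (\<lambda>x. ennreal (indicator {0..} x * (x powr (2*\<alpha>+1) / (2 powr \<alpha> * Gamma (\<alpha>+1)))))"

definition nu_alpha :: "real \<Rightarrow> (real \<times> real) measure" where
  "nu_alpha \<alpha> = density lborel (\<lambda>a. ennreal (indicator {0<..} a * a powr (2*\<alpha>+1)))
                 \<Otimes>\<^sub>M mu_alpha \<alpha>"

definition bessel_j :: "real \<Rightarrow> real \<Rightarrow> real" where
  "bessel_j \<alpha> z = Gamma (\<alpha>+1) *
     (\<Sum>n. (-1)^n / (fact n * Gamma (real n + \<alpha> + 1)) * (z/2)^(2*n))"

definition hankel :: "real \<Rightarrow> (real \<Rightarrow> complex) \<Rightarrow> real \<Rightarrow> complex" where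
  "hankel \<alpha> f \<xi> = (\<integral>x. f x * complex_of_real (bessel_j \<alpha> (x*\<xi>)) \<partial>mu_alpha \<alpha>)"

definition hankel_transl :: "real \<Rightarrow> real \<Rightarrow> (real \<Rightarrow> complex) \<Rightarrow> real \<Rightarrow> complex" where
  "hankel_transl \<alpha> x f y =
     complex_of_real (Gamma (\<alpha>+1) / (Gamma (1/2) * Gamma (\<alpha>+1/2))) *
     (LINT \<theta>:{0..pi}|lborel.
        f (sqrt (x^2 + y^2 + 2*x*y*cos \<theta>)) * complex_of_real (sin \<theta> powr (2*\<alpha>)))"

definition dilation :: "real \<Rightarrow> real \<Rightarrow> (real \<Rightarrow> complex) \<Rightarrow> real \<Rightarrow> complex" where
  "dilation \<alpha> a f x = complex_of_real (a powr (\<alpha>+1)) * f (a*x)"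

definition L2norm :: "real \<Rightarrow> (real \<Rightarrow> complex) \<Rightarrow> real" where
  "L2norm \<alpha> f = sqrt (\<integral>x. (cmod (f x))^2 \<partial>mu_alpha \<alpha>)"

definition in_L2 :: "real \<Rightarrow> (real \<Rightarrow> complex) \<Rightarrow> bool" where
  "in_L2 \<alpha> f \<longleftrightarrow> f \<in> borel_measurable (mu_alpha \<alpha>) \<and>
      (\<integral>\<^sup>+x. ennreal ((cmod (f x))^2) \<partial>mu_alpha \<alpha>) < \<infinity>"

definition c_psi_ennreal :: "real \<Rightarrow> (real \<Rightarrow> complex) \<Rightarrow> ennreal" where
  "c_psi_ennreal \<alpha> \<psi> = (\<integral>\<^sup>+a. ennreal (indicator {0<..} a * (cmod (hankel \<alpha> \<psi> a))^2 / a) \<partial>lborel)"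

definition c_psi :: "real \<Rightarrow> (real \<Rightarrow> complex) \<Rightarrow> real" where
  "c_psi \<alpha> \<psi> = enn2real (c_psi_ennreal \<alpha> \<psi>)"

definition admissible :: "real \<Rightarrow> (real \<Rightarrow> complex) \<Rightarrow> bool" where
  "admissible \<alpha> \<psi> \<longleftrightarrow>
     integrable (mu_alpha \<alpha>) \<psi> \<and>
     (\<exists>C. AE x in mu_alpha \<alpha>. cmod (\<psi> x) \<le> C) \<and>
     \<not> (AE x in mu_alpha \<alpha>. \<psi> x = 0) \<and>
     0 < c_psi_ennreal \<alpha> \<psi> \<and> c_psi_ennreal \<alpha> \<psi> < \<infinity>"

definition wavelet_transform ::
  "real \<Rightarrow> (real \<Rightarrow> complex) \<Rightarrow> (real \<Rightarrow> complex) \<Rightarrow> real \<times> real \<Rightarrow> complex" where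
  "wavelet_transform \<alpha> \<psi> f = (\<lambda>(a,x).
     complex_of_real (1 / sqrt (c_psi \<alpha> \<psi>)) *
     (\<integral>t. f t * cnj (hankel_transl \<alpha> x (dilation \<alpha> a \<psi>) t) \<partial>mu_alpha \<alpha>))"

definition ent :: "real \<Rightarrow> real" where
  "ent s = (if s = 0 then 0 else - s * ln s)"

end

theory Submission
  imports Defs
begin

text \<open>With \<open>M = \<parallel>\<psi>\<parallel>\<^sup>2 \<parallel>f\<parallel>\<^sup>2 / c\<^sub>\<psi>\<close>, Cauchy--Schwarz gives \<open>|W f|\<^sup>2 \<le> M\<close> almost everywhere, so
  \<open>- |W f|\<^sup>2 ln |W f|\<^sup>2 \<ge> - |W f|\<^sup>2 ln M\<close>; integrating, the claim reduces to the isometry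
  \<open>\<parallel>W f\<parallel> = \<parallel>f\<parallel>\<close>.

  For continuous bounded integrable \<open>f\<close> the isometry follows from the Plancherel theorem for the Hankel
  transform, applied to \<open>f\<close> and to its convolutions with the dilates of \<open>\<psi>\<close>. Plancherel itself
  is obtained by inserting the factor \<open>exp (- \<epsilon>\<^sup>2 \<xi>\<^sup>2 / 2)\<close>: by the product formula for \<open>j\<^sub>\<alpha>\<close>
  (Chu--Vandermonde on the level of power series) the regularised kernel is a translated Gaussian, an
  approximate identity. The symmetry of the translation is the symmetry, in the sides \<open>t\<close> and \<open>s\<close>, of the
  density of the law of cosines \<open>s\<^sup>2 = x\<^sup>2 + t\<^sup>2 + 2 x t cos \<theta>\<close>. General \<open>f\<close> are reached by density.\<close>

subsection \<open>The measure on the half-line\<close>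

text \<open>The transform \<open>W f\<close> is given by an integral at each point, for each
  square-integrable \<open>f\<close>; it is not declared as a continuous extension. The density
  argument therefore has to follow the values \<open>W f p\<close> themselves: Cauchy-Schwarz makes
  them converge, Fatou yields one inequality between the norms, and the other one needs a separate
  device.

  The angular average is carried as a probability measure \<open>ang\<close>, and translation
  becomes integration over the product \<open>mu_ang\<close>. There, for x > 0, the pair of a side t
  and the third side s has an image measure invariant under exchange of its coordinates. This one
  fact yields the invariance of \<mu> under translation, the transfer of a translation from one
  factor of an integral to the other, and the Cauchy-Schwarz bound. The boundary lines a = 0 and x =
  0, where the formulas degenerate, are null sets.

  Plancherel is an equality of nonnegative integrals, so square integrability of the transform is a
  consequence and not a precondition. A convolution inherits its continuity from \<open>f\<close>
  alone, so the wavelet enters there merely as an integrable function.\<close>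

lemma power2_powr:
  fixes x :: real
  assumes "x > 0"
  shows "(x\<^sup>2) powr p = x powr (2 * p)"
proof -
  have "x\<^sup>2 = x powr 2" using assms by simp
  then show ?thesis by (simp only: powr_powr)
qed

locale hankel_setup =
  fixes \<alpha> :: real
  assumes alpha_gt: "\<alpha> > -1/2"
begin

abbreviation "\<mu> \<equiv> mu_alpha \<alpha>"

definition mu_weight :: "real \<Rightarrow> real" where
  "mu_weight x = indicator {0..} x * (x powr (2*\<alpha>+1) / (2 powr \<alpha> * Gamma (\<alpha>+1)))"

lemma Gamma_pos [simp]: "Gamma (\<alpha>+1) > 0" "Gamma (\<alpha>+1/2) > 0" "Gamma (1/2::real) > 0"
  using alpha_gt by (auto intro!: Gamma_real_pos)

lemma mu_weight_nonneg [simp]: "mu_weight x \<ge> 0"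
  unfolding mu_weight_def using less_imp_le[OF Gamma_pos(1)] by (simp add: indicator_def)

lemma mu_weight_pos: "x > 0 \<Longrightarrow> mu_weight x > 0"
  unfolding mu_weight_def by auto

lemma mu_weight_measurable [measurable]: "mu_weight \<in> borel_measurable borel"
  unfolding mu_weight_def by measurable

lemma mu_eq: "\<mu> = density lborel (\<lambda>x. ennreal (mu_weight x))"
  unfolding mu_alpha_def mu_weight_def ..

lemma sets_mu [measurable_cong, simp]: "sets \<mu> = sets borel"
  by (simp add: mu_eq)

lemma space_mu [simp]: "space \<mu> = UNIV"
  by (simp add: mu_eq)

lemma sigma_finite_mu: "sigma_finite_measure \<mu>"
  unfolding mu_eq by (subst sigma_finite_measure.sigma_finite_iff_density_finite[OF sigma_finite_lborel]) auto

lemma AE_mu_iff: "(AE x in \<mu>. P x) \<longleftrightarrow> (AE x in lborel. 0 < x \<longrightarrow> P x)"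
proof -
  have "(AE x in \<mu>. P x) \<longleftrightarrow> (AE x in lborel. 0 < ennreal (mu_weight x) \<longrightarrow> P x)"
    unfolding mu_eq by (subst AE_density) auto
  also have "\<dots> \<longleftrightarrow> (AE x in lborel. 0 < x \<longrightarrow> P x)"
  proof -
    have *: "0 < ennreal (mu_weight x) \<longleftrightarrow> 0 < x" for x
      using mu_weight_pos[of x] by (cases "x = 0"; cases "x < 0") (auto simp: mu_weight_def)
    show ?thesis unfolding * ..
  qed
  finally show ?thesis .
qed

lemma AE_mu_pos: "AE x in \<mu>. 0 < x"
  by (simp add: AE_mu_iff)

lemma nn_integral_mu:
  assumes [measurable]: "f \<in> borel_measurable borel"
  shows "(\<integral>\<^sup>+x. f x \<partial>\<mu>) = (\<integral>\<^sup>+x. ennreal (mu_weight x) * f x \<partial>lborel)"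
  unfolding mu_eq by (subst nn_integral_density) auto

lemma integral_mu:
  fixes f :: "real \<Rightarrow> 'a :: {banach, second_countable_topology}"
  assumes [measurable]: "f \<in> borel_measurable borel"
  shows "(\<integral>x. f x \<partial>\<mu>) = (\<integral>x. mu_weight x *\<^sub>R f x \<partial>lborel)"
  unfolding mu_eq by (subst integral_density) auto

lemma mu_weight_scale:
  assumes "a > 0"
  shows "mu_weight (a * x) = a powr (2*\<alpha>+1) * mu_weight x"
  using assms by (auto simp: mu_weight_def indicator_def powr_mult zero_le_mult_iff)

text \<open>The exponent is the homogeneity 2\<alpha>+1 of the density plus one for Lebesgue
  measure. Half of it is the exponent in \<open>dilation\<close>, which makes dilations isometric in
  L2.\<close>

lemma nn_integral_mu_scale:
  assumes [measurable]: "f \<in> borel_measurable borel" and "a > 0"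
  shows "(\<integral>\<^sup>+x. f x \<partial>\<mu>) = ennreal (a powr (2*\<alpha>+2)) * (\<integral>\<^sup>+x. f (a * x) \<partial>\<mu>)"
proof -
  have "(\<integral>\<^sup>+x. f x \<partial>\<mu>) = ennreal a * (\<integral>\<^sup>+x. ennreal (mu_weight (a*x)) * f (a*x) \<partial>lborel)"
    unfolding nn_integral_mu[OF assms(1)]
    using assms by (subst nn_integral_real_affine[where c=a and t=0]) auto
  also have "\<dots> = ennreal a * (\<integral>\<^sup>+x. ennreal (a powr (2*\<alpha>+1)) * (ennreal (mu_weight x) * f (a*x)) \<partial>lborel)"
    using assms by (simp add: mu_weight_scale ennreal_mult mult.assoc)
  also have "\<dots> = ennreal a * ennreal (a powr (2*\<alpha>+1)) * (\<integral>\<^sup>+x. f (a * x) \<partial>\<mu>)"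
    by (simp add: nn_integral_cmult nn_integral_mu mult.assoc)
  also have "ennreal a * ennreal (a powr (2*\<alpha>+1)) = ennreal (a powr (2*\<alpha>+2))"
  proof -
    have "a * a powr (2*\<alpha>+1) = a powr (2*\<alpha>+2)"
      using assms powr_add[of a 1 "2*\<alpha>+1"] by (simp add: add.commute)
    then show ?thesis using assms by (simp add: ennreal_mult[symmetric])
  qed
  finally show ?thesis .
qed

lemma integral_mu_scale:
  fixes f :: "real \<Rightarrow> 'a :: {banach, second_countable_topology}"
  assumes [measurable]: "f \<in> borel_measurable borel" and "a > 0"
  shows "(\<integral>x. f x \<partial>\<mu>) = a powr (2*\<alpha>+2) *\<^sub>R (\<integral>x. f (a * x) \<partial>\<mu>)"
proof -
  have "(\<integral>x. f x \<partial>\<mu>) = a *\<^sub>R (\<integral>x. mu_weight (a*x) *\<^sub>R f (a*x) \<partial>lborel)"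
    unfolding integral_mu[OF assms(1)]
    using assms by (subst lborel_integral_real_affine[where c=a and t=0]) auto
  also have "\<dots> = a *\<^sub>R (\<integral>x. a powr (2*\<alpha>+1) *\<^sub>R (mu_weight x *\<^sub>R f (a*x)) \<partial>lborel)"
    using assms by (simp add: mu_weight_scale)
  also have "\<dots> = (a * a powr (2*\<alpha>+1)) *\<^sub>R (\<integral>x. f (a * x) \<partial>\<mu>)"
    by (simp add: integral_mu scaleR_scaleR[symmetric] del: scaleR_scaleR)
  also have "a * a powr (2*\<alpha>+1) = a powr (2*\<alpha>+2)"
    using assms powr_add[of a 1 "2*\<alpha>+1"] by (simp add: add.commute)
  finally show ?thesis .
qed

lemma integrable_mu_scale:
  fixes f :: "real \<Rightarrow> 'a :: {banach, second_countable_topology}"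
  assumes "integrable \<mu> f" and a: "a > 0"
  shows "integrable \<mu> (\<lambda>x. f (a * x))"
proof -
  have [measurable]: "f \<in> borel_measurable borel"
    using borel_measurable_integrable[OF assms(1)] by simp
  have "ennreal (a powr (2*\<alpha>+2)) * (\<integral>\<^sup>+x. norm (f (a * x)) \<partial>\<mu>) < \<infinity>"
    using assms(1) nn_integral_mu_scale[of "\<lambda>x. ennreal (norm (f x))", OF _ a]
    by (simp add: integrable_iff_bounded)
  then have "(\<integral>\<^sup>+x. norm (f (a * x)) \<partial>\<mu>) < \<infinity>"
    using a by (auto simp: ennreal_mult_less_top)
  then show ?thesis by (auto intro!: integrableI_bounded)
qed

subsection \<open>The angular measure\<close>

definition ang_const :: real where
  "ang_const = Gamma (\<alpha>+1) / (Gamma (1/2) * Gamma (\<alpha>+1/2))"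

definition ang_weight :: "real \<Rightarrow> real" where
  "ang_weight \<theta> = indicator {0..pi} \<theta> * (ang_const * sin \<theta> powr (2*\<alpha>))"

text \<open>The constant of the Hankel translation normalises this to a probability measure
  (\<open>emeasure_ang\<close>), so a translate is an average of values of the function. For
  \<alpha> < 0 the density is unbounded near 0 and pi, and \<alpha> > -1/2 is what keeps it
  integrable.\<close>

definition ang :: "real measure" where
  "ang = density lborel (\<lambda>\<theta>. ennreal (ang_weight \<theta>))"

lemma ang_const_pos [simp]: "ang_const > 0"
  unfolding ang_const_def by auto

lemma ang_weight_nonneg [simp]: "ang_weight \<theta> \<ge> 0"
  unfolding ang_weight_def using less_imp_le[OF ang_const_pos] by auto

lemma ang_weight_measurable [measurable]: "ang_weight \<in> borel_measurable borel"
  unfolding ang_weight_def by measurable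

lemma sets_ang [measurable_cong, simp]: "sets ang = sets borel"
  by (simp add: ang_def)

lemma space_ang [simp]: "space ang = UNIV"
  by (simp add: ang_def)

lemma nn_integral_ang:
  assumes [measurable]: "f \<in> borel_measurable borel"
  shows "(\<integral>\<^sup>+x. f x \<partial>ang) = (\<integral>\<^sup>+x. ennreal (ang_weight x) * f x \<partial>lborel)"
  unfolding ang_def by (subst nn_integral_density) auto

lemma integral_ang:
  fixes f :: "real \<Rightarrow> 'a :: {banach, second_countable_topology}"
  assumes [measurable]: "f \<in> borel_measurable borel"
  shows "(\<integral>x. f x \<partial>ang) = (\<integral>x. ang_weight x *\<^sub>R f x \<partial>lborel)"
  unfolding ang_def by (subst integral_density) auto

text \<open>Reflection preserves the sine and changes the sign of the cosine. This version turns the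
  plus sign of the translation into the minus sign of the law of cosines; its Bochner twin kills the
  odd moments of the cosine.\<close>

lemma nn_integral_ang_reflect:
  assumes [measurable]: "f \<in> borel_measurable borel"
  shows "(\<integral>\<^sup>+\<theta>. f (pi - \<theta>) \<partial>ang) = (\<integral>\<^sup>+\<theta>. f \<theta> \<partial>ang)"
proof -
  have *: "(\<lambda>\<theta>. ang_weight (pi - \<theta>)) = ang_weight"
    by (auto simp: ang_weight_def indicator_def fun_eq_iff)
  have "(\<integral>\<^sup>+\<theta>. f \<theta> \<partial>ang) = (\<integral>\<^sup>+\<theta>. ennreal (ang_weight (pi - \<theta>)) * f (pi - \<theta>) \<partial>lborel)"
    unfolding nn_integral_ang[OF assms] by (subst nn_integral_real_affine[where c="-1" and t=pi]) auto
  then show ?thesis using fun_cong[OF *] by (simp add: nn_integral_ang)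
qed

lemma integral_ang_reflect:
  fixes f :: "real \<Rightarrow> 'a :: {banach, second_countable_topology}"
  assumes [measurable]: "f \<in> borel_measurable borel"
  shows "(\<integral>\<theta>. f (pi - \<theta>) \<partial>ang) = (\<integral>\<theta>. f \<theta> \<partial>ang)"
proof -
  have *: "(\<lambda>\<theta>. ang_weight (pi - \<theta>)) = ang_weight"
    by (auto simp: ang_weight_def indicator_def fun_eq_iff)
  have "(\<integral>\<theta>. f \<theta> \<partial>ang) = (\<integral>\<theta>. ang_weight (pi - \<theta>) *\<^sub>R f (pi - \<theta>) \<partial>lborel)"
    unfolding integral_ang[OF assms] by (subst lborel_integral_real_affine[where c="-1" and t=pi]) auto
  then show ?thesis using fun_cong[OF *] by (simp add: integral_ang)
qed

text \<open>The substitution t = (sin \<theta>)^2 in the Beta integral. Only {0..pi/2} is covered,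
  because (sin \<theta>)^2 is monotone there and not on {0..pi}.\<close>

lemma nn_integral_cos_power_half:
  "(\<integral>\<^sup>+\<theta>. ennreal (sin \<theta> powr (2*\<alpha>) * cos \<theta> ^ (2*n)) * indicator {0..pi/2} \<theta> \<partial>lborel)
    = ennreal (Beta (\<alpha>+1/2) (real n + 1/2) / 2)"
proof -
  let ?f = "\<lambda>t. t powr (\<alpha>+1/2-1) * (1-t) powr (real n + 1/2 - 1) :: real"
  have "(\<integral>\<^sup>+t. ennreal (?f t) * indicator {0..1} t \<partial>lborel) = ennreal (Beta (\<alpha>+1/2) (real n + 1/2))"
    using nn_integral_has_integral_lebesgue[OF _ has_integral_Beta_real[of "\<alpha>+1/2" "real n + 1/2"]] alpha_gt
    by (simp add: mult.commute indicator_mult_ennreal)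
  moreover have "(\<integral>\<^sup>+t. ennreal (?f t) * indicator {(sin 0)^2..(sin (pi/2))^2} t \<partial>lborel)
     = (\<integral>\<^sup>+\<theta>. ennreal (?f ((sin \<theta>)^2)) * ennreal (2 * sin \<theta> * cos \<theta>) * indicator {0..pi/2} \<theta> \<partial>lborel)"
    by (rule nn_integral_substitution_aux)
      (auto intro!: derivative_eq_intros continuous_intros mult_nonneg_nonneg sin_ge_zero cos_ge_zero)
  moreover have "(\<integral>\<^sup>+\<theta>. ennreal (?f ((sin \<theta>)^2)) * ennreal (2 * sin \<theta> * cos \<theta>) * indicator {0..pi/2} \<theta> \<partial>lborel)
     = (\<integral>\<^sup>+\<theta>. ennreal 2 * (ennreal (sin \<theta> powr (2*\<alpha>) * cos \<theta> ^ (2*n)) * indicator {0..pi/2} \<theta>) \<partial>lborel)"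
  proof (intro nn_integral_cong_AE)
    \<comment> \<open>The rewriting needs sine and cosine strictly positive. Since
      \<open>0 powr p = 0\<close> but \<open>0 ^ 0 = 1\<close>, the two integrands really differ at
      pi/2 when n = 0.\<close>
    have "AE \<theta> in lborel. \<theta> \<noteq> (0::real)" "AE \<theta> in lborel. \<theta> \<noteq> pi/2"
      by (rule AE_lborel_singleton)+
    then show "AE \<theta> in lborel. ennreal (?f ((sin \<theta>)^2)) * ennreal (2 * sin \<theta> * cos \<theta>) * indicator {0..pi/2} \<theta>
       = ennreal 2 * (ennreal (sin \<theta> powr (2*\<alpha>) * cos \<theta> ^ (2*n)) * indicator {0..pi/2} \<theta>)"
    proof eventually_elim
      case (elim \<theta>)
      show ?case
      proof (cases "\<theta> \<in> {0..pi/2}")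
        case True
        with elim have s: "sin \<theta> > 0" "cos \<theta> > 0"
          by (auto intro!: sin_gt_zero cos_gt_zero)
        have 1: "(sin \<theta>)\<^sup>2 powr (\<alpha>+1/2-1) * sin \<theta> = sin \<theta> powr (2*\<alpha>)"
        proof -
          have "(sin \<theta>)\<^sup>2 powr (\<alpha>+1/2-1) * sin \<theta> = sin \<theta> powr (2*(\<alpha>+1/2-1)) * sin \<theta> powr 1"
            using s by (subst power2_powr) auto
          also have "\<dots> = sin \<theta> powr (2*\<alpha>)" by (subst powr_add[symmetric]) simp
          finally show ?thesis .
        qed
        have 2: "(1 - (sin \<theta>)\<^sup>2) powr (real n + 1/2 - 1) * cos \<theta> = cos \<theta> ^ (2*n)"
        proof -
          have "(1 - (sin \<theta>)\<^sup>2) powr (real n + 1/2 - 1) * cos \<theta> = (cos \<theta>)\<^sup>2 powr (real n + 1/2 - 1) * cos \<theta>"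
            by (simp add: cos_squared_eq)
          also have "\<dots> = cos \<theta> powr (2*(real n + 1/2-1)) * cos \<theta> powr 1"
            using s by (subst power2_powr) auto
          also have "\<dots> = cos \<theta> powr (real (2*n))" by (subst powr_add[symmetric]) simp
          also have "\<dots> = cos \<theta> ^ (2*n)" using s by (subst powr_realpow) auto
          finally show ?thesis .
        qed
        have "?f ((sin \<theta>)^2) * (2 * sin \<theta> * cos \<theta>)
           = 2 * (((sin \<theta>)\<^sup>2 powr (\<alpha>+1/2-1) * sin \<theta>) * ((1 - (sin \<theta>)\<^sup>2) powr (real n + 1/2 - 1) * cos \<theta>))"
          by (simp add: mult_ac)
        also have "\<dots> = 2 * (sin \<theta> powr (2*\<alpha>) * cos \<theta> ^ (2*n))"
          by (simp only: 1 2)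
        finally show ?thesis
          using True s by (simp add: ennreal_mult[symmetric] flip: ennreal_numeral)
      qed auto
    qed
  qed
  ultimately have "ennreal 2 * (\<integral>\<^sup>+\<theta>. ennreal (sin \<theta> powr (2*\<alpha>) * cos \<theta> ^ (2*n)) * indicator {0..pi/2} \<theta> \<partial>lborel)
      = ennreal (Beta (\<alpha>+1/2) (real n + 1/2))" (is "ennreal 2 * ?I = _")
    by (subst (asm) nn_integral_cmult) auto
  then have "ennreal (1/2) * (ennreal 2 * ?I) = ennreal (1/2) * ennreal (Beta (\<alpha>+1/2) (real n + 1/2))"
    by simp
  moreover have "ennreal (1/2) * (ennreal 2 * ?I) = ?I"
    unfolding mult.assoc[symmetric] by (subst ennreal_mult[symmetric]) auto
  moreover have "ennreal (1/2) * ennreal (Beta (\<alpha>+1/2) (real n + 1/2)) = ennreal (Beta (\<alpha>+1/2) (real n + 1/2) / 2)"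
    by (subst ennreal_mult'[symmetric]) auto
  ultimately show ?thesis by (simp only:)
qed

lemma nn_integral_ang_cos_power:
  "(\<integral>\<^sup>+\<theta>. ennreal (cos \<theta> ^ (2*n)) \<partial>ang) = ennreal (pochhammer (1/2) n / pochhammer (\<alpha>+1) n)"
proof -
  let ?g = "\<lambda>\<theta>. sin \<theta> powr (2*\<alpha>) * cos \<theta> ^ (2*n)"
  let ?B = "Beta (\<alpha>+1/2) (real n + 1/2)"
  have B: "?B \<ge> 0" using less_imp_le[OF Gamma_pos(2)] alpha_gt
    unfolding Beta_def by (auto intro!: divide_nonneg_nonneg mult_nonneg_nonneg less_imp_le[OF Gamma_real_pos])
  have "(\<integral>\<^sup>+\<theta>. ennreal (cos \<theta> ^ (2*n)) \<partial>ang) =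
      (\<integral>\<^sup>+\<theta>. ennreal ang_const * (ennreal (?g \<theta>) * indicator {0..pi/2} \<theta> + ennreal (?g \<theta>) * indicator {pi/2..pi} \<theta>) \<partial>lborel)"
    unfolding nn_integral_ang[of "\<lambda>\<theta>. ennreal (cos \<theta> ^ (2*n))", simplified]
  proof (intro nn_integral_cong_AE)
    \<comment> \<open>The point pi/2 lies in both halves and would be counted twice.\<close>
    have "AE \<theta> in lborel. \<theta> \<noteq> pi/2" by (rule AE_lborel_singleton)
    then show "AE \<theta> in lborel. ennreal (ang_weight \<theta>) * ennreal (cos \<theta> ^ (2*n)) =
       ennreal ang_const * (ennreal (?g \<theta>) * indicator {0..pi/2} \<theta> + ennreal (?g \<theta>) * indicator {pi/2..pi} \<theta>)"
    proof eventually_elim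
      case (elim \<theta>)
      have "ennreal (ang_weight \<theta>) * ennreal (cos \<theta> ^ (2*n)) = ennreal ang_const * (ennreal (?g \<theta>) * indicator {0..pi} \<theta>)"
        using less_imp_le[OF ang_const_pos]
        by (auto simp: ang_weight_def indicator_def mult.assoc ennreal_mult' ennreal_mult'' power_mult)
      then show ?case using elim by (auto simp: indicator_def)
    qed
  qed
  also have "\<dots> = ennreal ang_const * ((\<integral>\<^sup>+\<theta>. ennreal (?g \<theta>) * indicator {0..pi/2} \<theta> \<partial>lborel)
       + (\<integral>\<^sup>+\<theta>. ennreal (?g \<theta>) * indicator {pi/2..pi} \<theta> \<partial>lborel))"
    by (simp add: nn_integral_cmult nn_integral_add)
  also have "(\<integral>\<^sup>+\<theta>. ennreal (?g \<theta>) * indicator {pi/2..pi} \<theta> \<partial>lborel) = (\<integral>\<^sup>+\<theta>. ennreal (?g \<theta>) * indicator {0..pi/2} \<theta> \<partial>lborel)"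
    by (subst nn_integral_real_affine[where c="-1" and t=pi])
       (auto intro!: nn_integral_cong simp: indicator_def)
  also have "ennreal ang_const * ((\<integral>\<^sup>+\<theta>. ennreal (?g \<theta>) * indicator {0..pi/2} \<theta> \<partial>lborel)
       + (\<integral>\<^sup>+\<theta>. ennreal (?g \<theta>) * indicator {0..pi/2} \<theta> \<partial>lborel)) = ennreal (ang_const * ?B)"
    unfolding nn_integral_cos_power_half using B less_imp_le[OF ang_const_pos]
    by (simp add: ennreal_plus[symmetric] ennreal_mult[symmetric] del: ennreal_plus)
  also have "ang_const * ?B = pochhammer (1/2) n / pochhammer (\<alpha>+1) n"
  proof -
    have "pochhammer (1/2::real) n = Gamma (1/2 + real n) / Gamma (1/2)"
      by (rule pochhammer_Gamma) (auto elim!: nonpos_Ints_cases)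
    moreover have "pochhammer (\<alpha>+1) n = Gamma (\<alpha>+1 + real n) / Gamma (\<alpha>+1)"
      using alpha_gt by (intro pochhammer_Gamma) (auto elim!: nonpos_Ints_cases)
    moreover have "\<alpha>+1/2 + (real n + 1/2) = \<alpha>+1 + real n" by simp
    ultimately show ?thesis
      unfolding ang_const_def Beta_def using less_imp_neq[OF Gamma_pos(2)] by (simp add: ac_simps)
  qed
  finally show ?thesis .
qed

lemma emeasure_ang [simp]: "emeasure ang UNIV = 1"
  using nn_integral_ang_cos_power[of 0] by simp

sublocale ang: finite_measure ang
  by (rule finite_measureI) simp

lemma measure_ang [simp]: "measure ang UNIV = 1"
  by (simp add: measure_def)

sublocale mu: sigma_finite_measure \<mu>
  by (rule sigma_finite_mu)

lemma pochhammer_alpha_pos: "pochhammer (\<alpha>+1) n > 0"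
  using alpha_gt by (intro pochhammer_pos) auto

text \<open>\<open>fact_double\<close> removes the Pochhammer symbol at 1/2. The numerator
  \<open>fact (2*n)\<close> is the factor that cancels against the Taylor coefficients of the
  cosine.\<close>

lemma integral_ang_cos_power_even:
  "(\<integral>\<theta>. cos \<theta> ^ (2*n) \<partial>ang) = fact (2*n) / (4^n * fact n * pochhammer (\<alpha>+1) n)"
proof -
  have "(\<integral>\<theta>. cos \<theta> ^ (2*n) \<partial>ang) = pochhammer (1/2) n / pochhammer (\<alpha>+1) n"
    using nn_integral_ang_cos_power[of n] pochhammer_alpha_pos[of n]
    by (intro integral_eq_nn_integral[THEN trans]) (auto simp: pochhammer_nonneg)
  also have "\<dots> = fact (2*n) / (4^n * fact n * pochhammer (\<alpha>+1) n)"
    using fact_double[of n, where ?'a=real] by (simp add: power_mult)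
  finally show ?thesis .
qed

lemma integral_ang_cos_power_odd:
  assumes "odd n"
  shows "(\<integral>\<theta>. cos \<theta> ^ n \<partial>ang) = 0"
  using integral_ang_reflect[of "\<lambda>\<theta>. cos \<theta> ^ n"] assms by simp

lemma integrable_ang_bounded:
  fixes f :: "real \<Rightarrow> 'a :: {banach, second_countable_topology}"
  assumes "f \<in> borel_measurable borel" "\<And>x. norm (f x) \<le> B"
  shows "integrable ang f"
  using assms by (intro ang.integrable_const_bound[of _ B]) auto


subsection \<open>The product formula for the Bessel function\<close>

text \<open>Coefficients of the Bessel series in the variable z^2, with the quotient of Gamma values
  turned into a Pochhammer symbol, so that the later identities are purely algebraic.\<close>

definition bcoef :: "nat \<Rightarrow> real" where
  "bcoef n = (-1)^n / (4^n * fact n * pochhammer (\<alpha>+1) n)"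

text \<open>A moment of the cosine under a probability measure is at most 1; by its closed form this
  says that (2n)! is at most 4^n n! (\<alpha>+1)_n. The Bessel series thus has an exponential
  majorant.\<close>

lemma abs_bcoef_le: "\<bar>bcoef n\<bar> \<le> inverse (fact n)"
proof -
  have "(\<integral>\<theta>. cos \<theta> ^ (2*n) \<partial>ang) \<le> (\<integral>\<theta>. 1 \<partial>ang)"
    by (intro integral_mono integrable_ang_bounded[where B=1])
       (auto simp: power_le_one power_abs[symmetric] abs_square_le_1 power_mult)
  then have "fact (2*n) / (4^n * fact n * pochhammer (\<alpha>+1) n) \<le> 1"
    by (simp add: integral_ang_cos_power_even)
  then have "fact (2*n) \<le> 4^n * fact n * pochhammer (\<alpha>+1) n"
    using pochhammer_alpha_pos[of n] by (simp add: divide_le_eq)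
  moreover have "(fact n :: real) \<le> fact (2*n)" by (intro fact_mono) auto
  ultimately have "(fact n :: real) \<le> 4^n * fact n * pochhammer (\<alpha>+1) n" by linarith
  then have "inverse (4^n * fact n * pochhammer (\<alpha>+1) n) \<le> inverse (fact n)"
    by (intro le_imp_inverse_le) auto
  then show ?thesis
    using pochhammer_alpha_pos[of n] by (simp add: bcoef_def abs_mult power_abs divide_inverse)
qed

lemma summable_bcoef: "summable (\<lambda>n. \<bar>bcoef n\<bar> * r ^ n)" if "r \<ge> 0" for r :: real
proof (rule summable_comparison_test'[where N=0])
  show "summable (\<lambda>n. inverse (fact n) * r ^ n)" by (rule summable_exp)
  show "norm (\<bar>bcoef n\<bar> * r ^ n) \<le> inverse (fact n) * r ^ n" for n
    using that abs_bcoef_le[of n] by (auto simp: abs_mult intro!: mult_right_mono)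
qed

lemma summable_bcoef': "summable (\<lambda>n. bcoef n * (z\<^sup>2) ^ n)"
  by (rule summable_norm_cancel) (use summable_bcoef[of "z\<^sup>2"] in \<open>simp add: abs_mult\<close>)

lemma bessel_j_eq: "bessel_j \<alpha> z = (\<Sum>n. bcoef n * (z\<^sup>2) ^ n)"
proof -
  let ?f = "\<lambda>n. (-1)^n / (fact n * Gamma (real n + \<alpha> + 1)) * (z/2)^(2*n)"
  have *: "Gamma (\<alpha>+1) * ?f n = bcoef n * (z\<^sup>2) ^ n" for n
  proof -
    have "pochhammer (\<alpha>+1) n = Gamma (\<alpha>+1 + real n) / Gamma (\<alpha>+1)"
      using alpha_gt by (intro pochhammer_Gamma) (auto elim!: nonpos_Ints_cases)
    moreover have "\<alpha>+1 + real n = real n + \<alpha> + 1" by simp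
    moreover have "(z/2)^(2*n) = (z\<^sup>2)^n / 4^n"
      by (simp add: power_mult power_divide)
    ultimately show ?thesis
      using less_imp_neq[OF Gamma_pos(1)] by (simp add: bcoef_def mult_ac)
  qed
  have "summable (\<lambda>n. Gamma (\<alpha>+1) * ?f n)"
    unfolding * by (rule summable_bcoef')
  then have "summable ?f"
    using less_imp_neq[OF Gamma_pos(1)] by (subst (asm) summable_cmult_iff) auto
  then have "Gamma (\<alpha>+1) * (\<Sum>n. ?f n) = (\<Sum>n. Gamma (\<alpha>+1) * ?f n)"
    by (rule suminf_mult[symmetric])
  then show ?thesis unfolding bessel_j_def * .
qed

lemma bessel_j_measurable [measurable]: "bessel_j \<alpha> \<in> borel_measurable borel"
  unfolding bessel_j_eq[abs_def] by measurable

text \<open>The cosine series is integrated term by term against the even moments. The purpose is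
  the bound \<open>abs_bessel_j_le_1\<close>, which the alternating series does not show.\<close>

lemma bessel_j_Poisson: "bessel_j \<alpha> z = (\<integral>\<theta>. cos (z * cos \<theta>) \<partial>ang)"
proof -
  let ?f = "\<lambda>n \<theta>. (-1)^n / fact (2*n) * (z * cos \<theta>)^(2*n) :: real"
  have le: "norm (?f n \<theta>) \<le> 1 / fact (2*n) * \<bar>z\<bar> ^ (2*n)" for n \<theta>
  proof -
    have "\<bar>z * cos \<theta>\<bar> ^ (2*n) \<le> \<bar>z\<bar> ^ (2*n)"
      by (intro power_mono) (auto simp: abs_mult intro!: mult_left_le)
    then show ?thesis by (simp add: abs_mult power_abs divide_right_mono power_even_abs)
  qed
  have int: "integrable ang (?f n)" for n
    by (rule integrable_ang_bounded[OF _ le]) measurable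
  have sm: "summable (\<lambda>n. 1 / fact (2*n) * \<bar>z\<bar> ^ (2*n))"
  proof (rule summable_comparison_test'[where N=0])
    show "summable (\<lambda>n. inverse (fact n) * (z\<^sup>2) ^ n)" by (rule summable_exp)
    fix n
    have "inverse (fact (2*n)) \<le> (inverse (fact n) :: real)"
      by (intro le_imp_inverse_le fact_mono) auto
    then show "norm (1 / fact (2*n) * \<bar>z\<bar> ^ (2*n)) \<le> inverse (fact n) * (z\<^sup>2) ^ n"
      by (simp add: power_mult divide_inverse mult_right_mono)
  qed
  have "(\<lambda>n. \<integral>\<theta>. ?f n \<theta> \<partial>ang) sums (\<integral>\<theta>. (\<Sum>n. ?f n \<theta>) \<partial>ang)"
  proof (rule sums_integral[OF int])
    show "AE \<theta> in ang. summable (\<lambda>n. norm (?f n \<theta>))"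
      by (intro AE_I2 summable_comparison_test'[OF sm, where N=0]) (use le in auto)
    show "summable (\<lambda>n. \<integral>\<theta>. norm (?f n \<theta>) \<partial>ang)"
    proof (rule summable_comparison_test'[OF sm, where N=0])
      fix n
      have "(\<integral>\<theta>. norm (?f n \<theta>) \<partial>ang) \<le> (\<integral>\<theta>. 1 / fact (2*n) * \<bar>z\<bar> ^ (2*n) \<partial>ang)"
        by (intro integral_mono integrable_norm int le) auto
      then show "norm (\<integral>\<theta>. norm (?f n \<theta>) \<partial>ang) \<le> 1 / fact (2*n) * \<bar>z\<bar> ^ (2*n)"
        by simp
    qed
  qed
  moreover have "(\<Sum>n. ?f n \<theta>) = cos (z * cos \<theta>)" for \<theta>
    using cos_paired[of "z * cos \<theta>"] by (simp add: sums_iff)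
  moreover have "(\<integral>\<theta>. ?f n \<theta> \<partial>ang) = bcoef n * (z\<^sup>2)^n" for n
  proof -
    have "(\<integral>\<theta>. ?f n \<theta> \<partial>ang) = (-1)^n / fact (2*n) * z^(2*n) * (\<integral>\<theta>. cos \<theta> ^ (2*n) \<partial>ang)"
      by (simp add: power_mult_distrib)
    then show ?thesis unfolding integral_ang_cos_power_even by (simp add: bcoef_def power_mult[of z])
  qed
  ultimately show ?thesis by (simp add: sums_iff bessel_j_eq)
qed

lemma abs_bessel_j_le_1: "\<bar>bessel_j \<alpha> z\<bar> \<le> 1"
proof -
  have "norm (\<integral>\<theta>. cos (z * cos \<theta>) \<partial>ang) \<le> (\<integral>\<theta>. norm (cos (z * cos \<theta>)) \<partial>ang)"
    by (rule integral_norm_bound)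
  also have "\<dots> \<le> (\<integral>\<theta>. 1 \<partial>ang)"
    by (intro integral_mono integrable_ang_bounded[where B=1]) auto
  finally show ?thesis by (simp add: bessel_j_Poisson)
qed

text \<open>Chu-Vandermonde for \<open>m gchoose j\<close> and
  \<open>(\<alpha>+n) gchoose (n-j)\<close>, divided by m! (\<alpha>+1)_n. The left side is what the
  law of cosines produces for a monomial of degrees m and n in the two squared sides; in the right
  side the dependence on m and n separates, up to the factor at m+n.\<close>

lemma sum_inverse_fact_pochhammer:
  "(\<Sum>j\<le>min m n. 1 / (fact (m-j) * fact (n-j) * fact j * pochhammer (\<alpha>+1) j))
    = pochhammer (\<alpha>+1) (m+n) / (fact m * fact n * pochhammer (\<alpha>+1) m * pochhammer (\<alpha>+1) n)"
proof -
  note pos = pochhammer_alpha_pos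
  have nz: "pochhammer (\<alpha>+1) k \<noteq> 0" for k using pos[of k] by linarith
  have V: "(\<Sum>j=0..n. (real m gchoose j) * ((\<alpha>+n) gchoose (n-j))) = (real m + (\<alpha>+n)) gchoose n"
    by (rule gbinomial_Vandermonde)
  have R: "(real m + (\<alpha>+n)) gchoose n = pochhammer (\<alpha>+1) (m+n) / (pochhammer (\<alpha>+1) m * fact n)"
  proof -
    have "(real m + (\<alpha>+n)) gchoose n = pochhammer (\<alpha>+1 + real m) n / fact n"
      by (simp add: gbinomial_pochhammer' add_ac)
    then show ?thesis using nz[of m] by (simp add: pochhammer_product')
  qed
  have L: "(real m gchoose j) * ((\<alpha>+n) gchoose (n-j))
      = fact m * pochhammer (\<alpha>+1) n * (1 / (fact (m-j) * fact (n-j) * fact j * pochhammer (\<alpha>+1) j))"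
    if "j \<le> m" "j \<le> n" for j
  proof -
    have "real m gchoose j = fact m / (fact j * fact (m-j))"
      using that by (simp add: binomial_gbinomial[symmetric] binomial_fact)
    moreover have "(\<alpha>+n) gchoose (n-j) = pochhammer (\<alpha>+1 + real j) (n-j) / fact (n-j)"
      using that by (simp add: gbinomial_pochhammer' of_nat_diff add_ac)
    moreover have "pochhammer (\<alpha>+1) n = pochhammer (\<alpha>+1) j * pochhammer (\<alpha>+1 + real j) (n-j)"
      by (rule pochhammer_product[OF that(2)])
    ultimately show ?thesis using nz[of j] by simp
  qed
  have "(\<Sum>j=0..n. (real m gchoose j) * ((\<alpha>+n) gchoose (n-j))) = 
     (\<Sum>j\<le>min m n. (real m gchoose j) * ((\<alpha>+n) gchoose (n-j)))"
    by (rule sum.mono_neutral_right) (auto simp: binomial_gbinomial[symmetric])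
  also have "\<dots> = (\<Sum>j\<le>min m n. fact m * pochhammer (\<alpha>+1) n * (1 / (fact (m-j) * fact (n-j) * fact j * pochhammer (\<alpha>+1) j)))"
    by (intro sum.cong refl L) auto
  also have "\<dots> = fact m * pochhammer (\<alpha>+1) n * (\<Sum>j\<le>min m n. 1 / (fact (m-j) * fact (n-j) * fact j * pochhammer (\<alpha>+1) j))"
    by (rule sum_distrib_left[symmetric])
  finally have "fact m * pochhammer (\<alpha>+1) n * (\<Sum>j\<le>min m n. 1 / (fact (m-j) * fact (n-j) * fact j * pochhammer (\<alpha>+1) j))
     = pochhammer (\<alpha>+1) (m+n) / (pochhammer (\<alpha>+1) m * fact n)"
    using V R by simp
  note eq = this
  have "fact m * pochhammer (\<alpha>+1) n \<noteq> 0" using nz by simp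
  then have "(\<Sum>j\<le>min m n. 1 / (fact (m-j) * fact (n-j) * fact j * pochhammer (\<alpha>+1) j))
     = pochhammer (\<alpha>+1) (m+n) / (pochhammer (\<alpha>+1) m * fact n) / (fact m * pochhammer (\<alpha>+1) n)"
    by (rule eq_divide_imp[OF _ trans[OF mult.commute eq]])
  then show ?thesis by (simp add: mult_ac)
qed

text \<open>Two binomial expansions: in the cosine term against the rest, then of the powers of x^2
  + y^2. Odd powers of the cosine average to zero, and an even power 2j adds j to both exponents. A
  fixed monomial thus collects a sum over j, which is \<open>sum_inverse_fact_pochhammer\<close>
  with n = k - m.\<close>

lemma integral_ang_law_of_cosines_power:
  "(\<integral>\<theta>. (x\<^sup>2 + y\<^sup>2 + 2*x*y*cos \<theta>) ^ k \<partial>ang) =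
    (\<Sum>m\<le>k. fact k * pochhammer (\<alpha>+1) k /
        (fact m * fact (k-m) * pochhammer (\<alpha>+1) m * pochhammer (\<alpha>+1) (k-m)) * ((x\<^sup>2)^m * (y\<^sup>2)^(k-m)))"
proof -
  define M where "M i = (\<integral>\<theta>. cos \<theta> ^ i \<partial>ang)" for i
  define A where "A i l = real (k choose i) * (2*x*y)^i * M i * (real ((k-i) choose l) * (x\<^sup>2)^l * (y\<^sup>2)^(k-i-l))" for i l
  have M_even: "even i" if "M i \<noteq> 0" for i
    using that integral_ang_cos_power_odd[of i] unfolding M_def by blast
  have int: "integrable ang (\<lambda>\<theta>. cos \<theta> ^ i)" for i
    by (rule integrable_ang_bounded[where B=1]) (auto simp: power_abs power_le_one)
  have "(\<integral>\<theta>. (x\<^sup>2 + y\<^sup>2 + 2*x*y*cos \<theta>) ^ k \<partial>ang) =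
      (\<integral>\<theta>. (\<Sum>i\<le>k. real (k choose i) * (2*x*y)^i * (x\<^sup>2+y\<^sup>2)^(k-i) * cos \<theta> ^ i) \<partial>ang)"
  proof (intro Bochner_Integration.integral_cong refl)
    fix \<theta>
    have "(x\<^sup>2 + y\<^sup>2 + 2*x*y*cos \<theta>) ^ k = (2*x*y*cos \<theta> + (x\<^sup>2+y\<^sup>2)) ^ k" by (simp add: add_ac)
    also have "\<dots> = (\<Sum>i\<le>k. real (k choose i) * (2*x*y*cos \<theta>)^i * (x\<^sup>2+y\<^sup>2)^(k-i))"
      by (rule binomial_ring)
    finally show "(x\<^sup>2 + y\<^sup>2 + 2*x*y*cos \<theta>) ^ k = (\<Sum>i\<le>k. real (k choose i) * (2*x*y)^i * (x\<^sup>2+y\<^sup>2)^(k-i) * cos \<theta> ^ i)"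
      by (simp add: power_mult_distrib mult_ac)
  qed
  also have "\<dots> = (\<Sum>i\<le>k. real (k choose i) * (2*x*y)^i * (x\<^sup>2+y\<^sup>2)^(k-i) * M i)"
    by (subst Bochner_Integration.integral_sum) (auto intro!: int simp: M_def)
  also have "\<dots> = (\<Sum>i\<le>k. \<Sum>l\<le>k-i. A i l)"
    unfolding binomial_ring[of "x\<^sup>2" "y\<^sup>2"] A_def by (simp add: sum_distrib_left sum_distrib_right mult_ac)
  also have "\<dots> = (\<Sum>(i,l)\<in>(SIGMA i:{..k}. {..k-i}). A i l)"
    by (rule sum.Sigma) auto
  also have "\<dots> = (\<Sum>(i,l)\<in>{(i,l). i \<le> k \<and> even i \<and> l \<le> k-i}. A i l)"
    by (rule sum.mono_neutral_right) (auto simp: A_def dest: M_even)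
  \<comment> \<open>With i = 2j the total exponent of x^2 is m = l + j. The conditions 0 \<le> l and
    l \<le> k - i turn into j \<le> m and j \<le> k - m.\<close>
  also have "\<dots> = (\<Sum>(m,j)\<in>(SIGMA m:{..k}. {..min m (k-m)}). A (2*j) (m-j))"
    by (rule sum.reindex_bij_witness[where i="\<lambda>(m,j). (2*j, m-j)" and j="\<lambda>(i,l). (l + i div 2, i div 2)"])
       (auto elim!: evenE)
  also have "\<dots> = (\<Sum>m\<le>k. \<Sum>j\<le>min m (k-m). A (2*j) (m-j))"
    by (rule sum.Sigma[symmetric]) auto
  also have "\<dots> = (\<Sum>m\<le>k. fact k * pochhammer (\<alpha>+1) k /
        (fact m * fact (k-m) * pochhammer (\<alpha>+1) m * pochhammer (\<alpha>+1) (k-m)) * ((x\<^sup>2)^m * (y\<^sup>2)^(k-m)))"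
  proof (intro sum.cong refl)
    fix m assume "m \<in> {..k}"
    then have mk: "m \<le> k" by simp
    have "A (2*j) (m-j) = fact k * ((x\<^sup>2)^m * (y\<^sup>2)^(k-m)) *
        (1 / (fact (m-j) * fact (k-m-j) * fact j * pochhammer (\<alpha>+1) j))" if j: "j \<le> m" "j \<le> k-m" for j
    proof -
      have e: "k - 2*j - (m-j) = k - m - j" using j mk by simp
      have 1: "real (k choose (2*j)) = fact k / (fact (2*j) * fact (k - 2*j))"
        using j mk by (intro binomial_fact) simp
      have 2: "real ((k-2*j) choose (m-j)) = fact (k-2*j) / (fact (m-j) * fact (k-m-j))"
        using j mk binomial_fact[of "m-j" "k-2*j", where ?'a=real] by (simp add: e add.commute)
      have 3: "(2*x*y)^(2*j) = 4^j * (x\<^sup>2)^j * (y\<^sup>2)^j"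
        by (simp add: power_mult power_mult_distrib)
      have 4: "(x\<^sup>2)^m = (x\<^sup>2)^j * (x\<^sup>2)^(m-j)" "(y\<^sup>2)^(k-m) = (y\<^sup>2)^j * (y\<^sup>2)^(k-m-j)"
        by (simp_all only: power_add[symmetric] le_add_diff_inverse[OF j(1)] le_add_diff_inverse[OF j(2)])
      have nz: "(fact (2*j) :: real) \<noteq> 0" "(fact (k-2*j) :: real) \<noteq> 0" "(4::real)^j \<noteq> 0" by auto
      have "A (2*j) (m-j) = (fact k / (fact (2*j) * fact (k - 2*j))) * (4^j * (x\<^sup>2)^j * (y\<^sup>2)^j) *
          (fact (2*j) / (4^j * fact j * pochhammer (\<alpha>+1) j)) *
          ((fact (k-2*j) / (fact (m-j) * fact (k-m-j))) * (x\<^sup>2)^(m-j) * (y\<^sup>2)^(k-m-j))"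
        unfolding A_def M_def e 1 2 3 integral_ang_cos_power_even ..
      also have "\<dots> = fact k * ((x\<^sup>2)^m * (y\<^sup>2)^(k-m)) *
        (1 / (fact (m-j) * fact (k-m-j) * fact j * pochhammer (\<alpha>+1) j))"
        unfolding 4 using nz pochhammer_alpha_pos[of j] by (simp add: divide_simps)
      finally show ?thesis .
    qed
    then have "(\<Sum>j\<le>min m (k-m). A (2*j) (m-j)) = fact k * ((x\<^sup>2)^m * (y\<^sup>2)^(k-m)) *
        (\<Sum>j\<le>min m (k-m). 1 / (fact (m-j) * fact (k-m-j) * fact j * pochhammer (\<alpha>+1) j))"
      unfolding sum_distrib_left by (intro sum.cong refl) auto
    also note sum_inverse_fact_pochhammer
    finally show "(\<Sum>j\<le>min m (k-m). A (2*j) (m-j)) = fact k * pochhammer (\<alpha>+1) k /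
        (fact m * fact (k-m) * pochhammer (\<alpha>+1) m * pochhammer (\<alpha>+1) (k-m)) * ((x\<^sup>2)^m * (y\<^sup>2)^(k-m))"
      using mk by simp
  qed
  finally show ?thesis .
qed

text \<open>The third side of a triangle whose sides x and y enclose the angle pi - \<theta>; the
  plus sign is the convention of the Hankel translation. The radicand is nonnegative for all real x
  and y, so the basic facts carry no sign conditions.\<close>

definition cos_dist :: "real \<Rightarrow> real \<Rightarrow> real \<Rightarrow> real" where
  "cos_dist x y \<theta> = sqrt (x\<^sup>2 + y\<^sup>2 + 2*x*y*cos \<theta>)"

lemma
  fixes x y :: real
  shows cos_dist_sq_le: "x\<^sup>2 + y\<^sup>2 + 2*x*y*cos \<theta> \<le> (\<bar>x\<bar>+\<bar>y\<bar>)\<^sup>2"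
  and cos_dist_sq_ge: "(\<bar>x\<bar>-\<bar>y\<bar>)\<^sup>2 \<le> x\<^sup>2 + y\<^sup>2 + 2*x*y*cos \<theta>"
proof -
  have "\<bar>2*x*y*cos \<theta>\<bar> \<le> 2*\<bar>x\<bar>*\<bar>y\<bar>"
    using mult_left_le[of "\<bar>cos \<theta>\<bar>" "\<bar>x\<bar>*\<bar>y\<bar>"] by (simp add: abs_mult mult_ac)
  then show "x\<^sup>2 + y\<^sup>2 + 2*x*y*cos \<theta> \<le> (\<bar>x\<bar>+\<bar>y\<bar>)\<^sup>2" "(\<bar>x\<bar>-\<bar>y\<bar>)\<^sup>2 \<le> x\<^sup>2 + y\<^sup>2 + 2*x*y*cos \<theta>"
    by (auto simp: power2_sum power2_diff)
qed

lemma cos_dist_sq_nonneg: "0 \<le> x\<^sup>2 + y\<^sup>2 + 2*x*y*cos \<theta>" for x y :: real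
  by (rule order_trans[OF _ cos_dist_sq_ge]) simp

lemma cos_dist_power2: "(cos_dist x y \<theta>)\<^sup>2 = x\<^sup>2 + y\<^sup>2 + 2*x*y*cos \<theta>"
  unfolding cos_dist_def using cos_dist_sq_nonneg by simp

lemma cos_dist_nonneg [simp]: "cos_dist x y \<theta> \<ge> 0"
  unfolding cos_dist_def using cos_dist_sq_nonneg by simp

lemma cos_dist_commute: "cos_dist x y \<theta> = cos_dist y x \<theta>"
  by (simp add: cos_dist_def add_ac mult_ac)

lemma cos_dist_measurable [measurable]:
  assumes [measurable]: "f \<in> borel_measurable M" "g \<in> borel_measurable M" "h \<in> borel_measurable M"
  shows "(\<lambda>x. cos_dist (f x) (g x) (h x)) \<in> borel_measurable M"
  unfolding cos_dist_def by measurable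

text \<open>The Bessel series at \<xi> times the third side is integrated term by term, with sides u
  = x\<xi> and v = y\<xi>. In the average of its n-th term the factorial and the Pochhammer symbol
  at n cancel against \<open>bcoef n\<close>, and what is left is the n-th term of the Cauchy
  product of the two series.\<close>

lemma bessel_j_product: "(\<integral>\<theta>. bessel_j \<alpha> (\<xi> * cos_dist x y \<theta>) \<partial>ang) = bessel_j \<alpha> (x*\<xi>) * bessel_j \<alpha> (y*\<xi>)"
proof -
  define u where "u = x*\<xi>"
  define v where "v = y*\<xi>"
  define Q where "Q \<theta> = u\<^sup>2 + v\<^sup>2 + 2 * u * v * cos \<theta>" for \<theta>
  have j: "bessel_j \<alpha> (\<xi> * cos_dist x y \<theta>) = (\<Sum>n. bcoef n * Q \<theta> ^ n)" for \<theta>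
  proof -
    have "(\<xi> * cos_dist x y \<theta>)\<^sup>2 = Q \<theta>"
      unfolding power_mult_distrib cos_dist_power2 Q_def u_def v_def
      by (simp add: algebra_simps power2_eq_square)
    then show ?thesis by (simp add: bessel_j_eq)
  qed
  let ?B = "(\<bar>u\<bar>+\<bar>v\<bar>)\<^sup>2"
  have le: "norm (bcoef n * Q \<theta> ^ n) \<le> \<bar>bcoef n\<bar> * ?B ^ n" for n \<theta>
    using cos_dist_sq_le[of u v \<theta>] cos_dist_sq_nonneg[of u v \<theta>]
    by (auto simp: abs_mult power_abs Q_def intro!: mult_left_mono power_mono)
  have [measurable]: "Q \<in> borel_measurable borel" unfolding Q_def by measurable
  have int: "integrable ang (\<lambda>\<theta>. bcoef n * Q \<theta> ^ n)" for n
    by (rule integrable_ang_bounded[OF _ le]) measurable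
  have sm: "summable (\<lambda>n. \<bar>bcoef n\<bar> * ?B ^ n)" by (rule summable_bcoef) auto
  have "(\<lambda>n. \<integral>\<theta>. bcoef n * Q \<theta> ^ n \<partial>ang) sums (\<integral>\<theta>. (\<Sum>n. bcoef n * Q \<theta> ^ n) \<partial>ang)"
  proof (rule sums_integral[OF int])
    show "AE \<theta> in ang. summable (\<lambda>n. norm (bcoef n * Q \<theta> ^ n))"
      by (intro AE_I2 summable_comparison_test'[OF sm, where N=0]) (use le in auto)
    show "summable (\<lambda>n. \<integral>\<theta>. norm (bcoef n * Q \<theta> ^ n) \<partial>ang)"
    proof (rule summable_comparison_test'[OF sm, where N=0])
      fix n
      have "(\<integral>\<theta>. norm (bcoef n * Q \<theta> ^ n) \<partial>ang) \<le> (\<integral>\<theta>. \<bar>bcoef n\<bar> * ?B ^ n \<partial>ang)"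
        by (intro integral_mono integrable_norm int le) auto
      then show "norm (\<integral>\<theta>. norm (bcoef n * Q \<theta> ^ n) \<partial>ang) \<le> \<bar>bcoef n\<bar> * ?B ^ n"
        by simp
    qed
  qed
  moreover have "(\<integral>\<theta>. bcoef n * Q \<theta> ^ n \<partial>ang)
      = (\<Sum>m\<le>n. (bcoef m * (u\<^sup>2)^m) * (bcoef (n-m) * (v\<^sup>2)^(n-m)))" for n
  proof -
    have "(\<integral>\<theta>. bcoef n * Q \<theta> ^ n \<partial>ang) = bcoef n * (\<integral>\<theta>. Q \<theta> ^ n \<partial>ang)" by simp
    also have "\<dots> = (\<Sum>m\<le>n. bcoef n * (fact n * pochhammer (\<alpha>+1) n /
        (fact m * fact (n-m) * pochhammer (\<alpha>+1) m * pochhammer (\<alpha>+1) (n-m)) * ((u\<^sup>2)^m * (v\<^sup>2)^(n-m))))"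
      unfolding Q_def integral_ang_law_of_cosines_power by (rule sum_distrib_left)
    also have "\<dots> = (\<Sum>m\<le>n. (bcoef m * (u\<^sup>2)^m) * (bcoef (n-m) * (v\<^sup>2)^(n-m)))"
    proof (intro sum.cong refl)
      fix m assume "m \<in> {..n}"
      then have m: "(-1::real)^n = (-1)^m * (-1)^(n-m)" "(4::real)^n = 4^m * 4^(n-m)"
        by (simp_all flip: power_add)
      have "pochhammer (\<alpha>+1) k \<noteq> 0" for k using pochhammer_alpha_pos[of k] by linarith
      then show "bcoef n * (fact n * pochhammer (\<alpha>+1) n /
        (fact m * fact (n-m) * pochhammer (\<alpha>+1) m * pochhammer (\<alpha>+1) (n-m)) * ((u\<^sup>2)^m * (v\<^sup>2)^(n-m)))
        = (bcoef m * (u\<^sup>2)^m) * (bcoef (n-m) * (v\<^sup>2)^(n-m))"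
        unfolding bcoef_def m by (simp add: mult_ac)
    qed
    finally show ?thesis .
  qed
  moreover have "(\<lambda>n. \<Sum>m\<le>n. (bcoef m * (u\<^sup>2)^m) * (bcoef (n-m) * (v\<^sup>2)^(n-m))) sums
     ((\<Sum>n. bcoef n * (u\<^sup>2)^n) * (\<Sum>n. bcoef n * (v\<^sup>2)^n))"
    by (rule Cauchy_product_sums) (use summable_bcoef[of "u\<^sup>2"] summable_bcoef[of "v\<^sup>2"] in \<open>simp_all add: abs_mult\<close>)
  ultimately have "(\<integral>\<theta>. (\<Sum>n. bcoef n * Q \<theta> ^ n) \<partial>ang) = bessel_j \<alpha> u * bessel_j \<alpha> v"
    unfolding bessel_j_eq by (metis (no_types, lifting) sums_unique2 sums_cong)
  then show ?thesis unfolding j u_def v_def .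
qed


subsection \<open>Symmetry of the Hankel translation\<close>

text \<open>Sixteen times the squared area of a triangle with sides \<open>x\<close>, \<open>t\<close>, \<open>s\<close>.\<close>

definition heron :: "real \<Rightarrow> real \<Rightarrow> real \<Rightarrow> real" where
  "heron x t s = (2*x*t)\<^sup>2 - (s\<^sup>2 - x\<^sup>2 - t\<^sup>2)\<^sup>2"

text \<open>The density of \<open>s = cos_dist x t \<theta>\<close> under the angular measure.\<close>

definition dist_dens :: "real \<Rightarrow> real \<Rightarrow> real \<Rightarrow> real" where
  "dist_dens x t s = ang_const * s / (x*t) * (heron x t s / (2*x*t)\<^sup>2) powr (\<alpha> - 1/2)"

lemma dist_dens_measurable [measurable]:
  assumes [measurable]: "f \<in> borel_measurable M" "g \<in> borel_measurable M" "h \<in> borel_measurable M"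
  shows "(\<lambda>x. dist_dens (f x) (g x) (h x)) \<in> borel_measurable M"
  unfolding dist_dens_def heron_def by measurable

text \<open>In expanded form the expression is symmetric in all three sides. This is the algebraic
  core of the symmetry of the translation.\<close>

lemma heron_commute: "heron x t s = heron x s t"
  unfolding heron_def by (simp add: power2_eq_square algebra_simps)

lemma heron_nonneg:
  assumes "\<bar>x - t\<bar> \<le> s" "s \<le> x + t"
  shows "heron x t s \<ge> 0"
proof -
  have "heron x t s = ((x+t)\<^sup>2 - s\<^sup>2) * (s\<^sup>2 - (x-t)\<^sup>2)"
    unfolding heron_def by (simp add: power2_eq_square algebra_simps)
  moreover have "s\<^sup>2 \<le> (x+t)\<^sup>2" using assms by (intro power_mono) auto
  moreover have "(x-t)\<^sup>2 \<le> s\<^sup>2" using assms(1) abs_le_square_iff[of "x-t" s] by auto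
  ultimately show ?thesis by simp
qed

text \<open>Substitution by the third side s. When t = x the third side can shrink to zero, where
  the square root is not differentiable; this single value of t does not matter once t is
  integrated.\<close>

lemma nn_integral_ang_cos_dist:
  assumes [measurable]: "F \<in> borel_measurable borel" and x: "x > 0" and t: "t > 0" and ne: "t \<noteq> x"
  shows "(\<integral>\<^sup>+\<theta>. F (cos_dist x t \<theta>) \<partial>ang) =
    (\<integral>\<^sup>+s. F s * ennreal (dist_dens x t s) * indicator {\<bar>x - t\<bar>..x + t} s \<partial>lborel)"
proof -
  \<comment> \<open>With pi - \<theta> the third side increases in \<theta>, from |x - t| to x + t,
    so the derivative in the substitution is nonnegative.\<close>
  define g where "g \<theta> = cos_dist x t (pi - \<theta>)" for \<theta>
  define g' where "g' \<theta> = x * t * sin \<theta> / g \<theta>" for \<theta>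
  have g_eq: "g = (\<lambda>\<theta>. sqrt (x\<^sup>2 + t\<^sup>2 - 2*x*t*cos \<theta>))"
    by (simp add: g_def[abs_def] cos_dist_def)
  have pos: "x\<^sup>2 + t\<^sup>2 - 2*x*t*cos \<theta> > 0" for \<theta>
  proof -
    have "0 < (\<bar>x\<bar>-\<bar>t\<bar>)\<^sup>2" using x t ne by simp
    also have "\<dots> \<le> x\<^sup>2 + t\<^sup>2 + 2*x*t*cos (pi - \<theta>)" by (rule cos_dist_sq_ge)
    finally show ?thesis by simp
  qed
  have gpos: "g \<theta> > 0" for \<theta> using pos[of \<theta>] by (simp add: g_eq)
  have gder: "(g has_real_derivative g' \<theta>) (at \<theta>)" for \<theta>
    unfolding g'_def g_eq using pos[of \<theta>]
    by (auto intro!: derivative_eq_intros simp: field_simps)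
  have gcont: "continuous_on A g" for A
    unfolding g_eq by (intro continuous_intros)
  have g'cont: "continuous_on {0..pi} g'"
    unfolding g'_def using gpos less_imp_neq[OF gpos]
    by (intro continuous_intros gcont) auto
  have g0: "g 0 = \<bar>x - t\<bar>"
  proof -
    have "x\<^sup>2 + t\<^sup>2 - 2*x*t*cos 0 = (x-t)\<^sup>2" by (simp add: power2_eq_square algebra_simps)
    then show ?thesis unfolding g_eq by simp
  qed
  have gpi: "g pi = x + t"
  proof -
    have "x\<^sup>2 + t\<^sup>2 - 2*x*t*cos pi = (x+t)\<^sup>2" by (simp add: power2_eq_square algebra_simps)
    then show ?thesis unfolding g_eq using x t by simp
  qed
  have dens: "dist_dens x t (g \<theta>) * g' \<theta> = ang_const * sin \<theta> powr (2*\<alpha>)" if "sin \<theta> > 0" for \<theta>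
  proof -
    have g_sq: "(g \<theta>)\<^sup>2 = x\<^sup>2 + t\<^sup>2 - 2*x*t*cos \<theta>" unfolding g_eq using pos[of \<theta>] by simp
    \<comment> \<open>The triangle with sides x, t and included angle \<theta> has area x t sin
      \<theta> / 2, and sixteen times its square is (2 x t sin \<theta>)^2.\<close>
    have "heron x t (g \<theta>) = (2*x*t)\<^sup>2 * (1 - (cos \<theta>)\<^sup>2)"
      unfolding heron_def g_sq by (simp add: power2_eq_square algebra_simps)
    then have "heron x t (g \<theta>) / (2*x*t)\<^sup>2 = (sin \<theta>)\<^sup>2"
      using x t by (simp add: sin_squared_eq)
    then have "dist_dens x t (g \<theta>) * g' \<theta> = ang_const * (g \<theta> / g \<theta>) * ((x*t) / (x*t)) * ((sin \<theta> powr (2*(\<alpha>-1/2))) * sin \<theta> powr 1)"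
      unfolding dist_dens_def g'_def using that by (simp add: power2_powr mult_ac)
    also have "(sin \<theta> powr (2*(\<alpha>-1/2))) * sin \<theta> powr 1 = sin \<theta> powr (2*\<alpha>)"
      by (subst powr_add[symmetric]) simp
    finally show ?thesis using x t gpos[of \<theta>] by simp
  qed
  have "(\<integral>\<^sup>+s. F s * ennreal (dist_dens x t s) * indicator {\<bar>x - t\<bar>..x + t} s \<partial>lborel) =
     (\<integral>\<^sup>+\<theta>. F (g \<theta>) * ennreal (dist_dens x t (g \<theta>)) * ennreal (g' \<theta>) * indicator {0..pi} \<theta> \<partial>lborel)"
    unfolding g0[symmetric] gpi[symmetric]
  proof (rule nn_integral_substitution_aux)
    show "g' \<theta> \<ge> 0" if "\<theta> \<in> {0..pi}" for \<theta>
      unfolding g'_def using that x t gpos[of \<theta>] by (intro divide_nonneg_pos mult_nonneg_nonneg sin_ge_zero) auto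
  qed (use gder g'cont in auto)
  also have "\<dots> = (\<integral>\<^sup>+\<theta>. ennreal (ang_weight \<theta>) * F (g \<theta>) \<partial>lborel)"
  proof (intro nn_integral_cong_AE)
    have "AE \<theta> in lborel. \<theta> \<noteq> (0::real)" "AE \<theta> in lborel. \<theta> \<noteq> pi"
      by (rule AE_lborel_singleton)+
    then show "AE \<theta> in lborel. F (g \<theta>) * ennreal (dist_dens x t (g \<theta>)) * ennreal (g' \<theta>) * indicator {0..pi} \<theta>
       = ennreal (ang_weight \<theta>) * F (g \<theta>)"
    proof eventually_elim
      case (elim \<theta>)
      show ?case
      proof (cases "\<theta> \<in> {0..pi}")
        case True
        with elim have s: "sin \<theta> > 0" by (intro sin_gt_zero) auto
        have "g' \<theta> \<ge> 0" unfolding g'_def using s x t gpos[of \<theta>] by (simp add: divide_nonneg_pos)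
        then have "ennreal (dist_dens x t (g \<theta>)) * ennreal (g' \<theta>) = ennreal (ang_weight \<theta>)"
          using True by (simp add: dens[OF s] ang_weight_def flip: ennreal_mult'')
        then show ?thesis
          using True by (simp add: mult.assoc mult.commute[of "ennreal (ang_weight \<theta>)"])
      qed (simp add: ang_weight_def)
    qed
  qed
  also have "\<dots> = (\<integral>\<^sup>+\<theta>. F (cos_dist x t (pi - \<theta>)) \<partial>ang)"
    unfolding g_def by (subst nn_integral_ang) auto
  also have "\<dots> = (\<integral>\<^sup>+\<theta>. F (cos_dist x t \<theta>) \<partial>ang)"
    by (rule nn_integral_ang_reflect) measurable
  finally show ?thesis ..
qed

text \<open>The powers of the outer variable u collapse, because u^(2\<alpha>+1) / (u *
  u^(2\<alpha>-1)) = u. What remains is a factor depending on x only, the product t s, and a power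
  of \<open>heron\<close>. All are symmetric in t and s, and so is the triangle inequality encoded
  by the indicator.\<close>

lemma mu_weight_dist_dens_sym:
  assumes x: "x > 0"
  shows "mu_weight t * dist_dens x t s * indicator {\<bar>x - t\<bar>..x + t} s
       = mu_weight s * dist_dens x s t * indicator {\<bar>x - s\<bar>..x + s} t"
proof (cases "t > 0 \<and> s > 0")
  case True
  then have t: "t > 0" and s: "s > 0" by auto
  have ind: "(indicator {\<bar>x - t\<bar>..x + t} s :: real) = indicator {\<bar>x - s\<bar>..x + s} t"
    by (auto simp: indicator_def)
  have *: "mu_weight u * dist_dens x u v =
       u * v * (ang_const / (2 powr \<alpha> * Gamma (\<alpha>+1)) * (heron x u v powr (\<alpha>-1/2) / (x * (2*x) powr (2*\<alpha>-1))))"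
    if "u > 0" "heron x u v \<ge> 0" for u v
  proof -
    have "(2*x*u)\<^sup>2 powr (\<alpha>-1/2) = (2*x) powr (2*\<alpha>-1) * u powr (2*\<alpha>-1)"
      using that x by (simp add: power2_powr powr_mult)
    then have "mu_weight u * dist_dens x u v = ang_const / (2 powr \<alpha> * Gamma (\<alpha>+1)) *
        (heron x u v powr (\<alpha>-1/2) / (x * (2*x) powr (2*\<alpha>-1))) * v * (u powr (2*\<alpha>+1) / (u * u powr (2*\<alpha>-1)))"
      unfolding mu_weight_def dist_dens_def using that x by (simp add: powr_divide mult_ac)
    also have "u powr (2*\<alpha>+1) / (u * u powr (2*\<alpha>-1)) = u"
    proof -
      have "u powr (2*\<alpha>+1) = u powr (2*\<alpha>-1) * u powr 2"
        by (subst powr_add[symmetric]) (simp add: add.commute)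
      also have "\<dots> = u powr (2*\<alpha>-1) * (u * u)"
        using that by (simp add: power2_eq_square)
      finally show ?thesis using that by simp
    qed
    finally show ?thesis by (simp add: mult_ac)
  qed
  show ?thesis
  proof (cases "s \<in> {\<bar>x - t\<bar>..x + t}")
    case True
    then have "heron x t s \<ge> 0" by (intro heron_nonneg) auto
    moreover from this have "heron x s t \<ge> 0" by (simp add: heron_commute)
    ultimately have "mu_weight t * dist_dens x t s = mu_weight s * dist_dens x s t"
      using *[of t s] *[of s t] t s by (simp add: heron_commute[of x s t] mult_ac)
    then show ?thesis by (simp add: ind)
  next
    case False
    then show ?thesis by (simp add: ind[symmetric])
  qed
next
  case False
  \<comment> \<open>At t = 0 or s = 0 one side vanishes by division by zero and the other by the
    factor that is the third argument of \<open>dist_dens\<close>. For negative values the weight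
    vanishes on one side and the indicator on the other.\<close>
  then consider "t < 0" | "s < 0" | "t = 0" | "s = 0" by linarith
  then show ?thesis
    by cases (auto simp: mu_weight_def dist_dens_def indicator_def)
qed

text \<open>Tonelli for a symmetric kernel in the plane: integrating out the angle leaves the
  density \<open>dist_dens\<close> of the third side against \<mu>. \<open>F\<close> may be any
  function of the pair, so factors on both coordinates are exchanged at once.\<close>

lemma nn_integral_swap:
  fixes F :: "real \<times> real \<Rightarrow> ennreal"
  assumes [measurable]: "F \<in> borel_measurable (borel \<Otimes>\<^sub>M borel)" and x: "x > 0"
  shows "(\<integral>\<^sup>+t. \<integral>\<^sup>+\<theta>. F (t, cos_dist x t \<theta>) \<partial>ang \<partial>\<mu>) = (\<integral>\<^sup>+t. \<integral>\<^sup>+\<theta>. F (cos_dist x t \<theta>, t) \<partial>ang \<partial>\<mu>)"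
proof -
  define K where "K t s = ennreal (mu_weight t * dist_dens x t s * indicator {\<bar>x - t\<bar>..x + t} s)" for t s
  have K_sym: "K t s = K s t" for t s
    unfolding K_def mu_weight_dist_dens_sym[OF x, of t s] ..
  have [measurable]: "(\<lambda>p. indicator {\<bar>x - fst p\<bar>..x + fst p} (snd p) :: real) \<in> borel_measurable (borel \<Otimes>\<^sub>M borel)"
    unfolding indicator_def atLeastAtMost_iff by measurable
  have K_meas: "(\<lambda>p. K (fst p) (snd p)) \<in> borel_measurable (borel \<Otimes>\<^sub>M borel)"
    unfolding K_def by measurable
  have [measurable]: "(\<lambda>p. K (f p) (g p)) \<in> borel_measurable M" 
    if "f \<in> borel_measurable M" "g \<in> borel_measurable M" for f g and M :: "'z measure"
    using measurable_compose[OF measurable_Pair[OF that] K_meas] by simp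
  have *: "(\<integral>\<^sup>+t. \<integral>\<^sup>+\<theta>. G (t, cos_dist x t \<theta>) \<partial>ang \<partial>\<mu>) = (\<integral>\<^sup>+t. \<integral>\<^sup>+s. G (t, s) * K t s \<partial>lborel \<partial>lborel)"
    if [measurable]: "G \<in> borel_measurable (borel \<Otimes>\<^sub>M borel)" for G :: "real \<times> real \<Rightarrow> ennreal"
  proof -
    have "AE t in \<mu>. t \<noteq> x"
      using AE_lborel_singleton[of x] by (auto simp: AE_mu_iff)
    with AE_mu_pos have "(\<integral>\<^sup>+t. \<integral>\<^sup>+\<theta>. G (t, cos_dist x t \<theta>) \<partial>ang \<partial>\<mu>) = 
      (\<integral>\<^sup>+t. \<integral>\<^sup>+s. G (t, s) * ennreal (dist_dens x t s) * indicator {\<bar>x - t\<bar>..x + t} s \<partial>lborel \<partial>\<mu>)"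
      by (intro nn_integral_cong_AE, eventually_elim) (subst nn_integral_ang_cos_dist, use x in auto)
    also have "\<dots> = (\<integral>\<^sup>+t. ennreal (mu_weight t) * (\<integral>\<^sup>+s. G (t, s) * ennreal (dist_dens x t s) * indicator {\<bar>x - t\<bar>..x + t} s \<partial>lborel) \<partial>lborel)"
      unfolding indicator_def atLeastAtMost_iff by (rule nn_integral_mu) measurable
    also have "\<dots> = (\<integral>\<^sup>+t. \<integral>\<^sup>+s. G (t, s) * K t s \<partial>lborel \<partial>lborel)"
    proof (intro nn_integral_cong)
      fix t :: real
      have "(\<integral>\<^sup>+s. G (t, s) * K t s \<partial>lborel) = (\<integral>\<^sup>+s. ennreal (mu_weight t) * (G (t, s) * ennreal (dist_dens x t s) * indicator {\<bar>x - t\<bar>..x + t} s) \<partial>lborel)"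
        unfolding K_def by (intro nn_integral_cong) (auto simp: ennreal_mult' mult_ac indicator_def)
      also have "\<dots> = ennreal (mu_weight t) * (\<integral>\<^sup>+s. G (t, s) * ennreal (dist_dens x t s) * indicator {\<bar>x - t\<bar>..x + t} s \<partial>lborel)"
        by (rule nn_integral_cmult) measurable
      finally show "ennreal (mu_weight t) * (\<integral>\<^sup>+s. G (t, s) * ennreal (dist_dens x t s) * indicator {\<bar>x - t\<bar>..x + t} s \<partial>lborel)
          = (\<integral>\<^sup>+s. G (t, s) * K t s \<partial>lborel)" ..
    qed
    finally show ?thesis .
  qed
  have "(\<integral>\<^sup>+t. \<integral>\<^sup>+\<theta>. F (t, cos_dist x t \<theta>) \<partial>ang \<partial>\<mu>) = (\<integral>\<^sup>+t. \<integral>\<^sup>+s. F (t, s) * K t s \<partial>lborel \<partial>lborel)"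
    by (rule *) measurable
  also have "\<dots> = (\<integral>\<^sup>+s. \<integral>\<^sup>+t. F (t, s) * K t s \<partial>lborel \<partial>lborel)"
    by (rule lborel_pair.Fubini'[symmetric]) measurable
  also have "\<dots> = (\<integral>\<^sup>+s. \<integral>\<^sup>+t. F (t, s) * K s t \<partial>lborel \<partial>lborel)"
    by (simp only: K_sym)
  also have "\<dots> = (\<integral>\<^sup>+t. \<integral>\<^sup>+\<theta>. F (cos_dist x t \<theta>, t) \<partial>ang \<partial>\<mu>)"
    using *[of "\<lambda>(s, t). F (t, s)"] by simp
  finally show ?thesis .
qed

section \<open>The exchange symmetry as an identity of image measures\<close>

abbreviation "mu_ang \<equiv> \<mu> \<Otimes>\<^sub>M ang"

text \<open>Stated for measures, so that integrals of vector-valued functions, and integrability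
  itself, transfer without a decomposition into nonnegative parts.\<close>

lemma distr_swap:
  assumes "x > 0"
  shows "distr mu_ang (borel \<Otimes>\<^sub>M borel) (\<lambda>p. (fst p, cos_dist x (fst p) (snd p)))
       = distr mu_ang (borel \<Otimes>\<^sub>M borel) (\<lambda>p. (cos_dist x (fst p) (snd p), fst p))"
proof (rule measure_eqI)
  fix A assume "A \<in> sets (distr mu_ang (borel \<Otimes>\<^sub>M borel) (\<lambda>p. (fst p, cos_dist x (fst p) (snd p))))"
  then have [measurable]: "A \<in> sets (borel \<Otimes>\<^sub>M borel)" by simp
  have *: "emeasure (distr mu_ang (borel \<Otimes>\<^sub>M borel) h) A = (\<integral>\<^sup>+t. \<integral>\<^sup>+\<theta>. indicator A (h (t, \<theta>)) \<partial>ang \<partial>\<mu>)"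
    if [measurable]: "h \<in> measurable mu_ang (borel \<Otimes>\<^sub>M borel)" for h :: "real \<times> real \<Rightarrow> real \<times> real"
  proof -
    have "emeasure (distr mu_ang (borel \<Otimes>\<^sub>M borel) h) A = (\<integral>\<^sup>+z. indicator A z \<partial>distr mu_ang (borel \<Otimes>\<^sub>M borel) h)"
      by simp
    also have "\<dots> = (\<integral>\<^sup>+p. indicator A (h p) \<partial>mu_ang)"
      by (rule nn_integral_distr) measurable
    also have "\<dots> = (\<integral>\<^sup>+t. \<integral>\<^sup>+\<theta>. indicator A (h (t, \<theta>)) \<partial>ang \<partial>\<mu>)"
      by (rule ang.nn_integral_fst[symmetric]) measurable
    finally show ?thesis .
  qed
  show "emeasure (distr mu_ang (borel \<Otimes>\<^sub>M borel) (\<lambda>p. (fst p, cos_dist x (fst p) (snd p)))) A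
      = emeasure (distr mu_ang (borel \<Otimes>\<^sub>M borel) (\<lambda>p. (cos_dist x (fst p) (snd p), fst p))) A"
    using nn_integral_swap[of "indicator A" x] assms by (subst (1 2) *) auto
qed simp

lemma distr_fst: "distr mu_ang borel fst = \<mu>"
proof (rule measure_eqI)
  fix A assume "A \<in> sets (distr mu_ang borel (fst :: real \<times> real \<Rightarrow> real))"
  then have [measurable]: "A \<in> sets borel" by simp
  have "emeasure (distr mu_ang borel fst) A = emeasure mu_ang (A \<times> UNIV)"
    by (subst emeasure_distr) (auto simp: space_pair_measure intro!: arg_cong[where f="emeasure mu_ang"])
  also have "\<dots> = emeasure \<mu> A"
    by (subst ang.emeasure_pair_measure_Times) auto
  finally show "emeasure (distr mu_ang borel fst) A = emeasure \<mu> A" .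
qed simp

text \<open>The two marginals of an exchangeable measure agree, and one of them is \<mu> because
  \<open>ang\<close> has mass one. This is the invariance of \<mu> under translation.\<close>

lemma distr_cos_dist:
  assumes "x > 0"
  shows "distr mu_ang borel (\<lambda>p. cos_dist x (fst p) (snd p)) = \<mu>"
proof -
  have "distr mu_ang borel (\<lambda>p. cos_dist x (fst p) (snd p))
      = distr (distr mu_ang (borel \<Otimes>\<^sub>M borel) (\<lambda>p. (cos_dist x (fst p) (snd p), fst p))) borel fst"
    by (subst distr_distr) (auto simp: comp_def)
  also have "\<dots> = distr (distr mu_ang (borel \<Otimes>\<^sub>M borel) (\<lambda>p. (fst p, cos_dist x (fst p) (snd p)))) borel fst"
    by (simp only: distr_swap[OF assms])
  also have "\<dots> = distr mu_ang borel fst"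
    by (subst distr_distr) (auto simp: comp_def)
  finally show ?thesis by (simp add: distr_fst)
qed

lemma integral_swap:
  fixes f :: "real \<times> real \<Rightarrow> 'a :: {banach, second_countable_topology}"
  assumes [measurable]: "f \<in> borel_measurable (borel \<Otimes>\<^sub>M borel)" and x: "x > 0"
  shows "(\<integral>p. f (fst p, cos_dist x (fst p) (snd p)) \<partial>mu_ang) = (\<integral>p. f (cos_dist x (fst p) (snd p), fst p) \<partial>mu_ang)"
  using arg_cong[OF distr_swap[OF x], of "\<lambda>M. integral\<^sup>L M f"] by (simp add: integral_distr)

lemma integrable_swap:
  fixes f :: "real \<times> real \<Rightarrow> 'a :: {banach, second_countable_topology}"
  assumes [measurable]: "f \<in> borel_measurable (borel \<Otimes>\<^sub>M borel)" and x: "x > 0"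
  shows "integrable mu_ang (\<lambda>p. f (fst p, cos_dist x (fst p) (snd p))) \<longleftrightarrow> integrable mu_ang (\<lambda>p. f (cos_dist x (fst p) (snd p), fst p))"
  using arg_cong[OF distr_swap[OF x], of "\<lambda>M. integrable M f"] by (simp add: integrable_distr_eq)

lemma integrable_mu_ang_fst:
  fixes f :: "real \<Rightarrow> 'a :: {banach, second_countable_topology}"
  assumes "integrable \<mu> f"
  shows "integrable mu_ang (\<lambda>p. f (fst p))"
proof -
  have [measurable]: "f \<in> borel_measurable borel"
    using borel_measurable_integrable[OF assms] by simp
  from assms have "integrable (distr mu_ang borel fst) f" by (simp add: distr_fst)
  then show ?thesis by (subst (asm) integrable_distr_eq) auto
qed

lemma integrable_mu_ang_cos_dist:
  fixes f :: "real \<Rightarrow> 'a :: {banach, second_countable_topology}"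
  assumes "integrable \<mu> f" "x > 0"
  shows "integrable mu_ang (\<lambda>p. f (cos_dist x (fst p) (snd p)))"
proof -
  have [measurable]: "f \<in> borel_measurable borel"
    using borel_measurable_integrable[OF assms(1)] by simp
  from assms have "integrable (distr mu_ang borel (\<lambda>p. cos_dist x (fst p) (snd p))) f" by (simp add: distr_cos_dist)
  then show ?thesis by (subst (asm) integrable_distr_eq) auto
qed

lemma nn_integral_mu_ang_fst:
  assumes [measurable]: "f \<in> borel_measurable borel"
  shows "(\<integral>\<^sup>+p. f (fst p) \<partial>mu_ang) = (\<integral>\<^sup>+t. f t \<partial>\<mu>)"
  using arg_cong[OF distr_fst, of "\<lambda>M. integral\<^sup>N M f"] by (simp add: nn_integral_distr)

lemma nn_integral_mu_ang_cos_dist: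
  assumes [measurable]: "f \<in> borel_measurable borel" and "x > 0"
  shows "(\<integral>\<^sup>+p. f (cos_dist x (fst p) (snd p)) \<partial>mu_ang) = (\<integral>\<^sup>+t. f t \<partial>\<mu>)"
  using arg_cong[OF distr_cos_dist[OF assms(2)], of "\<lambda>M. integral\<^sup>N M f"] by (simp add: nn_integral_distr)

end

text \<open>Substitution on each compact interval, then continuity from below of the two density
  measures along the growing intervals. The applications exhaust half-lines, once with a singular
  endpoint.\<close>

lemma nn_integral_substitution_exhausting:
  fixes f :: "real \<Rightarrow> ennreal" and g g' :: "real \<Rightarrow> real" and l u :: "nat \<Rightarrow> real"
  assumes [measurable]: "f \<in> borel_measurable borel" "g \<in> borel_measurable borel" "g' \<in> borel_measurable borel"
    and der: "\<And>n x. x \<in> {l n..u n} \<Longrightarrow> (g has_real_derivative g' x) (at x)"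
    and cont: "\<And>n. continuous_on {l n..u n} g'"
    and nonneg: "\<And>n x. x \<in> {l n..u n} \<Longrightarrow> g' x \<ge> 0"
    and lu: "\<And>n. l n < u n" and l: "decseq l" and u: "incseq u"
  shows "(\<integral>\<^sup>+x. f x * indicator (\<Union>n. {g (l n)..g (u n)}) x \<partial>lborel)
      = (\<integral>\<^sup>+x. f (g x) * ennreal (g' x) * indicator (\<Union>n. {l n..u n}) x \<partial>lborel)"
proof -
  let ?A = "\<lambda>n. {l n..u n}" and ?B = "\<lambda>n. {g (l n)..g (u n)}"
  \<comment> \<open>The image intervals are nested only if g is monotone, which the sign of g'
    provides.\<close>
  have mono_g: "g x \<le> g y" if "x \<in> ?A n" "y \<in> ?A n" "x \<le> y" for x y n
    using that by (intro DERIV_nonneg_imp_nondecreasing[of x y g]) (auto intro!: exI[of _ "g' _"] der[of _ n] nonneg[of _ n])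
  have A: "incseq ?A"
    unfolding incseq_def using l u by (force simp: decseq_def incseq_def intro: order_trans)
  have B: "incseq ?B"
  proof (rule incseq_SucI)
    fix n
    have "l (Suc n) \<le> l n" "u n \<le> u (Suc n)" using l u by (auto simp: decseq_SucD incseq_SucD)
    then have "g (l (Suc n)) \<le> g (l n)" "g (u n) \<le> g (u (Suc n))"
      using lu[of n] by (auto intro!: mono_g[of _ "Suc n"])
    then show "?B n \<subseteq> ?B (Suc n)" by auto
  qed
  let ?F = "density lborel f" and ?G = "density lborel (\<lambda>x. f (g x) * ennreal (g' x))"
  have "(\<integral>\<^sup>+x. f x * indicator (\<Union>n. ?B n) x \<partial>lborel) = emeasure ?F (\<Union>n. ?B n)"
    by (subst emeasure_density) auto
  also have "\<dots> = (SUP n. emeasure ?F (?B n))"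
    by (rule SUP_emeasure_incseq[symmetric]) (use B in auto)
  also have "\<dots> = (SUP n. emeasure ?G (?A n))"
  proof (intro SUP_cong refl)
    fix n
    have "emeasure ?F (?B n) = (\<integral>\<^sup>+x. f x * indicator (?B n) x \<partial>lborel)"
      by (subst emeasure_density) auto
    also have "\<dots> = (\<integral>\<^sup>+x. f (g x) * ennreal (g' x) * indicator (?A n) x \<partial>lborel)"
      by (rule nn_integral_substitution_aux) (use der nonneg cont lu in auto)
    also have "\<dots> = emeasure ?G (?A n)"
      by (subst emeasure_density) auto
    finally show "emeasure ?F (?B n) = emeasure ?G (?A n)" .
  qed
  also have "\<dots> = emeasure ?G (\<Union>n. ?A n)"
    by (rule SUP_emeasure_incseq) (use A in auto)
  also have "\<dots> = (\<integral>\<^sup>+x. f (g x) * ennreal (g' x) * indicator (\<Union>n. ?A n) x \<partial>lborel)"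
    by (subst emeasure_density) auto
  finally show ?thesis .
qed

lemma (in pair_sigma_finite) integrable_dominated_product:
  fixes h :: "'a \<times> 'b \<Rightarrow> 'c :: {banach, second_countable_topology}" and F :: "'a \<Rightarrow> real" and G :: "'b \<Rightarrow> real"
  assumes [measurable]: "h \<in> borel_measurable (M1 \<Otimes>\<^sub>M M2)"
    and F: "integrable M1 F" and G: "integrable M2 G"
    and le: "\<And>x y. norm (h (x, y)) \<le> F x * G y"
  shows "integrable (M1 \<Otimes>\<^sub>M M2) h"
proof -
  have [measurable]: "F \<in> borel_measurable M1" "G \<in> borel_measurable M2" using F G by auto
  have "integrable (M1 \<Otimes>\<^sub>M M2) (\<lambda>p. F (fst p) * G (snd p))"
    by (rule Fubini_integrable) (use F G in \<open>auto simp: abs_mult\<close>)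
  then show ?thesis
    by (rule Bochner_Integration.integrable_bound) (auto intro!: AE_I2 order_trans[OF le abs_ge_self])
qed

section \<open>The Gaussian and its Hankel transform\<close>

definition gauss :: "real \<Rightarrow> real" where
  "gauss x = exp (- x\<^sup>2 / 2)"

lemma gauss_measurable [measurable]: "gauss \<in> borel_measurable borel"
  unfolding gauss_def by measurable

lemma gauss_nonneg [simp]: "gauss x \<ge> 0" and gauss_le_1: "gauss x \<le> 1"
  by (auto simp: gauss_def)

context hankel_setup
begin

sublocale mumu: pair_sigma_finite \<mu> \<mu> ..
sublocale muang: pair_sigma_finite \<mu> ang ..

text \<open>The substitution t = x^2/2 in the Gamma integral at n + \<alpha> + 1. The factor
  2^\<alpha> Gamma(\<alpha>+1) in \<mu> is the one that gives the Gaussian total mass 1.\<close>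

lemma nn_integral_gauss_moment:
  "(\<integral>\<^sup>+x. ennreal ((x\<^sup>2)^n * gauss x) \<partial>\<mu>) = ennreal (2^n * pochhammer (\<alpha>+1) n)"
proof -
  let ?q = "real n + \<alpha> + 1"
  have q: "?q > 0" using alpha_gt by simp
  define C where "C = 2 powr \<alpha> * Gamma (\<alpha>+1)"
  have C: "C > 0" unfolding C_def by simp
  let ?f = "\<lambda>t::real. ennreal (t powr (?q - 1) / exp t)"
  \<comment> \<open>\<open>Suc k\<close> rather than \<open>k\<close>, since the interval for k = 0
    must be nondegenerate too.\<close>
  have eq: "(\<Union>k. {0..real (Suc k)}) = {0..}"
  proof -
    have "\<exists>k. x \<le> real (Suc k)" for x
    proof -
      obtain k where "x \<le> real k" using real_arch_simple by blast
      then have "x \<le> real (Suc k)" by simp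
      then show ?thesis ..
    qed
    then show ?thesis by auto
  qed
  have eq2: "(\<Union>k. {0\<^sup>2/2..(real (Suc k))\<^sup>2/2}) = {0..}"
  proof -
    have "\<exists>k. x \<le> (real (Suc k))\<^sup>2/2" for x
    proof -
      obtain k where "2 * x \<le> real k" using real_arch_simple by blast
      also have "\<dots> \<le> (real (Suc k))\<^sup>2" by (simp add: power2_eq_square algebra_simps)
      finally have "x \<le> (real (Suc k))\<^sup>2/2" by simp
      then show ?thesis ..
    qed
    then show ?thesis by auto
  qed
  have "ennreal (Gamma ?q) = (\<integral>\<^sup>+t. ?f t * indicator {0..} t \<partial>lborel)"
    unfolding Gamma_conv_nn_integral_real[OF q]
    by (intro nn_integral_cong) (auto simp: indicator_def)
  also have "\<dots> = (\<integral>\<^sup>+x. ?f (x\<^sup>2/2) * ennreal x * indicator {0..} x \<partial>lborel)"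
  proof -
    have "(\<integral>\<^sup>+t. ?f t * indicator (\<Union>k. {0\<^sup>2/2..(real (Suc k))\<^sup>2/2}) t \<partial>lborel)
        = (\<integral>\<^sup>+x. ?f (x\<^sup>2/2) * ennreal x * indicator (\<Union>k. {0..real (Suc k)}) x \<partial>lborel)"
      by (rule nn_integral_substitution_exhausting)
         (auto intro!: derivative_eq_intros simp: decseq_def incseq_def)
    then show ?thesis by (simp only: eq eq2)
  qed
  also have "\<dots> = (\<integral>\<^sup>+x. ennreal (C * (1/2) powr (?q-1)) * (ennreal (mu_weight x) * ennreal ((x\<^sup>2)^n * gauss x)) \<partial>lborel)"
  proof (intro nn_integral_cong_AE)
    have "AE x in lborel. x \<noteq> (0::real)" by (rule AE_lborel_singleton)
    then show "AE x in lborel. ?f (x\<^sup>2/2) * ennreal x * indicator {0..} x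
      = ennreal (C * (1/2) powr (?q-1)) * (ennreal (mu_weight x) * ennreal ((x\<^sup>2)^n * gauss x))"
    proof eventually_elim
      case (elim x)
      show ?case
      proof (cases "x > 0")
        case True
        have "(x\<^sup>2/2) powr (?q-1) * x = (1/2) powr (?q-1) * ((x\<^sup>2) powr (?q-1) * x)"
          using True powr_mult[of "1/2" "x\<^sup>2" "?q-1"] by simp
        also have "(x\<^sup>2) powr (?q-1) * x = x powr (2 * real n + (2*\<alpha>+1))"
        proof -
          have "(x\<^sup>2) powr (?q-1) * x = x powr (2*(?q-1)) * x powr 1" using True by (simp add: power2_powr)
          also have "\<dots> = x powr (2*(?q-1) + 1)" by (rule powr_add[symmetric])
          finally show ?thesis by (simp add: algebra_simps)
        qed
        also have "\<dots> = x powr real (2*n) * x powr (2*\<alpha>+1)" by (simp add: powr_add)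
        also have "x powr real (2*n) = (x\<^sup>2)^n" using True by (simp only: powr_realpow power_mult)
        finally have "(x\<^sup>2/2) powr (?q-1) * x = (1/2) powr (?q-1) * ((x\<^sup>2)^n * x powr (2*\<alpha>+1))" .
        then have "(x\<^sup>2/2) powr (?q-1) / exp (x\<^sup>2/2) * x = C * (1/2) powr (?q-1) * (mu_weight x * ((x\<^sup>2)^n * gauss x))"
          using True C less_imp_neq[OF Gamma_pos(1), symmetric] unfolding C_def mu_weight_def gauss_def
          by (simp add: exp_minus divide_simps)
        then show ?thesis using True C
          by (simp add: ennreal_mult'[symmetric] ennreal_mult''[symmetric] del: ennreal_mult)
      next
        case False
        with elim show ?thesis by (simp add: mu_weight_def)
      qed
    qed
  qed
  also have "\<dots> = ennreal (C * (1/2) powr (?q-1)) * (\<integral>\<^sup>+x. ennreal ((x\<^sup>2)^n * gauss x) \<partial>\<mu>)"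
    by (subst nn_integral_cmult, measurable) (simp add: nn_integral_mu)
  finally have *: "ennreal (Gamma ?q) = ennreal (C * (1/2) powr (?q-1)) * (\<integral>\<^sup>+x. ennreal ((x\<^sup>2)^n * gauss x) \<partial>\<mu>)" .
  have G: "Gamma ?q = C * (1/2) powr (?q-1) * (2^n * pochhammer (\<alpha>+1) n)"
  proof -
    have "pochhammer (\<alpha>+1) n = Gamma (\<alpha>+1 + real n) / Gamma (\<alpha>+1)"
      using alpha_gt by (intro pochhammer_Gamma) (auto elim!: nonpos_Ints_cases)
    moreover have "(1/2::real) powr (?q-1) = (1/2) ^ n / 2 powr \<alpha>"
      by (simp add: powr_divide powr_add powr_realpow power_divide)
    ultimately show ?thesis
      using less_imp_neq[OF Gamma_pos(1)] unfolding C_def by (simp add: ac_simps power_divide)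
  qed
  define c where "c = C * (1/2) powr (?q-1)"
  have c: "c > 0" unfolding c_def using C by simp
  have "ennreal (1/c) * ennreal (c * (2^n * pochhammer (\<alpha>+1) n)) = ennreal (1/c) * (ennreal c * (\<integral>\<^sup>+x. ennreal ((x\<^sup>2)^n * gauss x) \<partial>\<mu>))"
    using * G unfolding c_def by simp
  moreover have "ennreal (1/c) * (ennreal c * X) = X" for X
    unfolding mult.assoc[symmetric] using c by (subst ennreal_mult[symmetric]) auto
  moreover have "ennreal (1/c) * ennreal (c * (2^n * pochhammer (\<alpha>+1) n)) = ennreal (2^n * pochhammer (\<alpha>+1) n)"
    using c by (subst ennreal_mult'[symmetric]) auto
  ultimately show ?thesis by simp
qed

lemma gauss_moment:
  "integrable \<mu> (\<lambda>x. (x\<^sup>2)^n * gauss x)" "(\<integral>x. (x\<^sup>2)^n * gauss x \<partial>\<mu>) = 2^n * pochhammer (\<alpha>+1) n"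
proof -
  show "integrable \<mu> (\<lambda>x. (x\<^sup>2)^n * gauss x)"
    using nn_integral_gauss_moment[of n] by (intro integrableI_bounded) (auto simp: abs_mult)
  show "(\<integral>x. (x\<^sup>2)^n * gauss x \<partial>\<mu>) = 2^n * pochhammer (\<alpha>+1) n"
    using nn_integral_gauss_moment[of n] less_imp_le[OF pochhammer_alpha_pos[of n]]
    by (subst integral_eq_nn_integral) auto
qed

lemma integrable_gauss: "integrable \<mu> gauss"
  using gauss_moment(1)[of 0] by simp

lemma integral_gauss: "(\<integral>x. gauss x \<partial>\<mu>) = 1"
  using gauss_moment(2)[of 0] by simp

text \<open>The moment 2^n (\<alpha>+1)_n cancels the Pochhammer symbol of \<open>bcoef n\<close>
  and one of the factors 2^n in 4^n, which leaves the exponential series of -r^2/2. The same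
  cancellation in absolute values justifies the exchange of sum and integral.\<close>

lemma integral_gauss_bessel: "(\<integral>\<xi>. gauss \<xi> * bessel_j \<alpha> (r * \<xi>) \<partial>\<mu>) = gauss r"
proof -
  let ?f = "\<lambda>n \<xi>. bcoef n * (r\<^sup>2)^n * ((\<xi>\<^sup>2)^n * gauss \<xi>)"
  have e: "(4::real)^n = 2^n * 2^n" for n by (simp flip: power_mult_distrib)
  have b: "bcoef n * (r\<^sup>2)^n * (2^n * pochhammer (\<alpha>+1) n) = inverse (fact n) * (- r\<^sup>2/2)^n" for n
    using pochhammer_alpha_pos[of n] unfolding bcoef_def e
    by (simp add: power_divide power_minus' divide_simps)
  have b': "\<bar>bcoef n\<bar> * (r\<^sup>2)^n * (2^n * pochhammer (\<alpha>+1) n) = inverse (fact n) * (r\<^sup>2/2)^n" for n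
    using pochhammer_alpha_pos[of n] unfolding bcoef_def e
    by (simp add: power_divide divide_simps abs_mult)
  have "(\<lambda>n. \<integral>\<xi>. ?f n \<xi> \<partial>\<mu>) sums (\<integral>\<xi>. (\<Sum>n. ?f n \<xi>) \<partial>\<mu>)"
  proof (rule sums_integral)
    show "integrable \<mu> (?f n)" for n
      by (intro integrable_mult_right gauss_moment)
    show "AE \<xi> in \<mu>. summable (\<lambda>n. norm (?f n \<xi>))"
    proof (intro AE_I2)
      fix \<xi>
      have "summable (\<lambda>n. \<bar>bcoef n\<bar> * (r\<^sup>2 * \<xi>\<^sup>2)^n * gauss \<xi>)"
        by (intro summable_mult2 summable_bcoef) auto
      then show "summable (\<lambda>n. norm (?f n \<xi>))" by (simp add: abs_mult power_mult_distrib mult_ac)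
    qed
    have "(\<integral>\<xi>. norm (?f n \<xi>) \<partial>\<mu>) = inverse (fact n) * (r\<^sup>2/2)^n" for n
    proof -
      have "(\<integral>\<xi>. norm (?f n \<xi>) \<partial>\<mu>) = (\<integral>\<xi>. \<bar>bcoef n\<bar> * (r\<^sup>2)^n * ((\<xi>\<^sup>2)^n * gauss \<xi>) \<partial>\<mu>)"
        by (simp add: abs_mult)
      also have "\<dots> = \<bar>bcoef n\<bar> * (r\<^sup>2)^n * (2^n * pochhammer (\<alpha>+1) n)"
        by (subst integral_mult_right_zero) (simp only: gauss_moment(2))
      finally show ?thesis by (simp only: b')
    qed
    then show "summable (\<lambda>n. \<integral>\<xi>. norm (?f n \<xi>) \<partial>\<mu>)" by (simp only: summable_exp)
  qed
  moreover have "(\<integral>\<xi>. ?f n \<xi> \<partial>\<mu>) = inverse (fact n) * (- r\<^sup>2/2)^n" for n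
    by (subst integral_mult_right_zero) (simp only: gauss_moment(2) b)
  moreover have "(\<Sum>n. ?f n \<xi>) = gauss \<xi> * bessel_j \<alpha> (r * \<xi>)" for \<xi>
  proof -
    have "gauss \<xi> * bessel_j \<alpha> (r * \<xi>) = (\<Sum>n. gauss \<xi> * (bcoef n * ((r*\<xi>)\<^sup>2)^n))"
      unfolding bessel_j_eq by (rule suminf_mult[symmetric]) (rule summable_bcoef')
    then show ?thesis by (simp add: power_mult_distrib mult_ac)
  qed
  ultimately have "(\<lambda>n. inverse (fact n) * (- r\<^sup>2/2)^n) sums (\<integral>\<xi>. gauss \<xi> * bessel_j \<alpha> (r * \<xi>) \<partial>\<mu>)"
    by simp
  moreover have "(\<lambda>n. inverse (fact n) * (- r\<^sup>2/2)^n) sums exp (- r\<^sup>2/2)"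
    using exp_converges[of "- r\<^sup>2/2"] by simp
  ultimately show ?thesis unfolding gauss_def by (rule sums_unique2)
qed

lemma integral_gauss_bessel_scaled:
  assumes "\<epsilon> > 0"
  shows "(\<integral>\<xi>. gauss (\<epsilon> * \<xi>) * bessel_j \<alpha> (r * \<xi>) \<partial>\<mu>) = gauss (r / \<epsilon>) / \<epsilon> powr (2*\<alpha>+2)"
proof -
  have "gauss (r/\<epsilon>) = (\<integral>\<xi>. gauss \<xi> * bessel_j \<alpha> (r/\<epsilon> * \<xi>) \<partial>\<mu>)"
    by (rule integral_gauss_bessel[symmetric])
  also have "\<dots> = \<epsilon> powr (2*\<alpha>+2) *\<^sub>R (\<integral>\<xi>. gauss (\<epsilon> * \<xi>) * bessel_j \<alpha> (r/\<epsilon> * (\<epsilon> * \<xi>)) \<partial>\<mu>)"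
    by (rule integral_mu_scale) (use assms in auto)
  finally show ?thesis using assms by simp
qed

end

subsection \<open>Plancherel theorem\<close>

lemma cnj_borel_measurable [measurable]: "cnj \<in> borel_measurable borel"
  by (intro borel_measurable_continuous_onI continuous_intros)

context hankel_setup
begin

lemma hankel_measurable [measurable]:
  assumes [measurable]: "f \<in> borel_measurable borel"
  shows "hankel \<alpha> f \<in> borel_measurable borel"
  unfolding hankel_def by measurable

lemma integrable_mult_bessel:
  fixes f :: "real \<Rightarrow> complex"
  assumes "integrable \<mu> f"
  shows "integrable \<mu> (\<lambda>x. f x * complex_of_real (bessel_j \<alpha> (x * \<xi>)))"
proof (rule Bochner_Integration.integrable_bound[OF assms])
  have [measurable]: "f \<in> borel_measurable borel" using assms by auto
  show "(\<lambda>x. f x * complex_of_real (bessel_j \<alpha> (x * \<xi>))) \<in> borel_measurable \<mu>" by measurable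
  show "AE x in \<mu>. norm (f x * complex_of_real (bessel_j \<alpha> (x * \<xi>))) \<le> norm (f x)"
    by (intro AE_I2) (auto simp: norm_mult intro!: mult_left_le abs_bessel_j_le_1)
qed

lemma norm_hankel_le:
  assumes "integrable \<mu> f"
  shows "norm (hankel \<alpha> f \<xi>) \<le> (\<integral>x. norm (f x) \<partial>\<mu>)"
proof -
  have "norm (hankel \<alpha> f \<xi>) \<le> (\<integral>x. norm (f x * complex_of_real (bessel_j \<alpha> (x * \<xi>))) \<partial>\<mu>)"
    unfolding hankel_def by (rule integral_norm_bound)
  also have "\<dots> \<le> (\<integral>x. norm (f x) \<partial>\<mu>)"
    by (intro integral_mono integrable_norm integrable_mult_bessel assms)
       (auto simp: norm_mult intro!: mult_left_le abs_bessel_j_le_1)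
  finally show ?thesis .
qed

lemma integrable_gauss_scaled: "\<epsilon> > 0 \<Longrightarrow> integrable \<mu> (\<lambda>\<xi>. gauss (\<epsilon> * \<xi>))"
  by (rule integrable_mu_scale[OF integrable_gauss])

text \<open>The product formula merges the two Bessel factors into one whose parameter is the third
  side. The Gaussian makes Fubini applicable, the Bessel function itself being merely
  bounded.\<close>

lemma integral_gauss_bessel_product:
  assumes "\<epsilon> > 0"
  shows "(\<integral>\<xi>. gauss (\<epsilon> * \<xi>) * (bessel_j \<alpha> (y * \<xi>) * bessel_j \<alpha> (x * \<xi>)) \<partial>\<mu>)
    = (\<integral>\<theta>. gauss (cos_dist y x \<theta> / \<epsilon>) / \<epsilon> powr (2*\<alpha>+2) \<partial>ang)"
proof -
  let ?h = "\<lambda>\<xi> \<theta>. gauss (\<epsilon> * \<xi>) * bessel_j \<alpha> (cos_dist y x \<theta> * \<xi>)"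
  have int: "integrable mu_ang (case_prod ?h)"
  proof (rule muang.integrable_dominated_product[where F="\<lambda>\<xi>. gauss (\<epsilon> * \<xi>)" and G="\<lambda>_. 1"])
    show "integrable ang (\<lambda>\<theta>. 1 :: real)" by (rule integrable_ang_bounded[where B=1]) auto
    show "norm (case (\<xi>, \<theta>) of (\<xi>, \<theta>) \<Rightarrow> ?h \<xi> \<theta>) \<le> gauss (\<epsilon> * \<xi>) * 1" for \<xi> \<theta>
      by (auto simp: abs_mult intro!: mult_left_le abs_bessel_j_le_1)
  qed (use integrable_gauss_scaled[OF assms] in auto)
  have "(\<integral>\<xi>. gauss (\<epsilon> * \<xi>) * (bessel_j \<alpha> (y * \<xi>) * bessel_j \<alpha> (x * \<xi>)) \<partial>\<mu>) = (\<integral>\<xi>. (\<integral>\<theta>. ?h \<xi> \<theta> \<partial>ang) \<partial>\<mu>)"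
    by (simp add: bessel_j_product mult.commute[of "cos_dist y x _"])
  also have "\<dots> = (\<integral>\<theta>. (\<integral>\<xi>. ?h \<xi> \<theta> \<partial>\<mu>) \<partial>ang)"
    by (rule muang.Fubini_integral[OF int, symmetric])
  finally show ?thesis by (simp only: integral_gauss_bessel_scaled[OF assms])
qed

text \<open>The left side is the regularised inverse transform at y. On the right \<epsilon> occurs
  only inside the argument of \<open>u\<close>, against a fixed probability density, so its limit
  needs no more than continuity and boundedness of \<open>u\<close>.\<close>

lemma integral_hankel_gauss_bessel:
  fixes u :: "real \<Rightarrow> complex"
  assumes u: "integrable \<mu> u" and B: "\<And>x. norm (u x) \<le> B" and \<epsilon>: "\<epsilon> > 0" and y: "y > 0"
  shows "(\<integral>\<xi>. hankel \<alpha> u \<xi> * complex_of_real (gauss (\<epsilon> * \<xi>) * bessel_j \<alpha> (y * \<xi>)) \<partial>\<mu>)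
    = (\<integral>p. u (cos_dist y (\<epsilon> * fst p) (snd p)) * complex_of_real (gauss (fst p)) \<partial>mu_ang)"
proof -
  have [measurable]: "u \<in> borel_measurable borel" using u by auto
  have int1: "integrable ang (\<lambda>\<theta>. 1::real)" by (rule integrable_ang_bounded[where B=1]) auto
  define C where "C = \<epsilon> powr (2*\<alpha>+2)"
  have C: "C > 0" using \<epsilon> by (simp add: C_def)
  let ?j = "\<lambda>x. complex_of_real (bessel_j \<alpha> x)" and ?G = "\<lambda>x. complex_of_real (gauss x)"
  let ?h = "\<lambda>\<xi> x. u x * (?G (\<epsilon> * \<xi>) * (?j (y * \<xi>) * ?j (x * \<xi>)))"
  have "(\<integral>\<xi>. hankel \<alpha> u \<xi> * complex_of_real (gauss (\<epsilon> * \<xi>) * bessel_j \<alpha> (y * \<xi>)) \<partial>\<mu>) = (\<integral>\<xi>. (\<integral>x. ?h \<xi> x \<partial>\<mu>) \<partial>\<mu>)"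
  proof (rule Bochner_Integration.integral_cong[OF refl])
    fix \<xi>
    have "hankel \<alpha> u \<xi> * complex_of_real (gauss (\<epsilon> * \<xi>) * bessel_j \<alpha> (y * \<xi>)) 
       = (\<integral>x. u x * ?j (x * \<xi>) * complex_of_real (gauss (\<epsilon> * \<xi>) * bessel_j \<alpha> (y * \<xi>)) \<partial>\<mu>)"
      unfolding hankel_def by (rule integral_mult_left_zero[symmetric])
    then show "hankel \<alpha> u \<xi> * complex_of_real (gauss (\<epsilon> * \<xi>) * bessel_j \<alpha> (y * \<xi>)) = (\<integral>x. ?h \<xi> x \<partial>\<mu>)"
      by (simp add: mult_ac)
  qed
  also have "\<dots> = (\<integral>x. (\<integral>\<xi>. ?h \<xi> x \<partial>\<mu>) \<partial>\<mu>)"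
  proof (rule mumu.Fubini_integral[symmetric], rule mumu.integrable_dominated_product[where F="\<lambda>\<xi>. gauss (\<epsilon> * \<xi>)" and G="\<lambda>x. norm (u x)"])
    show "integrable \<mu> (\<lambda>x. norm (u x))" using u by (rule integrable_norm)
    show "norm (case (\<xi>, x) of (\<xi>, x) \<Rightarrow> ?h \<xi> x) \<le> gauss (\<epsilon> * \<xi>) * norm (u x)" for \<xi> x
    proof -
      have "\<bar>bessel_j \<alpha> (y * \<xi>)\<bar> * \<bar>bessel_j \<alpha> (x * \<xi>)\<bar> \<le> 1 * 1"
        by (intro mult_mono abs_bessel_j_le_1) auto
      then have "(norm (u x) * gauss (\<epsilon> * \<xi>)) * (\<bar>bessel_j \<alpha> (y * \<xi>)\<bar> * \<bar>bessel_j \<alpha> (x * \<xi>)\<bar>) \<le> norm (u x) * gauss (\<epsilon> * \<xi>)"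
        by (intro mult_left_le) auto
      then show ?thesis by (simp add: norm_mult mult_ac)
    qed
  qed (use integrable_gauss_scaled[OF \<epsilon>] in auto)
  also have "\<dots> = (\<integral>x. (\<integral>\<theta>. u x * ?G (cos_dist y x \<theta> / \<epsilon>) / complex_of_real C \<partial>ang) \<partial>\<mu>)"
  proof (rule Bochner_Integration.integral_cong[OF refl])
    fix x
    have "(\<integral>\<xi>. ?h \<xi> x \<partial>\<mu>) = (\<integral>\<xi>. u x * complex_of_real (gauss (\<epsilon> * \<xi>) * (bessel_j \<alpha> (y * \<xi>) * bessel_j \<alpha> (x * \<xi>))) \<partial>\<mu>)"
      by simp
    also have "\<dots> = u x * complex_of_real (\<integral>\<xi>. gauss (\<epsilon> * \<xi>) * (bessel_j \<alpha> (y * \<xi>) * bessel_j \<alpha> (x * \<xi>)) \<partial>\<mu>)"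
      by (simp only: integral_mult_right_zero integral_complex_of_real)
    also have "\<dots> = u x * complex_of_real (\<integral>\<theta>. gauss (cos_dist y x \<theta> / \<epsilon>) / C \<partial>ang)"
      unfolding C_def by (simp only: integral_gauss_bessel_product[OF \<epsilon>])
    also have "\<dots> = (\<integral>\<theta>. u x * complex_of_real (gauss (cos_dist y x \<theta> / \<epsilon>) / C) \<partial>ang)"
      by (simp only: integral_mult_right_zero integral_complex_of_real)
    finally show "(\<integral>\<xi>. ?h \<xi> x \<partial>\<mu>) = (\<integral>\<theta>. u x * ?G (cos_dist y x \<theta> / \<epsilon>) / complex_of_real C \<partial>ang)"
      by simp
  qed
  also have "\<dots> = (\<integral>p. u (fst p) * ?G (cos_dist y (fst p) (snd p) / \<epsilon>) / complex_of_real C \<partial>mu_ang)"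
  proof -
    have "integrable mu_ang (\<lambda>p. u (fst p) * ?G (cos_dist y (fst p) (snd p) / \<epsilon>) / complex_of_real C)"
    proof (rule muang.integrable_dominated_product[where F="\<lambda>x. norm (u x) / C" and G="\<lambda>_. 1"])
      show "norm (u (fst (x, \<theta>)) * ?G (cos_dist y (fst (x, \<theta>)) (snd (x, \<theta>)) / \<epsilon>) / complex_of_real C) \<le> (norm (u x) / C) * 1" for x \<theta>
        using C by (auto simp: norm_mult norm_divide intro!: divide_right_mono mult_left_le gauss_le_1)
    qed (use u int1 in auto)
    from muang.integral_fst'[OF this] show ?thesis by (simp only: fst_conv snd_conv)
  qed
  \<comment> \<open>The exchange symmetry moves the Gaussian from the third side to the integration
    variable and puts \<open>u\<close> on the third side.\<close>
  also have "\<dots> = (\<integral>p. u (cos_dist y (fst p) (snd p)) * ?G (fst p / \<epsilon>) / complex_of_real C \<partial>mu_ang)"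
    using integral_swap[of "\<lambda>(a, b). u a * ?G (b / \<epsilon>) / complex_of_real C" y] y by simp
  also have "\<dots> = (\<integral>t. (\<integral>\<theta>. u (cos_dist y t \<theta>) * ?G (t / \<epsilon>) / complex_of_real C \<partial>ang) \<partial>\<mu>)"
  proof -
    have "integrable mu_ang (\<lambda>p. u (cos_dist y (fst p) (snd p)) * ?G (fst p / \<epsilon>) / complex_of_real C)"
    proof (rule muang.integrable_dominated_product[where F="\<lambda>x. gauss (1/\<epsilon> * x) * (B / C)" and G="\<lambda>_. 1"])
      show "norm (u (cos_dist y (fst (x, \<theta>)) (snd (x, \<theta>))) * ?G (fst (x, \<theta>) / \<epsilon>) / complex_of_real C) \<le> (gauss (1/\<epsilon> * x) * (B / C)) * 1" for x \<theta>
        using C divide_right_mono[OF mult_right_mono[OF B[of "cos_dist y x \<theta>"] gauss_nonneg[of "x/\<epsilon>"]], of C]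
        by (simp add: norm_mult norm_divide mult_ac)
      show "integrable \<mu> (\<lambda>x. gauss (1/\<epsilon> * x) * (B / C))"
        using integrable_gauss_scaled[of "1/\<epsilon>"] \<epsilon> by (intro integrable_mult_left) auto
    qed (use int1 in auto)
    from muang.integral_fst'[OF this] show ?thesis by (simp only: fst_conv snd_conv)
  qed
  \<comment> \<open>Rescaling t by \<epsilon> produces the factor C, which cancels the
    denominator.\<close>
  also have "\<dots> = C *\<^sub>R (\<integral>t. (\<integral>\<theta>. u (cos_dist y (\<epsilon> * t) \<theta>) * ?G (\<epsilon> * t / \<epsilon>) / complex_of_real C \<partial>ang) \<partial>\<mu>)"
    unfolding C_def by (rule integral_mu_scale) (use \<epsilon> in auto)
  also have "\<dots> = (\<integral>t. (\<integral>\<theta>. u (cos_dist y (\<epsilon> * t) \<theta>) * ?G t \<partial>ang) \<partial>\<mu>)"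
    using \<epsilon> C by (simp add: scaleR_conv_of_real)
  also have "\<dots> = (\<integral>p. u (cos_dist y (\<epsilon> * fst p) (snd p)) * ?G (fst p) \<partial>mu_ang)"
  proof -
    have "integrable mu_ang (\<lambda>p. u (cos_dist y (\<epsilon> * fst p) (snd p)) * ?G (fst p))"
    proof (rule muang.integrable_dominated_product[where F="\<lambda>x. B * gauss x" and G="\<lambda>_. 1"])
      show "norm (u (cos_dist y (\<epsilon> * fst (x, \<theta>)) (snd (x, \<theta>))) * ?G (fst (x, \<theta>))) \<le> (B * gauss x) * 1" for x \<theta>
        using B[of "cos_dist y (\<epsilon> * x) \<theta>"] by (auto simp: norm_mult mult_right_mono)
    qed (use integrable_gauss int1 in auto)
    from muang.integral_fst'[OF this] show ?thesis by (simp only: fst_conv snd_conv)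
  qed
  finally show ?thesis .
qed

lemma integral_mu_ang_fst:
  fixes f :: "real \<Rightarrow> 'a :: {banach, second_countable_topology}"
  assumes [measurable]: "f \<in> borel_measurable borel"
  shows "(\<integral>p. f (fst p) \<partial>mu_ang) = (\<integral>t. f t \<partial>\<mu>)"
  using arg_cong[OF distr_fst, of "\<lambda>M. integral\<^sup>L M f"] by (simp add: integral_distr)

lemma tendsto_gauss_average:
  fixes u :: "real \<Rightarrow> complex"
  assumes cont: "continuous_on UNIV u" and B: "\<And>x. norm (u x) \<le> B" and y: "y > 0"
    and e: "e \<longlonglongrightarrow> 0"
  shows "(\<lambda>n. \<integral>p. u (cos_dist y (e n * fst p) (snd p)) * complex_of_real (gauss (fst p)) \<partial>mu_ang) \<longlonglongrightarrow> u y"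
proof -
  have [measurable]: "u \<in> borel_measurable borel" using cont by (rule borel_measurable_continuous_onI)
  have "(\<lambda>n. \<integral>p. u (cos_dist y (e n * fst p) (snd p)) * complex_of_real (gauss (fst p)) \<partial>mu_ang)
     \<longlonglongrightarrow> (\<integral>p. u y * complex_of_real (gauss (fst p)) \<partial>mu_ang)"
  proof (rule integral_dominated_convergence)
    show "integrable mu_ang (\<lambda>p. B * gauss (fst p))"
      by (intro integrable_mult_right integrable_mu_ang_fst integrable_gauss)
    show "AE p in mu_ang. (\<lambda>n. u (cos_dist y (e n * fst p) (snd p)) * complex_of_real (gauss (fst p))) \<longlonglongrightarrow> u y * complex_of_real (gauss (fst p))"
    proof (intro AE_I2 tendsto_mult tendsto_const)
      fix p :: "real \<times> real"
      have "(\<lambda>n. cos_dist y (e n * fst p) (snd p)) \<longlonglongrightarrow> sqrt (y\<^sup>2 + (0 * fst p)\<^sup>2 + 2 * y * (0 * fst p) * cos (snd p))"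
        unfolding cos_dist_def by (intro tendsto_intros e)
      then have "(\<lambda>n. cos_dist y (e n * fst p) (snd p)) \<longlonglongrightarrow> y" using y by simp
      moreover have "isCont u y" using cont by (simp add: continuous_on_eq_continuous_at)
      ultimately show "(\<lambda>n. u (cos_dist y (e n * fst p) (snd p))) \<longlonglongrightarrow> u y"
        by (rule isCont_tendsto_compose[rotated])
    qed
    show "AE p in mu_ang. norm (u (cos_dist y (e n * fst p) (snd p)) * complex_of_real (gauss (fst p))) \<le> B * gauss (fst p)" for n
      using B by (intro AE_I2) (simp add: norm_mult mult_right_mono)
  qed measurable
  also have "(\<integral>p. u y * complex_of_real (gauss (fst p)) \<partial>mu_ang) = u y * complex_of_real (\<integral>p. gauss (fst p) \<partial>mu_ang)"
    by (simp only: integral_mult_right_zero integral_complex_of_real)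
  also have "(\<integral>p. gauss (fst p) \<partial>mu_ang) = 1"
    by (subst integral_mu_ang_fst) (auto simp: integral_gauss)
  finally show ?thesis by simp
qed

text \<open>\<open>\<Phi> n\<close> is the squared norm of the transform damped by a Gaussian,
  finite because the transform is bounded. Fubini rewrites it as the pairing of \<open>u\<close>
  with its averages \<open>V n\<close>, and this tends to the squared norm of \<open>u\<close>. The
  damping factors increase to 1, so monotone convergence removes them without knowing beforehand
  that the transform is square integrable.\<close>

theorem hankel_Plancherel:
  fixes u :: "real \<Rightarrow> complex"
  assumes cont: "continuous_on UNIV u" and B: "\<And>x. norm (u x) \<le> B" and u: "integrable \<mu> u"
  shows "(\<integral>\<^sup>+\<xi>. ennreal ((norm (hankel \<alpha> u \<xi>))\<^sup>2) \<partial>\<mu>) = (\<integral>\<^sup>+x. ennreal ((norm (u x))\<^sup>2) \<partial>\<mu>)"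
proof -
  have [measurable]: "u \<in> borel_measurable borel" using cont by (rule borel_measurable_continuous_onI)
  define e where "e n = 1 / real (Suc n)" for n
  have e_pos: "e n > 0" for n by (simp add: e_def)
  have e_lim: "e \<longlonglongrightarrow> 0" unfolding e_def by (rule LIMSEQ_Suc[OF lim_1_over_n])
  let ?H = "hankel \<alpha> u" and ?j = "\<lambda>x. complex_of_real (bessel_j \<alpha> x)"
  define N where "N = (\<integral>x. norm (u x) \<partial>\<mu>)"
  have N: "norm (?H \<xi>) \<le> N" for \<xi> unfolding N_def by (rule norm_hankel_le[OF u])
  have N0: "N \<ge> 0" unfolding N_def by simp
  have B0: "B \<ge> 0" using order_trans[OF norm_ge_zero B] .
  define V where "V n y = (\<integral>p. u (cos_dist y (e n * fst p) (snd p)) * complex_of_real (gauss (fst p)) \<partial>mu_ang)" for n y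
  have V_meas [measurable]: "V n \<in> borel_measurable borel" for n
    unfolding V_def by measurable
  have V_le: "norm (V n y) \<le> B" for n y
  proof -
    have "norm (V n y) \<le> (\<integral>p. norm (u (cos_dist y (e n * fst p) (snd p)) * complex_of_real (gauss (fst p))) \<partial>mu_ang)"
      unfolding V_def by (rule integral_norm_bound)
    also have "\<dots> \<le> (\<integral>p. B * gauss (fst p) \<partial>mu_ang)"
      using B B0 by (intro integral_mono_AE' integrable_mult_right integrable_mu_ang_fst integrable_gauss AE_I2)
        (auto simp: norm_mult intro!: mult_right_mono mult_nonneg_nonneg)
    also have "\<dots> = B"
      by (subst integral_mu_ang_fst[of "\<lambda>x. B * gauss x"]) (auto simp: integral_gauss)
    finally show ?thesis .
  qed
  have sq: "integrable \<mu> (\<lambda>x. (norm (u x))\<^sup>2)"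
  proof (rule Bochner_Integration.integrable_bound)
    show "integrable \<mu> (\<lambda>x. B * norm (u x))" using u by (intro integrable_mult_right integrable_norm)
    show "AE x in \<mu>. norm ((norm (u x))\<^sup>2) \<le> norm (B * norm (u x))"
      using B B0 by (intro AE_I2) (auto simp: power2_eq_square intro!: mult_right_mono)
  qed measurable
  define \<Phi> where "\<Phi> n = (\<integral>\<xi>. gauss (e n * \<xi>) * (norm (?H \<xi>))\<^sup>2 \<partial>\<mu>)" for n
  have \<Phi>_int: "integrable \<mu> (\<lambda>\<xi>. gauss (e n * \<xi>) * (norm (?H \<xi>))\<^sup>2)" for n
  proof (rule Bochner_Integration.integrable_bound)
    show "integrable \<mu> (\<lambda>\<xi>. gauss (e n * \<xi>) * N\<^sup>2)"
      by (intro integrable_mult_left integrable_gauss_scaled e_pos)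
    show "AE \<xi> in \<mu>. norm (gauss (e n * \<xi>) * (norm (?H \<xi>))\<^sup>2) \<le> norm (gauss (e n * \<xi>) * N\<^sup>2)"
      using N by (intro AE_I2) (auto simp: abs_mult intro!: mult_left_mono power_mono)
  qed measurable
  have \<Phi>_eq: "complex_of_real (\<Phi> n) = (\<integral>y. cnj (u y) * V n y \<partial>\<mu>)" for n
  proof -
    let ?k = "\<lambda>\<xi> y. cnj (u y) * (?H \<xi> * complex_of_real (gauss (e n * \<xi>) * bessel_j \<alpha> (y * \<xi>)))"
    have "complex_of_real (\<Phi> n) = (\<integral>\<xi>. complex_of_real (gauss (e n * \<xi>) * (norm (?H \<xi>))\<^sup>2) \<partial>\<mu>)"
      unfolding \<Phi>_def by (rule integral_complex_of_real[symmetric])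
    also have "\<dots> = (\<integral>\<xi>. (\<integral>y. ?k \<xi> y \<partial>\<mu>) \<partial>\<mu>)"
    proof (rule Bochner_Integration.integral_cong[OF refl])
      fix \<xi>
      \<comment> \<open>The Bessel factor is real, so it can be moved under the conjugation, where
        it forms the conjugate of the transform.\<close>
      have "(\<integral>y. ?k \<xi> y \<partial>\<mu>) = (\<integral>y. (?H \<xi> * complex_of_real (gauss (e n * \<xi>))) * cnj (u y * ?j (y * \<xi>)) \<partial>\<mu>)"
        by (simp add: mult_ac)
      also have "\<dots> = (?H \<xi> * complex_of_real (gauss (e n * \<xi>))) * cnj (?H \<xi>)"
        unfolding hankel_def by (simp only: integral_mult_right_zero Bochner_Integration.integral_cnj)
      finally show "complex_of_real (gauss (e n * \<xi>) * (norm (?H \<xi>))\<^sup>2) = (\<integral>y. ?k \<xi> y \<partial>\<mu>)"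
        by (simp only: of_real_mult complex_norm_square mult_ac)
    qed
    also have "\<dots> = (\<integral>y. (\<integral>\<xi>. ?k \<xi> y \<partial>\<mu>) \<partial>\<mu>)"
    proof (rule mumu.Fubini_integral[symmetric], rule mumu.integrable_dominated_product[where F="\<lambda>\<xi>. N * gauss (e n * \<xi>)" and G="\<lambda>y. norm (u y)"])
      show "integrable \<mu> (\<lambda>\<xi>. N * gauss (e n * \<xi>))"
        by (intro integrable_mult_right integrable_gauss_scaled e_pos)
      show "norm (case (\<xi>, y) of (\<xi>, y) \<Rightarrow> ?k \<xi> y) \<le> (N * gauss (e n * \<xi>)) * norm (u y)" for \<xi> y
      proof -
        have "norm (?H \<xi>) * \<bar>bessel_j \<alpha> (y * \<xi>)\<bar> \<le> N * 1"
          by (intro mult_mono N abs_bessel_j_le_1) (auto intro: N0)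
        then have "(norm (u y) * gauss (e n * \<xi>)) * (norm (?H \<xi>) * \<bar>bessel_j \<alpha> (y * \<xi>)\<bar>) \<le> (norm (u y) * gauss (e n * \<xi>)) * N"
          by (intro mult_left_mono) auto
        then show ?thesis by (simp add: norm_mult mult_ac)
      qed
    qed (use u in auto)
    also have "\<dots> = (\<integral>y. cnj (u y) * V n y \<partial>\<mu>)"
    proof (rule integral_cong_AE)
      show "AE y in \<mu>. (\<integral>\<xi>. ?k \<xi> y \<partial>\<mu>) = cnj (u y) * V n y"
        using AE_mu_pos
      proof eventually_elim
        case (elim y)
        show ?case
          unfolding V_def integral_hankel_gauss_bessel[OF u B e_pos elim, symmetric]
          by (simp only: integral_mult_right_zero)
      qed
    qed measurable
    finally show ?thesis .
  qed
  have "(\<lambda>n. \<integral>y. cnj (u y) * V n y \<partial>\<mu>) \<longlonglongrightarrow> (\<integral>y. cnj (u y) * u y \<partial>\<mu>)"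
  proof (rule integral_dominated_convergence)
    show "integrable \<mu> (\<lambda>y. norm (u y) * B)" using u by (intro integrable_mult_left integrable_norm)
    show "AE y in \<mu>. (\<lambda>n. cnj (u y) * V n y) \<longlonglongrightarrow> cnj (u y) * u y"
      using AE_mu_pos
    proof eventually_elim
      case (elim y)
      show ?case unfolding V_def
        by (intro tendsto_mult tendsto_const tendsto_gauss_average[OF cont B elim e_lim])
    qed
    show "AE y in \<mu>. norm (cnj (u y) * V n y) \<le> norm (u y) * B" for n
      using V_le by (intro AE_I2) (auto simp: norm_mult intro!: mult_left_mono)
  qed measurable
  also have "(\<integral>y. cnj (u y) * u y \<partial>\<mu>) = complex_of_real (\<integral>y. (norm (u y))\<^sup>2 \<partial>\<mu>)"
    unfolding integral_complex_of_real[symmetric] by (simp only: complex_norm_square mult.commute)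
  finally have "(\<lambda>n. complex_of_real (\<Phi> n)) \<longlonglongrightarrow> complex_of_real (\<integral>y. (norm (u y))\<^sup>2 \<partial>\<mu>)"
    by (simp only: \<Phi>_eq)
  then have "\<Phi> \<longlonglongrightarrow> (\<integral>y. (norm (u y))\<^sup>2 \<partial>\<mu>)" by (simp only: tendsto_of_real_iff)
  then have "(\<lambda>n. ennreal (\<Phi> n)) \<longlonglongrightarrow> ennreal (\<integral>y. (norm (u y))\<^sup>2 \<partial>\<mu>)"
    by (rule tendsto_ennrealI)
  moreover have "(\<lambda>n. \<integral>\<^sup>+\<xi>. ennreal (gauss (e n * \<xi>) * (norm (?H \<xi>))\<^sup>2) \<partial>\<mu>) \<longlonglongrightarrow> (\<integral>\<^sup>+\<xi>. ennreal ((norm (?H \<xi>))\<^sup>2) \<partial>\<mu>)"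
  proof (rule nn_integral_LIMSEQ)
    show "incseq (\<lambda>n \<xi>. ennreal (gauss (e n * \<xi>) * (norm (?H \<xi>))\<^sup>2))"
    proof (intro incseq_SucI le_funI ennreal_leI mult_right_mono)
      fix n \<xi>
      have "(e (Suc n))\<^sup>2 \<le> (e n)\<^sup>2" 
        by (intro power_mono) (auto simp: e_def divide_simps)
      then have "(e (Suc n))\<^sup>2 * \<xi>\<^sup>2 \<le> (e n)\<^sup>2 * \<xi>\<^sup>2" by (rule mult_right_mono) simp
      then show "gauss (e n * \<xi>) \<le> gauss (e (Suc n) * \<xi>)" by (simp add: gauss_def power_mult_distrib)
    qed simp
    show "(\<lambda>n. ennreal (gauss (e n * \<xi>) * (norm (?H \<xi>))\<^sup>2)) \<longlonglongrightarrow> ennreal ((norm (?H \<xi>))\<^sup>2)" for \<xi>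
    proof (rule tendsto_ennrealI)
      have "(\<lambda>n. gauss (e n * \<xi>) * (norm (?H \<xi>))\<^sup>2) \<longlonglongrightarrow> exp (- (0 * \<xi>)\<^sup>2 / 2) * (norm (?H \<xi>))\<^sup>2"
        unfolding gauss_def by (intro tendsto_intros e_lim) auto
      then show "(\<lambda>n. gauss (e n * \<xi>) * (norm (?H \<xi>))\<^sup>2) \<longlonglongrightarrow> (norm (?H \<xi>))\<^sup>2" by simp
    qed
  qed measurable
  moreover have "(\<integral>\<^sup>+\<xi>. ennreal (gauss (e n * \<xi>) * (norm (?H \<xi>))\<^sup>2) \<partial>\<mu>) = ennreal (\<Phi> n)" for n
    unfolding \<Phi>_def by (rule nn_integral_eq_integral[OF \<Phi>_int]) simp
  moreover have "(\<integral>\<^sup>+x. ennreal ((norm (u x))\<^sup>2) \<partial>\<mu>) = ennreal (\<integral>y. (norm (u y))\<^sup>2 \<partial>\<mu>)"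
    by (rule nn_integral_eq_integral[OF sq]) simp
  ultimately show ?thesis by (simp only: LIMSEQ_unique)
qed


subsection \<open>Translation and convolution\<close>

lemma hankel_transl_eq:
  assumes [measurable]: "f \<in> borel_measurable borel"
  shows "hankel_transl \<alpha> x f y = (\<integral>\<theta>. f (cos_dist x y \<theta>) \<partial>ang)"
proof -
  have "(\<integral>\<theta>. f (cos_dist x y \<theta>) \<partial>ang) = (\<integral>\<theta>. ang_weight \<theta> *\<^sub>R f (cos_dist x y \<theta>) \<partial>lborel)"
    by (rule integral_ang) measurable
  also have "\<dots> = (\<integral>\<theta>. complex_of_real ang_const * (indicator {0..pi} \<theta> *\<^sub>R (f (cos_dist x y \<theta>) * complex_of_real (sin \<theta> powr (2*\<alpha>)))) \<partial>lborel)"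
    by (intro Bochner_Integration.integral_cong refl) (simp add: ang_weight_def scaleR_conv_of_real mult_ac)
  also have "\<dots> = complex_of_real ang_const * (\<integral>\<theta>. indicator {0..pi} \<theta> *\<^sub>R (f (cos_dist x y \<theta>) * complex_of_real (sin \<theta> powr (2*\<alpha>))) \<partial>lborel)"
    by (rule integral_mult_right_zero)
  finally show ?thesis
    unfolding hankel_transl_def set_lebesgue_integral_def cos_dist_def ang_const_def by simp
qed

lemma hankel_transl_measurable [measurable]:
  assumes [measurable]: "f \<in> borel_measurable borel" "g \<in> borel_measurable M" "h \<in> borel_measurable M"
  shows "(\<lambda>z. hankel_transl \<alpha> (g z) f (h z)) \<in> borel_measurable M"
  unfolding hankel_transl_eq[OF assms(1)] by measurable

text \<open>An inner product with a translate, hence the conjugate. With \<open>g\<close> a dilate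
  of the wavelet it is the wavelet transform up to its constant factor.\<close>

definition hankel_conv :: "(real \<Rightarrow> complex) \<Rightarrow> (real \<Rightarrow> complex) \<Rightarrow> real \<Rightarrow> complex" where
  "hankel_conv f g x = (\<integral>t. f t * cnj (hankel_transl \<alpha> x g t) \<partial>\<mu>)"

lemma hankel_conv_eq:
  assumes [measurable]: "f \<in> borel_measurable borel" "g \<in> borel_measurable borel"
    and int: "integrable mu_ang (\<lambda>p. f (fst p) * cnj (g (cos_dist x (fst p) (snd p))))"
  shows "hankel_conv f g x = (\<integral>p. f (fst p) * cnj (g (cos_dist x (fst p) (snd p))) \<partial>mu_ang)"
proof -
  have "hankel_conv f g x = (\<integral>t. (\<integral>\<theta>. f t * cnj (g (cos_dist x t \<theta>)) \<partial>ang) \<partial>\<mu>)"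
    unfolding hankel_conv_def hankel_transl_eq[OF assms(2)]
    by (simp only: integral_mult_right_zero Bochner_Integration.integral_cnj)
  also have "\<dots> = (\<integral>p. f (fst p) * cnj (g (cos_dist x (fst p) (snd p))) \<partial>mu_ang)"
    using muang.integral_fst'[OF int] by (simp only: fst_conv snd_conv)
  finally show ?thesis .
qed

definition sqnorm :: "(real \<Rightarrow> complex) \<Rightarrow> ennreal" where
  "sqnorm f = (\<integral>\<^sup>+x. ennreal ((norm (f x))\<^sup>2) \<partial>\<mu>)"

text \<open>Cauchy-Schwarz is applied on the product with the angle, before averaging. Each squared
  factor then integrates by its image measure to a plain norm, and no estimate for the translate is
  required.\<close>

lemma nn_integral_mu_ang_product_le:
  assumes [measurable]: "f \<in> borel_measurable borel" "g \<in> borel_measurable borel" and x: "x > 0"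
  shows "(\<integral>\<^sup>+p. ennreal (norm (f (fst p) * cnj (g (cos_dist x (fst p) (snd p))))) \<partial>mu_ang)\<^sup>2 \<le> sqnorm f * sqnorm g"
proof -
  have "(\<integral>\<^sup>+p. ennreal (norm (f (fst p) * cnj (g (cos_dist x (fst p) (snd p))))) \<partial>mu_ang)\<^sup>2
     = (\<integral>\<^sup>+p. ennreal (norm (f (fst p))) * ennreal (norm (g (cos_dist x (fst p) (snd p)))) \<partial>mu_ang)\<^sup>2"
    by (simp add: norm_mult ennreal_mult)
  also have "\<dots> \<le> (\<integral>\<^sup>+p. (ennreal (norm (f (fst p))))\<^sup>2 \<partial>mu_ang) * (\<integral>\<^sup>+p. (ennreal (norm (g (cos_dist x (fst p) (snd p)))))\<^sup>2 \<partial>mu_ang)"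
    by (rule Cauchy_Schwarz_nn_integral) measurable
  also have "(\<integral>\<^sup>+p. (ennreal (norm (f (fst p))))\<^sup>2 \<partial>mu_ang) = sqnorm f"
    unfolding sqnorm_def by (subst nn_integral_mu_ang_fst[symmetric]) (auto simp: ennreal_power)
  also have "(\<integral>\<^sup>+p. (ennreal (norm (g (cos_dist x (fst p) (snd p)))))\<^sup>2 \<partial>mu_ang) = sqnorm g"
    unfolding sqnorm_def by (subst nn_integral_mu_ang_cos_dist[OF _ x, symmetric]) (auto simp: ennreal_power)
  finally show ?thesis .
qed

lemma integrable_mu_ang_product:
  assumes [measurable]: "f \<in> borel_measurable borel" "g \<in> borel_measurable borel" and x: "x > 0"
    and fin: "sqnorm f < \<infinity>" "sqnorm g < \<infinity>"
  shows "integrable mu_ang (\<lambda>p. f (fst p) * cnj (g (cos_dist x (fst p) (snd p))))"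
proof (rule integrableI_bounded)
  let ?I = "\<integral>\<^sup>+p. ennreal (norm (f (fst p) * cnj (g (cos_dist x (fst p) (snd p))))) \<partial>mu_ang"
  have "sqnorm f * sqnorm g < \<infinity>" using fin by (simp add: ennreal_mult_less_top)
  with nn_integral_mu_ang_product_le[OF assms(1,2) x] have "?I\<^sup>2 < \<infinity>" by (rule le_less_trans)
  then show "?I < \<infinity>" by (auto simp: power2_eq_square ennreal_mult_less_top top_unique less_top)
qed measurable

lemma hankel_conv_bound:
  assumes [measurable]: "f \<in> borel_measurable borel" "g \<in> borel_measurable borel" and x: "x > 0"
    and fin: "sqnorm f < \<infinity>" "sqnorm g < \<infinity>"
  shows "ennreal ((norm (hankel_conv f g x))\<^sup>2) \<le> sqnorm f * sqnorm g"
proof -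
  have "ennreal (norm (hankel_conv f g x)) \<le> (\<integral>\<^sup>+p. ennreal (norm (f (fst p) * cnj (g (cos_dist x (fst p) (snd p))))) \<partial>mu_ang)"
    unfolding hankel_conv_eq[OF assms(1,2) integrable_mu_ang_product[OF assms]]
    by (rule integral_norm_bound_ennreal[OF integrable_mu_ang_product[OF assms]])
  then have "(ennreal (norm (hankel_conv f g x)))\<^sup>2 \<le> (\<integral>\<^sup>+p. ennreal (norm (f (fst p) * cnj (g (cos_dist x (fst p) (snd p))))) \<partial>mu_ang)\<^sup>2"
    by (intro power_mono) auto
  also have "\<dots> \<le> sqnorm f * sqnorm g" by (rule nn_integral_mu_ang_product_le[OF assms(1,2) x])
  finally show ?thesis by (simp add: ennreal_power)
qed

lemma hankel_conv_lincomb: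
  assumes [measurable]: "f \<in> borel_measurable borel" "h \<in> borel_measurable borel" "g \<in> borel_measurable borel" and x: "x > 0"
    and fin: "sqnorm f < \<infinity>" "sqnorm h < \<infinity>" "sqnorm g < \<infinity>"
  shows "hankel_conv (\<lambda>t. a * f t + b * h t) g x = a * hankel_conv f g x + b * hankel_conv h g x"
proof -
  note iF = integrable_mu_ang_product[OF assms(1,3) x fin(1,3)]
  note iH = integrable_mu_ang_product[OF assms(2,3) x fin(2,3)]
  have int: "integrable mu_ang (\<lambda>p. (a * f (fst p) + b * h (fst p)) * cnj (g (cos_dist x (fst p) (snd p))))"
    using Bochner_Integration.integrable_add[OF integrable_mult_right[OF iF, of a] integrable_mult_right[OF iH, of b]]
    by (simp add: algebra_simps)
  have "hankel_conv (\<lambda>t. a * f t + b * h t) g x = 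
     (\<integral>p. a * (f (fst p) * cnj (g (cos_dist x (fst p) (snd p)))) + b * (h (fst p) * cnj (g (cos_dist x (fst p) (snd p)))) \<partial>mu_ang)"
    by (subst hankel_conv_eq[OF _ assms(3) int]) (auto simp: algebra_simps)
  also have "\<dots> = a * hankel_conv f g x + b * hankel_conv h g x"
    unfolding hankel_conv_eq[OF assms(1,3) iF] hankel_conv_eq[OF assms(2,3) iH]
    by (subst Bochner_Integration.integral_add) (auto intro!: integrable_mult_right iF iH)
  finally show ?thesis .
qed

text \<open>The hypotheses of \<open>hankel_Plancherel\<close>, collected into a class that is
  closed under linear combinations.\<close>

definition nice :: "(real \<Rightarrow> complex) \<Rightarrow> bool" where
  "nice f \<longleftrightarrow> continuous_on UNIV f \<and> (\<exists>B. \<forall>x. norm (f x) \<le> B) \<and> integrable \<mu> f"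

lemma nice_measurable [measurable_dest]: "nice f \<Longrightarrow> f \<in> borel_measurable borel"
  unfolding nice_def by (auto intro: borel_measurable_continuous_onI)

lemma norm_hankel_transl_le:
  assumes [measurable]: "f \<in> borel_measurable borel" and B: "\<And>x. norm (f x) \<le> B"
  shows "norm (hankel_transl \<alpha> x f t) \<le> B"
proof -
  have "norm (hankel_transl \<alpha> x f t) \<le> (\<integral>\<theta>. norm (f (cos_dist x t \<theta>)) \<partial>ang)"
    unfolding hankel_transl_eq[OF assms(1)] by (rule integral_norm_bound)
  also have "\<dots> \<le> (\<integral>\<theta>. B \<partial>ang)"
    using B order_trans[OF norm_ge_zero B] by (intro integral_mono integrable_ang_bounded[where B=B]) auto
  finally show ?thesis by simp
qed

text \<open>The integration runs over the translation parameter with the point \<open>t\<close>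
  fixed. \<open>cos_dist\<close> is symmetric in the two, so the invariance of \<mu> under
  translation applies.\<close>

lemma nn_integral_hankel_transl_le:
  assumes [measurable]: "f \<in> borel_measurable borel" and B: "\<And>x. norm (f x) \<le> B" and t: "t > 0"
  shows "(\<integral>\<^sup>+x. ennreal (norm (hankel_transl \<alpha> x f t)) \<partial>\<mu>) \<le> (\<integral>\<^sup>+x. ennreal (norm (f x)) \<partial>\<mu>)"
proof -
  have "ennreal (norm (hankel_transl \<alpha> x f t)) \<le> (\<integral>\<^sup>+\<theta>. ennreal (norm (f (cos_dist t x \<theta>))) \<partial>ang)" for x
    unfolding hankel_transl_eq[OF assms(1)] cos_dist_commute[of x t]
    using B by (intro integral_norm_bound_ennreal integrable_ang_bounded[where B=B]) auto
  then have "(\<integral>\<^sup>+x. ennreal (norm (hankel_transl \<alpha> x f t)) \<partial>\<mu>) \<le> (\<integral>\<^sup>+x. (\<integral>\<^sup>+\<theta>. ennreal (norm (f (cos_dist t x \<theta>))) \<partial>ang) \<partial>\<mu>)"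
    by (intro nn_integral_mono)
  also have "\<dots> = (\<integral>\<^sup>+p. ennreal (norm (f (cos_dist t (fst p) (snd p)))) \<partial>mu_ang)"
    using ang.nn_integral_fst[of "\<lambda>p. ennreal (norm (f (cos_dist t (fst p) (snd p))))" \<mu>] by simp
  also have "\<dots> = (\<integral>\<^sup>+x. ennreal (norm (f x)) \<partial>\<mu>)"
    by (rule nn_integral_mu_ang_cos_dist[OF _ t]) measurable
  finally show ?thesis .
qed

text \<open>The exchange symmetry carries the translation from \<open>f\<close> to the Bessel
  factor, where the product formula splits it: translation acts as a multiplier.\<close>

lemma hankel_hankel_transl:
  assumes f: "integrable \<mu> f" and B: "\<And>x. norm (f x) \<le> B" and t: "t > 0"
  shows "(\<integral>x. hankel_transl \<alpha> x f t * complex_of_real (bessel_j \<alpha> (x * \<xi>)) \<partial>\<mu>)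
       = complex_of_real (bessel_j \<alpha> (t * \<xi>)) * hankel \<alpha> f \<xi>"
proof -
  have [measurable]: "f \<in> borel_measurable borel" using f by auto
  let ?j = "\<lambda>x. complex_of_real (bessel_j \<alpha> x)"
  have int: "integrable mu_ang (\<lambda>p. f (cos_dist t (fst p) (snd p)) * ?j (fst p * \<xi>))"
  proof (rule Bochner_Integration.integrable_bound[OF integrable_mu_ang_cos_dist[OF f t]])
    show "AE p in mu_ang. norm (f (cos_dist t (fst p) (snd p)) * ?j (fst p * \<xi>)) \<le> norm (f (cos_dist t (fst p) (snd p)))"
      by (intro AE_I2) (auto simp: norm_mult intro!: mult_left_le abs_bessel_j_le_1)
  qed measurable
  have int': "integrable mu_ang (\<lambda>p. f (fst p) * ?j (cos_dist t (fst p) (snd p) * \<xi>))"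
  proof (rule Bochner_Integration.integrable_bound[OF integrable_mu_ang_fst[OF f]])
    show "AE p in mu_ang. norm (f (fst p) * ?j (cos_dist t (fst p) (snd p) * \<xi>)) \<le> norm (f (fst p))"
      by (intro AE_I2) (auto simp: norm_mult intro!: mult_left_le abs_bessel_j_le_1)
  qed measurable
  have "(\<integral>x. hankel_transl \<alpha> x f t * ?j (x * \<xi>) \<partial>\<mu>) = (\<integral>x. (\<integral>\<theta>. f (cos_dist t x \<theta>) * ?j (x * \<xi>) \<partial>ang) \<partial>\<mu>)"
    by (simp add: hankel_transl_eq cos_dist_commute[of _ t])
  also have "\<dots> = (\<integral>p. f (cos_dist t (fst p) (snd p)) * ?j (fst p * \<xi>) \<partial>mu_ang)"
    using muang.integral_fst'[OF int] by (simp only: fst_conv snd_conv)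
  also have "\<dots> = (\<integral>p. f (fst p) * ?j (cos_dist t (fst p) (snd p) * \<xi>) \<partial>mu_ang)"
    using integral_swap[of "\<lambda>(a, b). f a * ?j (b * \<xi>)" t] t by simp
  also have "\<dots> = (\<integral>x. (\<integral>\<theta>. f x * ?j (cos_dist t x \<theta> * \<xi>) \<partial>ang) \<partial>\<mu>)"
    using muang.integral_fst'[OF int'] by (simp only: fst_conv snd_conv)
  also have "\<dots> = (\<integral>x. ?j (t * \<xi>) * (f x * ?j (x * \<xi>)) \<partial>\<mu>)"
  proof (rule Bochner_Integration.integral_cong[OF refl])
    fix x
    have "(\<integral>\<theta>. f x * ?j (cos_dist t x \<theta> * \<xi>) \<partial>ang) = f x * complex_of_real (\<integral>\<theta>. bessel_j \<alpha> (\<xi> * cos_dist t x \<theta>) \<partial>ang)"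
      by (simp only: integral_mult_right_zero integral_complex_of_real mult.commute[of \<xi>])
    then show "(\<integral>\<theta>. f x * ?j (cos_dist t x \<theta> * \<xi>) \<partial>ang) = ?j (t * \<xi>) * (f x * ?j (x * \<xi>))"
      by (simp add: bessel_j_product)
  qed
  also have "\<dots> = ?j (t * \<xi>) * hankel \<alpha> f \<xi>"
    unfolding hankel_def by (rule integral_mult_right_zero)
  finally show ?thesis .
qed

text \<open>Plancherel for the convolution itself. It has a continuous, bounded and integrable
  version even when \<open>g\<close> is only integrable, and the transform of that version is the
  product of one transform and a conjugate.\<close>

lemma nn_integral_hankel_conv:
  assumes nice: "nice f" and g: "integrable \<mu> g"
  shows "(\<integral>\<^sup>+x. ennreal ((norm (hankel_conv f g x))\<^sup>2) \<partial>\<mu>)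
    = (\<integral>\<^sup>+\<xi>. ennreal ((norm (hankel \<alpha> f \<xi>))\<^sup>2) * ennreal ((norm (hankel \<alpha> g \<xi>))\<^sup>2) \<partial>\<mu>)"
proof -
  from nice obtain B where cont: "continuous_on UNIV f" and B: "\<And>x. norm (f x) \<le> B" and f: "integrable \<mu> f"
    by (auto simp: nice_def)
  have [measurable]: "f \<in> borel_measurable borel" "g \<in> borel_measurable borel"
    using nice_measurable[OF nice] g by auto
  have B0: "B \<ge> 0" using order_trans[OF norm_ge_zero B] .
  let ?T = "\<lambda>x t. hankel_transl \<alpha> x f t" and ?j = "\<lambda>x. complex_of_real (bessel_j \<alpha> x)"
  \<comment> \<open>With the translation placed on \<open>f\<close>, continuity and boundedness come
    from \<open>f\<close>. For x > 0 the symmetry identifies \<open>u\<close> with the convolution;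
    the values at x \<le> 0 serve the continuity on the whole line that Plancherel asks for.\<close>
  define u where "u x = (\<integral>t. ?T x t * cnj (g t) \<partial>\<mu>)" for x
  have int_P: "integrable mu_ang (\<lambda>p. f (cos_dist x (fst p) (snd p)) * cnj (g (fst p)))" for x
  proof (rule Bochner_Integration.integrable_bound)
    show "integrable mu_ang (\<lambda>p. B * norm (g (fst p)))"
      by (intro integrable_mult_right integrable_norm integrable_mu_ang_fst g)
    show "AE p in mu_ang. norm (f (cos_dist x (fst p) (snd p)) * cnj (g (fst p))) \<le> norm (B * norm (g (fst p)))"
      using B B0 by (intro AE_I2) (auto simp: norm_mult intro!: mult_right_mono)
  qed measurable
  have u_P: "u x = (\<integral>p. f (cos_dist x (fst p) (snd p)) * cnj (g (fst p)) \<partial>mu_ang)" for x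
    unfolding u_def using muang.integral_fst'[OF int_P[of x]] by (simp add: hankel_transl_eq)
  have conv: "hankel_conv f g x = u x" if x: "x > 0" for x
  proof -
    have int: "integrable mu_ang (\<lambda>p. f (fst p) * cnj (g (cos_dist x (fst p) (snd p))))"
      using integrable_swap[of "\<lambda>(a, b). f a * cnj (g b)", OF _ x] int_P[of x] by simp
    show ?thesis
      unfolding hankel_conv_eq[OF _ _ int, simplified] u_P
      using integral_swap[of "\<lambda>(a, b). f a * cnj (g b)", OF _ x] by simp
  qed
  have u_cont: "continuous_on UNIV u"
  proof (rule continuous_at_imp_continuous_on, rule ballI, rule continuous_at_sequentiallyI)
    fix x and s :: "nat \<Rightarrow> real" assume s: "s \<longlonglongrightarrow> x"
    show "(\<lambda>n. u (s n)) \<longlonglongrightarrow> u x"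
      unfolding u_P
    proof (rule integral_dominated_convergence)
      show "integrable mu_ang (\<lambda>p. B * norm (g (fst p)))"
        by (intro integrable_mult_right integrable_norm integrable_mu_ang_fst g)
      show "AE p in mu_ang. norm (f (cos_dist (s n) (fst p) (snd p)) * cnj (g (fst p))) \<le> B * norm (g (fst p))" for n
        using B by (intro AE_I2) (simp add: norm_mult mult_right_mono)
      show "AE p in mu_ang. (\<lambda>n. f (cos_dist (s n) (fst p) (snd p)) * cnj (g (fst p))) \<longlonglongrightarrow> f (cos_dist x (fst p) (snd p)) * cnj (g (fst p))"
      proof (intro AE_I2 tendsto_mult tendsto_const)
        fix p :: "real \<times> real"
        have "(\<lambda>n. cos_dist (s n) (fst p) (snd p)) \<longlonglongrightarrow> cos_dist x (fst p) (snd p)"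
          unfolding cos_dist_def by (intro tendsto_intros s)
        moreover have "isCont f (cos_dist x (fst p) (snd p))" using cont by (simp add: continuous_on_eq_continuous_at)
        ultimately show "(\<lambda>n. f (cos_dist (s n) (fst p) (snd p))) \<longlonglongrightarrow> f (cos_dist x (fst p) (snd p))"
          by (rule isCont_tendsto_compose[rotated])
      qed
    qed measurable
  qed
  have u_bound: "norm (u x) \<le> B * (\<integral>t. norm (g t) \<partial>\<mu>)" for x
  proof -
    have "norm (u x) \<le> (\<integral>t. norm (?T x t * cnj (g t)) \<partial>\<mu>)"
      unfolding u_def by (rule integral_norm_bound)
    also have "\<dots> \<le> (\<integral>t. B * norm (g t) \<partial>\<mu>)"
      using g norm_hankel_transl_le[OF _ B] B0
      by (intro integral_mono_AE' integrable_mult_right integrable_norm AE_I2) (auto simp: norm_mult intro!: mult_right_mono)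
    finally show ?thesis by simp
  qed
  \<comment> \<open>Joint integrability gives both the integrability of \<open>u\<close> and the
    exchange of integrals in its transform.\<close>
  have int2: "integrable (\<mu> \<Otimes>\<^sub>M \<mu>) (\<lambda>(x, t). ?T x t * cnj (g t))"
  proof (rule integrableI_bounded)
    have "(\<integral>\<^sup>+p. ennreal (norm (case p of (x, t) \<Rightarrow> ?T x t * cnj (g t))) \<partial>(\<mu> \<Otimes>\<^sub>M \<mu>))
        = (\<integral>\<^sup>+t. (\<integral>\<^sup>+x. ennreal (norm (?T x t * cnj (g t))) \<partial>\<mu>) \<partial>\<mu>)"
      by (subst mumu.nn_integral_snd[symmetric]) auto
    also have "\<dots> = (\<integral>\<^sup>+t. (\<integral>\<^sup>+x. ennreal (norm (?T x t)) \<partial>\<mu>) * ennreal (norm (g t)) \<partial>\<mu>)"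
      by (simp add: norm_mult ennreal_mult nn_integral_multc)
    also have "\<dots> \<le> (\<integral>\<^sup>+t. (\<integral>\<^sup>+x. ennreal (norm (f x)) \<partial>\<mu>) * ennreal (norm (g t)) \<partial>\<mu>)"
    proof (rule nn_integral_mono_AE)
      show "AE t in \<mu>. (\<integral>\<^sup>+x. ennreal (norm (?T x t)) \<partial>\<mu>) * ennreal (norm (g t)) \<le> (\<integral>\<^sup>+x. ennreal (norm (f x)) \<partial>\<mu>) * ennreal (norm (g t))"
        using AE_mu_pos by eventually_elim (intro mult_right_mono nn_integral_hankel_transl_le[OF _ B], auto)
    qed
    also have "\<dots> = (\<integral>\<^sup>+x. ennreal (norm (f x)) \<partial>\<mu>) * (\<integral>\<^sup>+t. ennreal (norm (g t)) \<partial>\<mu>)"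
      by (rule nn_integral_cmult) measurable
    also have "\<dots> < \<infinity>"
      using f g by (simp add: integrable_iff_bounded ennreal_mult_less_top)
    finally show "(\<integral>\<^sup>+p. ennreal (norm (case p of (x, t) \<Rightarrow> ?T x t * cnj (g t))) \<partial>(\<mu> \<Otimes>\<^sub>M \<mu>)) < \<infinity>" .
  qed measurable
  have u_int: "integrable \<mu> u"
    unfolding u_def using mumu.integrable_fst'[OF int2] by simp
  have u_hankel: "hankel \<alpha> u \<xi> = hankel \<alpha> f \<xi> * cnj (hankel \<alpha> g \<xi>)" for \<xi>
  proof -
    have "hankel \<alpha> u \<xi> = (\<integral>x. (\<integral>t. ?T x t * cnj (g t) * ?j (x * \<xi>) \<partial>\<mu>) \<partial>\<mu>)"
      unfolding hankel_def u_def by (simp only: integral_mult_left_zero)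
    also have "\<dots> = (\<integral>t. (\<integral>x. ?T x t * cnj (g t) * ?j (x * \<xi>) \<partial>\<mu>) \<partial>\<mu>)"
    proof (rule mumu.Fubini_integral[symmetric], rule Bochner_Integration.integrable_bound[OF int2])
      show "AE p in \<mu> \<Otimes>\<^sub>M \<mu>. norm (case p of (x, t) \<Rightarrow> ?T x t * cnj (g t) * ?j (x * \<xi>)) \<le> norm (case p of (x, t) \<Rightarrow> ?T x t * cnj (g t))"
        by (intro AE_I2) (auto simp: norm_mult intro!: mult_left_le abs_bessel_j_le_1)
    qed measurable
    also have "\<dots> = (\<integral>t. hankel \<alpha> f \<xi> * cnj (g t * ?j (t * \<xi>)) \<partial>\<mu>)"
    proof (rule integral_cong_AE)
      show "AE t in \<mu>. (\<integral>x. ?T x t * cnj (g t) * ?j (x * \<xi>) \<partial>\<mu>) = hankel \<alpha> f \<xi> * cnj (g t * ?j (t * \<xi>))"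
        using AE_mu_pos
      proof eventually_elim
        case (elim t)
        have "(\<integral>x. ?T x t * cnj (g t) * ?j (x * \<xi>) \<partial>\<mu>) = (\<integral>x. cnj (g t) * (?T x t * ?j (x * \<xi>)) \<partial>\<mu>)"
          by (simp only: mult_ac)
        also have "\<dots> = cnj (g t) * (?j (t * \<xi>) * hankel \<alpha> f \<xi>)"
          by (simp only: integral_mult_right_zero hankel_hankel_transl[OF f B elim])
        finally show ?case by (simp add: mult_ac)
      qed
    qed measurable
    also have "\<dots> = hankel \<alpha> f \<xi> * cnj (hankel \<alpha> g \<xi>)"
      unfolding hankel_def[of _ g] by (simp only: integral_mult_right_zero Bochner_Integration.integral_cnj)
    finally show ?thesis .
  qed
  have "(\<integral>\<^sup>+x. ennreal ((norm (hankel_conv f g x))\<^sup>2) \<partial>\<mu>) = (\<integral>\<^sup>+x. ennreal ((norm (u x))\<^sup>2) \<partial>\<mu>)"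
    using AE_mu_pos by (intro nn_integral_cong_AE, eventually_elim) (simp add: conv)
  also have "\<dots> = (\<integral>\<^sup>+\<xi>. ennreal ((norm (hankel \<alpha> u \<xi>))\<^sup>2) \<partial>\<mu>)"
    by (rule hankel_Plancherel[OF u_cont u_bound u_int, symmetric])
  finally show ?thesis
    by (simp add: u_hankel norm_mult power_mult_distrib ennreal_mult)
qed

end

subsection \<open>The wavelet transform is an isometry\<close>

text \<open>Invariance of da/a under a -> \<xi>/a. It is the reason why every \<xi> > 0 yields the
  same constant when the wavelet is integrated over all scales.\<close>

lemma nn_integral_Haar_inversion:
  fixes k :: "real \<Rightarrow> real"
  assumes [measurable]: "k \<in> borel_measurable borel" and \<xi>: "\<xi> > 0"
  shows "(\<integral>\<^sup>+a. ennreal (indicator {0<..} a * k (\<xi> / a) / a) \<partial>lborel) = (\<integral>\<^sup>+b. ennreal (indicator {0<..} b * k b / b) \<partial>lborel)"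
proof -
  \<comment> \<open>These intervals exhaust the open half-line. The double \<open>Suc\<close> in the
    upper ends keeps the first interval nondegenerate: its ends are 1 and 2.\<close>
  define l where "l n = 1 / real (Suc n)" for n
  define u where "u n = real (Suc (Suc n))" for n
  \<comment> \<open>Inversion reverses the order. The substitution therefore uses the increasing map
    a -> -\<xi>/a onto the negative half-line, and a reflection follows.\<close>
  let ?f = "\<lambda>y. ennreal (k (- y) / (- y))" and ?g = "\<lambda>a. - \<xi> / a" and ?g' = "\<lambda>a. \<xi> / a\<^sup>2"
  have lpos: "l n > 0" for n by (simp add: l_def)
  have lu: "l n < u n" for n
  proof -
    have "l n \<le> 1" by (simp add: l_def)
    then show ?thesis by (simp add: u_def)
  qed
  have l_ex: "\<exists>n. l n \<le> x" if "x > 0" for x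
    using reals_Archimedean[OF that] unfolding l_def by (auto simp: inverse_eq_divide intro: less_imp_le)
  have u_ex: "\<exists>n. x \<le> u n" for x
  proof -
    obtain n where "x \<le> real n" using real_arch_simple by blast
    then have "x \<le> u n" by (simp add: u_def)
    then show ?thesis ..
  qed
  have l_dec: "decseq l" and u_inc: "incseq u"
    by (auto simp: l_def u_def decseq_def incseq_def divide_simps)
  have ex: "\<exists>n. l n \<le> x \<and> x \<le> u n" if x: "x > 0" for x
  proof -
    obtain n m where nm: "l n \<le> x" "x \<le> u m" using l_ex[OF x] u_ex by blast
    have "l (max n m) \<le> l n" "u m \<le> u (max n m)" using l_dec u_inc by (auto simp: decseq_def incseq_def)
    with nm show ?thesis by (intro exI[of _ "max n m"]) auto
  qed
  have U1: "(\<Union>n. {l n..u n}) = {0<..}"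
    using ex by (auto intro: less_le_trans[OF lpos])
  have U2: "(\<Union>n. {?g (l n)..?g (u n)}) = {..<0}"
  proof (intro equalityI subsetI)
    fix y assume "y \<in> (\<Union>n. {?g (l n)..?g (u n)})"
    then obtain n where "y \<le> - \<xi> / u n" by auto
    moreover have "- \<xi> / u n < 0" using \<xi> by (simp add: u_def)
    ultimately show "y \<in> {..<0}" by simp
  next
    fix y assume "y \<in> {..<(0::real)}"
    then have y: "y < 0" by simp
    then have "0 < \<xi> / (- y)" using \<xi> by (intro divide_pos_pos) auto
    then obtain n where n: "l n \<le> \<xi> / (- y)" "\<xi> / (- y) \<le> u n" using ex by blast
    have u0: "u n > 0" using lu[of n] lpos[of n] by linarith
    have "?g (l n) \<le> y" using n(1) y lpos[of n] by (simp add: field_simps)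
    moreover have "y \<le> ?g (u n)" using n(2) y u0 by (simp add: field_simps)
    ultimately show "y \<in> (\<Union>n. {?g (l n)..?g (u n)})" by auto
  qed
  have pos: "x > 0" if "x \<in> {l n..u n}" for x n
    using that lpos[of n] by auto
  have S: "(\<integral>\<^sup>+y. ?f y * indicator (\<Union>n. {?g (l n)..?g (u n)}) y \<partial>lborel)
      = (\<integral>\<^sup>+a. ?f (?g a) * ennreal (?g' a) * indicator (\<Union>n. {l n..u n}) a \<partial>lborel)"
  proof (rule nn_integral_substitution_exhausting)
    show "(?g has_real_derivative ?g' x) (at x)" if "x \<in> {l n..u n}" for n x
      using pos[OF that] by (auto intro!: derivative_eq_intros simp: power2_eq_square)
    show "continuous_on {l n..u n} ?g'" for n
      using pos by (intro continuous_intros) force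
    show "?g' x \<ge> 0" if "x \<in> {l n..u n}" for n x using \<xi> by simp
  qed (use lu l_dec u_inc in auto)
  have "(\<integral>\<^sup>+a. ennreal (indicator {0<..} a * k (\<xi> / a) / a) \<partial>lborel)
     = (\<integral>\<^sup>+a. ?f (?g a) * ennreal (?g' a) * indicator {0<..} a \<partial>lborel)"
  proof (rule nn_integral_cong)
    fix a :: real
    show "ennreal (indicator {0<..} a * k (\<xi> / a) / a) = ?f (?g a) * ennreal (?g' a) * indicator {0<..} a"
    proof (cases "a > 0")
      case True
      have "?f (?g a) * ennreal (?g' a) = ennreal (k (- ?g a) / (- ?g a) * ?g' a)"
        using \<xi> by (intro ennreal_mult''[symmetric]) auto
      also have "k (- ?g a) / (- ?g a) * ?g' a = k (\<xi> / a) / a"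
        using True \<xi> by (simp add: power2_eq_square)
      finally show ?thesis using True by simp
    qed simp
  qed
  also have "\<dots> = (\<integral>\<^sup>+y. ?f y * indicator {..<0} y \<partial>lborel)"
    using S unfolding U1 U2 ..
  also have "\<dots> = (\<integral>\<^sup>+b. ?f (- b) * indicator {..<0} (- b) \<partial>lborel)"
    by (subst nn_integral_real_affine[where c="-1" and t=0]) auto
  also have "\<dots> = (\<integral>\<^sup>+b. ennreal (indicator {0<..} b * k b / b) \<partial>lborel)"
    by (intro nn_integral_cong) (auto simp: indicator_def)
  finally show ?thesis .
qed

section \<open>Dilations and the measure on scales and positions\<close>

context hankel_setup
begin

lemma dilation_measurable [measurable]:
  assumes [measurable]: "f \<in> borel_measurable borel" "g \<in> borel_measurable M" "h \<in> borel_measurable M"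
  shows "(\<lambda>z. dilation \<alpha> (g z) f (h z)) \<in> borel_measurable M"
  unfolding dilation_def by measurable

lemma integrable_dilation:
  assumes "integrable \<mu> f" "a > 0"
  shows "integrable \<mu> (dilation \<alpha> a f)"
  unfolding dilation_def[abs_def] by (intro integrable_mult_right integrable_mu_scale assms)

text \<open>Rescaling contributes a^(-(2\<alpha>+2)), of which the amplitude a^(\<alpha>+1) of the
  dilation absorbs half.\<close>

lemma hankel_dilation:
  assumes [measurable]: "f \<in> borel_measurable borel" and a: "a > 0"
  shows "hankel \<alpha> (dilation \<alpha> a f) \<xi> = complex_of_real (a powr (- (\<alpha>+1))) * hankel \<alpha> f (\<xi> / a)"
proof -
  let ?j = "\<lambda>x. complex_of_real (bessel_j \<alpha> x)"
  have "hankel \<alpha> f (\<xi> / a) = a powr (2*\<alpha>+2) *\<^sub>R (\<integral>x. f (a * x) * ?j (a * x * (\<xi> / a)) \<partial>\<mu>)"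
    unfolding hankel_def by (rule integral_mu_scale[OF _ a]) measurable
  also have "(\<integral>x. f (a * x) * ?j (a * x * (\<xi> / a)) \<partial>\<mu>) = (\<integral>x. f (a * x) * ?j (x * \<xi>) \<partial>\<mu>)"
    using a by simp
  finally have 1: "hankel \<alpha> f (\<xi> / a) = complex_of_real (a powr (2*\<alpha>+2)) * (\<integral>x. f (a * x) * ?j (x * \<xi>) \<partial>\<mu>)"
    by (simp add: scaleR_conv_of_real)
  have "hankel \<alpha> (dilation \<alpha> a f) \<xi> = (\<integral>x. complex_of_real (a powr (\<alpha>+1)) * (f (a * x) * ?j (x * \<xi>)) \<partial>\<mu>)"
    unfolding hankel_def dilation_def by (simp only: mult.assoc)
  also have "\<dots> = complex_of_real (a powr (\<alpha>+1)) * (\<integral>x. f (a * x) * ?j (x * \<xi>) \<partial>\<mu>)"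
    by (rule integral_mult_right_zero)
  also have "a powr (\<alpha>+1) = a powr (- (\<alpha>+1)) * a powr (2*\<alpha>+2)"
    by (subst powr_add[symmetric]) simp
  finally show ?thesis unfolding 1 by (simp only: of_real_mult mult.assoc)
qed

lemma sqnorm_dilation:
  assumes [measurable]: "f \<in> borel_measurable borel" and a: "a > 0"
  shows "sqnorm (dilation \<alpha> a f) = sqnorm f"
proof -
  have "sqnorm f = ennreal (a powr (2*\<alpha>+2)) * (\<integral>\<^sup>+x. ennreal ((norm (f (a * x)))\<^sup>2) \<partial>\<mu>)"
    unfolding sqnorm_def by (rule nn_integral_mu_scale[OF _ a]) measurable
  also have "\<dots> = (\<integral>\<^sup>+x. ennreal (a powr (2*\<alpha>+2)) * ennreal ((norm (f (a * x)))\<^sup>2) \<partial>\<mu>)"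
    by (rule nn_integral_cmult[symmetric]) measurable
  also have "\<dots> = sqnorm (dilation \<alpha> a f)"
  proof -
    have "a powr (2*\<alpha>+2) = (a powr (\<alpha>+1))\<^sup>2"
      by (simp add: power2_eq_square flip: powr_add)
    then show ?thesis
      unfolding sqnorm_def dilation_def by (simp add: norm_mult power_mult_distrib ennreal_mult)
  qed
  finally show ?thesis ..
qed

abbreviation scale_weight :: "real \<Rightarrow> real" where
  "scale_weight a \<equiv> indicator {0<..} a * a powr (2*\<alpha>+1)"

lemma nu_eq: "nu_alpha \<alpha> = density lborel (\<lambda>a. ennreal (scale_weight a)) \<Otimes>\<^sub>M \<mu>"
  unfolding nu_alpha_def ..

lemma sets_nu [measurable_cong, simp]: "sets (nu_alpha \<alpha>) = sets (borel \<Otimes>\<^sub>M borel)"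
  unfolding nu_eq by (intro sets_pair_measure_cong) simp_all

text \<open>The identities for translations are proved at positive positions and those for dilations
  at positive scales; this makes them sufficient for integration over the whole domain.\<close>

lemma AE_nu_pos: "AE p in nu_alpha \<alpha>. 0 < fst p \<and> 0 < snd p"
proof -
  have "sigma_finite_measure (density lborel (\<lambda>a. ennreal (scale_weight a)))"
    by (subst sigma_finite_measure.sigma_finite_iff_density_finite[OF sigma_finite_lborel]) auto
  then interpret nu: pair_sigma_finite "density lborel (\<lambda>a. ennreal (scale_weight a))" \<mu>
    by (intro pair_sigma_finite.intro sigma_finite_mu)
  have "AE a in density lborel (\<lambda>a. ennreal (scale_weight a)). 0 < a"
    by (subst AE_density) (auto simp: indicator_def)
  then have "AE a in density lborel (\<lambda>a. ennreal (scale_weight a)). AE x in \<mu>. 0 < a \<and> 0 < x"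
    by eventually_elim (use AE_mu_pos in auto)
  moreover have "{p \<in> space (density lborel (\<lambda>a. ennreal (scale_weight a)) \<Otimes>\<^sub>M \<mu>). 0 < fst p \<and> 0 < snd p}
      \<in> sets (density lborel (\<lambda>a. ennreal (scale_weight a)) \<Otimes>\<^sub>M \<mu>)"
    by measurable
  ultimately show ?thesis
    unfolding nu_eq by (intro nu.AE_pair_measure) simp_all
qed

lemma wavelet_transform_eq:
  "wavelet_transform \<alpha> \<psi> f (a, x) = complex_of_real (1 / sqrt (c_psi \<alpha> \<psi>)) * hankel_conv f (dilation \<alpha> a \<psi>) x"
  unfolding wavelet_transform_def hankel_conv_def by simp

lemma wavelet_transform_measurable [measurable]:
  assumes [measurable]: "f \<in> borel_measurable borel" "\<psi> \<in> borel_measurable borel"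
  shows "wavelet_transform \<alpha> \<psi> f \<in> borel_measurable (borel \<Otimes>\<^sub>M borel)"
proof -
  have D: "dilation \<alpha> a \<psi> \<in> borel_measurable borel" for a by measurable
  show ?thesis
    unfolding wavelet_transform_def hankel_transl_eq[OF D] by measurable
qed

end

locale wavelet_setup = hankel_setup +
  fixes \<psi> :: "real \<Rightarrow> complex"
  assumes adm: "admissible \<alpha> \<psi>"
begin

abbreviation "W \<equiv> wavelet_transform \<alpha> \<psi>"
abbreviation "c\<^sub>\<psi> \<equiv> c_psi \<alpha> \<psi>"

lemma psi_integrable: "integrable \<mu> \<psi>"
  using adm by (simp add: admissible_def)

lemma psi_measurable [measurable]: "\<psi> \<in> borel_measurable borel"
  using borel_measurable_integrable[OF psi_integrable] by simp

lemma c_psi_pos: "c\<^sub>\<psi> > 0" and ennreal_c_psi: "ennreal c\<^sub>\<psi> = c_psi_ennreal \<alpha> \<psi>"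
  using adm by (auto simp: admissible_def c_psi_def enn2real_positive_iff less_top)

text \<open>An integrable function with an essential bound C satisfies |\<psi>|^2 \<le> |C| |\<psi>|
  almost everywhere. The absolute value is taken because the bound comes without a sign.\<close>

lemma sqnorm_psi_finite: "sqnorm \<psi> < \<infinity>"
proof -
  obtain C where C: "AE x in \<mu>. norm (\<psi> x) \<le> C" using adm by (auto simp: admissible_def)
  have "sqnorm \<psi> \<le> (\<integral>\<^sup>+x. ennreal \<bar>C\<bar> * ennreal (norm (\<psi> x)) \<partial>\<mu>)"
    unfolding sqnorm_def
  proof (rule nn_integral_mono_AE, use C in eventually_elim)
    case (elim x)
    have "norm (\<psi> x) * norm (\<psi> x) \<le> \<bar>C\<bar> * norm (\<psi> x)" using elim by (intro mult_right_mono) auto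
    then show ?case by (simp add: ennreal_mult[symmetric] power2_eq_square)
  qed
  also have "\<dots> = ennreal \<bar>C\<bar> * (\<integral>\<^sup>+x. ennreal (norm (\<psi> x)) \<partial>\<mu>)"
    by (rule nn_integral_cmult) measurable
  also have "\<dots> < \<infinity>"
    using psi_integrable by (simp add: integrable_iff_bounded ennreal_mult_less_top)
  finally show ?thesis .
qed

lemma sqnorm_dilation_psi_finite: "a > 0 \<Longrightarrow> sqnorm (dilation \<alpha> a \<psi>) < \<infinity>"
  using sqnorm_psi_finite by (simp add: sqnorm_dilation)

definition energy :: "(real \<Rightarrow> complex) \<Rightarrow> ennreal" where
  "energy f = (\<integral>\<^sup>+p. ennreal ((norm (W f p))\<^sup>2) \<partial>nu_alpha \<alpha>)"

text \<open>The bound is uniform: a dilate has the norm of \<psi> at every scale, and Cauchy-Schwarz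
  on the product with the angle gives the same constant at every position.\<close>

lemma wavelet_bound:
  assumes [measurable]: "f \<in> borel_measurable borel" and fin: "sqnorm f < \<infinity>" and p: "0 < fst p" "0 < snd p"
  shows "ennreal ((norm (W f p))\<^sup>2) \<le> ennreal (1 / c\<^sub>\<psi>) * (sqnorm f * sqnorm \<psi>)"
proof -
  obtain a x where ax: "p = (a, x)" by (cases p)
  have "(norm (W f p))\<^sup>2 = 1 / c\<^sub>\<psi> * (norm (hankel_conv f (dilation \<alpha> a \<psi>) x))\<^sup>2"
    using c_psi_pos by (simp add: ax wavelet_transform_eq norm_mult norm_divide power_divide)
  then have "ennreal ((norm (W f p))\<^sup>2) = ennreal (1 / c\<^sub>\<psi>) * ennreal ((norm (hankel_conv f (dilation \<alpha> a \<psi>) x))\<^sup>2)"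
    by (simp only: ennreal_mult''[OF zero_le_power2])
  also have "\<dots> \<le> ennreal (1 / c\<^sub>\<psi>) * (sqnorm f * sqnorm (dilation \<alpha> a \<psi>))"
    using p fin sqnorm_dilation_psi_finite[of a] by (intro mult_left_mono hankel_conv_bound) (auto simp: ax)
  finally show ?thesis using p by (simp add: ax sqnorm_dilation)
qed

lemma wavelet_lincomb:
  assumes [measurable]: "f \<in> borel_measurable borel" "h \<in> borel_measurable borel"
    and fin: "sqnorm f < \<infinity>" "sqnorm h < \<infinity>" and p: "0 < fst p" "0 < snd p"
  shows "W (\<lambda>t. a * f t + b * h t) p = a * W f p + b * W h p"
proof -
  obtain s x where ax: "p = (s, x)" by (cases p)
  then have p': "s > 0" "x > 0" using p by auto
  have D: "dilation \<alpha> s \<psi> \<in> borel_measurable borel" by measurable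
  show ?thesis
    unfolding ax wavelet_transform_eq hankel_conv_lincomb[OF assms(1,2) D p'(2) fin sqnorm_dilation_psi_finite[OF p'(1)]]
    by (simp add: algebra_simps)
qed

text \<open>At a fixed scale the convolution identity gives the integral of |Hf(\<xi>)|^2
  |H\<psi>(\<xi>/a)|^2, H denoting the Hankel transform, and the powers of a leave 1/a. After
  Tonelli, the integral over the scales equals \<open>c\<^sub>\<psi>\<close> for each \<xi> > 0 and
  cancels the normalisation of \<open>W\<close>; Plancherel for \<open>f\<close> finishes.\<close>

lemma energy_nice:
  assumes nice: "nice f"
  shows "energy f = sqnorm f"
proof -
  from nice obtain B where cont: "continuous_on UNIV f" and B: "\<And>x. norm (f x) \<le> B" and f: "integrable \<mu> f"
    by (auto simp: nice_def)
  have [measurable]: "f \<in> borel_measurable borel" using nice_measurable[OF nice] .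
  let ?Hf = "\<lambda>\<xi>. ennreal ((norm (hankel \<alpha> f \<xi>))\<^sup>2)"
  let ?k = "\<lambda>b. (norm (hankel \<alpha> \<psi> b))\<^sup>2"
  interpret lm: pair_sigma_finite lborel \<mu> ..
  have inner: "ennreal (scale_weight a) * (\<integral>\<^sup>+x. ennreal ((norm (W f (a, x)))\<^sup>2) \<partial>\<mu>)
      = (\<integral>\<^sup>+\<xi>. ennreal (1 / c\<^sub>\<psi>) * ?Hf \<xi> * ennreal (indicator {0<..} a * ?k (\<xi> / a) / a) \<partial>\<mu>)" for a
  proof (cases "a > 0")
    case True
    \<comment> \<open>The density a^(2\<alpha>+1) on the scales is such that the exponents add up to
      -1, the density of da/a.\<close>
    have sq: "(a powr (- (\<alpha>+1)))\<^sup>2 * a powr (2*\<alpha>+1) = 1 / a"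
    proof -
      have "(a powr (- (\<alpha>+1)))\<^sup>2 * a powr (2*\<alpha>+1) = a powr (- (\<alpha>+1) + (- (\<alpha>+1)) + (2*\<alpha>+1))"
        by (simp only: power2_eq_square powr_add)
      also have "\<dots> = a powr (- 1)" by simp
      finally show ?thesis using True by (simp add: powr_minus divide_inverse)
    qed
    have "(\<integral>\<^sup>+x. ennreal ((norm (W f (a, x)))\<^sup>2) \<partial>\<mu>) = (\<integral>\<^sup>+x. ennreal (1 / c\<^sub>\<psi>) * ennreal ((norm (hankel_conv f (dilation \<alpha> a \<psi>) x))\<^sup>2) \<partial>\<mu>)"
      using c_psi_pos
      by (intro nn_integral_cong) (simp add: wavelet_transform_eq norm_mult norm_divide power_divide flip: ennreal_mult'')
    also have "\<dots> = ennreal (1 / c\<^sub>\<psi>) * (\<integral>\<^sup>+x. ennreal ((norm (hankel_conv f (dilation \<alpha> a \<psi>) x))\<^sup>2) \<partial>\<mu>)"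
      unfolding hankel_conv_def by (rule nn_integral_cmult) measurable
    also have "\<dots> = ennreal (1 / c\<^sub>\<psi>) * (\<integral>\<^sup>+\<xi>. ?Hf \<xi> * ennreal ((norm (hankel \<alpha> (dilation \<alpha> a \<psi>) \<xi>))\<^sup>2) \<partial>\<mu>)"
      by (simp only: nn_integral_hankel_conv[OF nice integrable_dilation[OF psi_integrable True]])
    finally have "ennreal (scale_weight a) * (\<integral>\<^sup>+x. ennreal ((norm (W f (a, x)))\<^sup>2) \<partial>\<mu>)
      = ennreal (scale_weight a) * (ennreal (1 / c\<^sub>\<psi>) * (\<integral>\<^sup>+\<xi>. ?Hf \<xi> * ennreal ((norm (hankel \<alpha> (dilation \<alpha> a \<psi>) \<xi>))\<^sup>2) \<partial>\<mu>))"
      by simp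
    also have "\<dots> = (\<integral>\<^sup>+\<xi>. ennreal (scale_weight a) * (ennreal (1 / c\<^sub>\<psi>) * (?Hf \<xi> * ennreal ((norm (hankel \<alpha> (dilation \<alpha> a \<psi>) \<xi>))\<^sup>2))) \<partial>\<mu>)"
      by (subst nn_integral_cmult[symmetric], measurable, subst nn_integral_cmult[symmetric], measurable)
    also have "\<dots> = (\<integral>\<^sup>+\<xi>. ennreal (1 / c\<^sub>\<psi>) * ?Hf \<xi> * ennreal (indicator {0<..} a * ?k (\<xi> / a) / a) \<partial>\<mu>)"
    proof (rule nn_integral_cong)
      fix \<xi>
      have "ennreal (scale_weight a) * ennreal ((norm (hankel \<alpha> (dilation \<alpha> a \<psi>) \<xi>))\<^sup>2)
         = ennreal ((a powr (- (\<alpha>+1)))\<^sup>2 * a powr (2*\<alpha>+1) * ?k (\<xi> / a))"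
        using True by (simp add: hankel_dilation norm_mult power_mult_distrib mult_ac flip: ennreal_mult'')
      also have "\<dots> = ennreal (indicator {0<..} a * ?k (\<xi> / a) / a)"
        unfolding sq using True by simp
      finally have *: "ennreal (scale_weight a) * ennreal ((norm (hankel \<alpha> (dilation \<alpha> a \<psi>) \<xi>))\<^sup>2)
         = ennreal (indicator {0<..} a * ?k (\<xi> / a) / a)" .
      have "ennreal (scale_weight a) * (ennreal (1 / c\<^sub>\<psi>) * (?Hf \<xi> * ennreal ((norm (hankel \<alpha> (dilation \<alpha> a \<psi>) \<xi>))\<^sup>2)))
        = ennreal (1 / c\<^sub>\<psi>) * ?Hf \<xi> * (ennreal (scale_weight a) * ennreal ((norm (hankel \<alpha> (dilation \<alpha> a \<psi>) \<xi>))\<^sup>2))"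
        by (simp only: mult_ac)
      then show "ennreal (scale_weight a) * (ennreal (1 / c\<^sub>\<psi>) * (?Hf \<xi> * ennreal ((norm (hankel \<alpha> (dilation \<alpha> a \<psi>) \<xi>))\<^sup>2)))
        = ennreal (1 / c\<^sub>\<psi>) * ?Hf \<xi> * ennreal (indicator {0<..} a * ?k (\<xi> / a) / a)"
        by (simp only: *)
    qed
    finally show ?thesis .
  qed simp
  have "energy f = (\<integral>\<^sup>+a. (\<integral>\<^sup>+x. ennreal ((norm (W f (a, x)))\<^sup>2) \<partial>\<mu>) \<partial>density lborel (\<lambda>a. ennreal (scale_weight a)))"
    unfolding energy_def nu_eq by (rule mu.nn_integral_fst[symmetric]) measurable
  also have "\<dots> = (\<integral>\<^sup>+a. ennreal (scale_weight a) * (\<integral>\<^sup>+x. ennreal ((norm (W f (a, x)))\<^sup>2) \<partial>\<mu>) \<partial>lborel)"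
    by (rule nn_integral_density) measurable
  also have "\<dots> = (\<integral>\<^sup>+a. (\<integral>\<^sup>+\<xi>. ennreal (1 / c\<^sub>\<psi>) * ?Hf \<xi> * ennreal (indicator {0<..} a * ?k (\<xi> / a) / a) \<partial>\<mu>) \<partial>lborel)"
    by (simp only: inner)
  also have "\<dots> = (\<integral>\<^sup>+\<xi>. (\<integral>\<^sup>+a. ennreal (1 / c\<^sub>\<psi>) * ?Hf \<xi> * ennreal (indicator {0<..} a * ?k (\<xi> / a) / a) \<partial>lborel) \<partial>\<mu>)"
    by (rule lm.Fubini'[symmetric]) measurable
  also have "\<dots> = (\<integral>\<^sup>+\<xi>. ?Hf \<xi> \<partial>\<mu>)"
  proof (rule nn_integral_cong_AE, use AE_mu_pos in eventually_elim)
    case (elim \<xi>)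
    have "(\<integral>\<^sup>+a. ennreal (1 / c\<^sub>\<psi>) * ?Hf \<xi> * ennreal (indicator {0<..} a * ?k (\<xi> / a) / a) \<partial>lborel)
       = ennreal (1 / c\<^sub>\<psi>) * ?Hf \<xi> * (\<integral>\<^sup>+a. ennreal (indicator {0<..} a * ?k (\<xi> / a) / a) \<partial>lborel)"
      by (rule nn_integral_cmult) measurable
    also have "(\<integral>\<^sup>+a. ennreal (indicator {0<..} a * ?k (\<xi> / a) / a) \<partial>lborel) = ennreal c\<^sub>\<psi>"
      unfolding ennreal_c_psi c_psi_ennreal_def by (rule nn_integral_Haar_inversion[OF _ elim]) measurable
    also have "ennreal (1 / c\<^sub>\<psi>) * ?Hf \<xi> * ennreal c\<^sub>\<psi> = (ennreal (1 / c\<^sub>\<psi>) * ennreal c\<^sub>\<psi>) * ?Hf \<xi>"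
      by (simp only: mult_ac)
    also have "ennreal (1 / c\<^sub>\<psi>) * ennreal c\<^sub>\<psi> = 1"
      using c_psi_pos by (subst ennreal_mult[symmetric]) auto
    finally show ?case by simp
  qed
  also have "\<dots> = sqnorm f"
    unfolding sqnorm_def by (rule hankel_Plancherel[OF cont B f])
  finally show ?thesis .
qed


section \<open>Extension of the isometry to all square-integrable functions\<close>

lemma sqnorm_tendsto:
  fixes g :: "nat \<Rightarrow> real \<Rightarrow> complex" and h :: "real \<Rightarrow> complex" and v :: "real \<Rightarrow> real"
  assumes [measurable]: "\<And>n. g n \<in> borel_measurable borel" "h \<in> borel_measurable borel" "v \<in> borel_measurable borel"
    and lim: "AE x in \<mu>. (\<lambda>n. g n x) \<longlonglongrightarrow> h x"
    and le: "\<And>n. AE x in \<mu>. norm (g n x) \<le> v x"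
    and fin: "(\<integral>\<^sup>+x. ennreal ((v x)\<^sup>2) \<partial>\<mu>) < \<infinity>"
  shows "(\<lambda>n. sqnorm (g n)) \<longlonglongrightarrow> sqnorm h"
  unfolding sqnorm_def
proof (rule nn_integral_dominated_convergence)
  show "AE x in \<mu>. ennreal ((norm (g n x))\<^sup>2) \<le> ennreal ((v x)\<^sup>2)" for n
    using le[of n] by eventually_elim (intro ennreal_leI power_mono, auto)
  show "AE x in \<mu>. (\<lambda>n. ennreal ((norm (g n x))\<^sup>2)) \<longlonglongrightarrow> ennreal ((norm (h x))\<^sup>2)"
    using lim by eventually_elim (intro tendsto_intros tendsto_ennrealI)
qed (use fin in auto)

lemma sqnorm_le:
  assumes "AE x in \<mu>. norm (g x) \<le> v x"
  shows "sqnorm g \<le> (\<integral>\<^sup>+x. ennreal ((v x)\<^sup>2) \<partial>\<mu>)"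
  unfolding sqnorm_def
  by (rule nn_integral_mono_AE, use assms in eventually_elim) (intro ennreal_leI power_mono, auto)

lemma nn_integral_gauss_scaled_sq: "(\<integral>\<^sup>+x. ennreal ((B * gauss x)\<^sup>2) \<partial>\<mu>) < \<infinity>"
proof -
  have "(\<integral>\<^sup>+x. ennreal ((B * gauss x)\<^sup>2) \<partial>\<mu>) \<le> (\<integral>\<^sup>+x. ennreal (B\<^sup>2) * ennreal (gauss x) \<partial>\<mu>)"
  proof (rule nn_integral_mono)
    fix x
    have "(B * gauss x)\<^sup>2 = B\<^sup>2 * (gauss x * gauss x)" by (simp add: power2_eq_square)
    also have "\<dots> \<le> B\<^sup>2 * gauss x"
      by (intro mult_left_mono mult_left_le gauss_le_1) auto
    finally show "ennreal ((B * gauss x)\<^sup>2) \<le> ennreal (B\<^sup>2) * ennreal (gauss x)"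
      by (simp add: ennreal_mult[symmetric] ennreal_leI)
  qed
  also have "\<dots> = ennreal (B\<^sup>2) * (\<integral>\<^sup>+x. ennreal (gauss x) \<partial>\<mu>)"
    by (rule nn_integral_cmult) measurable
  also have "\<dots> < \<infinity>"
    using integrable_gauss by (simp add: integrable_iff_bounded ennreal_mult_less_top)
  finally show ?thesis .
qed

lemma nice_lincomb:
  assumes "nice f" "nice g"
  shows "nice (\<lambda>x. a * f x + b * g x)"
proof -
  obtain A B where A: "\<And>x. norm (f x) \<le> A" and B: "\<And>x. norm (g x) \<le> B"
    using assms by (auto simp: nice_def)
  have "norm (a * f x + b * g x) \<le> norm a * A + norm b * B" for x
    by (rule norm_triangle_le) (auto simp: norm_mult intro!: add_mono mult_left_mono A B)
  then show ?thesis
    using assms unfolding nice_def by (auto intro!: continuous_intros)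
qed

text \<open>A bounded function with bounded support is an a.e. limit of continuous functions by the
  definition of \<open>measurable_on\<close>; truncating their values and multiplying by a cutoff makes
  them nice and uniformly dominated.\<close>

lemma nice_approximation:
  fixes f :: "real \<Rightarrow> complex"
  assumes [measurable]: "f \<in> borel_measurable borel"
    and M: "\<And>x. norm (f x) \<le> M" and supp: "\<And>x. \<bar>x\<bar> > R \<Longrightarrow> f x = 0"
  obtains h :: "nat \<Rightarrow> real \<Rightarrow> complex" and B where "\<And>n. nice (h n)" "AE x in \<mu>. (\<lambda>n. h n x) \<longlonglongrightarrow> f x"
    "\<And>n x. norm (h n x) \<le> B * gauss x"
proof -
  \<comment> \<open>The added 1 makes K positive even when M = 0, as the division in
    \<open>clip\<close> requires.\<close>
  define K where "K = M + 1"
  have K: "K > 0" using order_trans[OF norm_ge_zero M] by (simp add: K_def)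
  have f_le_K: "norm (f x) \<le> K" for x using M[of x] by (simp add: K_def)
  have "f \<in> borel_measurable lebesgue" by (rule measurable_completion) measurable
  then have "f measurable_on UNIV" by (rule lebesgue_measurable_imp_measurable_on) auto
  then obtain N g where N: "negligible N" and g_cont: "\<And>n. continuous_on UNIV (g n)"
    and g_lim: "\<And>x. x \<notin> N \<Longrightarrow> (\<lambda>n. g n x) \<longlonglongrightarrow> f x"
    unfolding measurable_on_def by auto
  \<comment> \<open>The radial retraction onto the ball of radius K. It is continuous and fixes all
    values of \<open>f\<close>, so clipping does not disturb the limit.\<close>
  define clip where "clip z = (K / max K (norm z)) *\<^sub>R z" for z :: complex
  have clip_cont: "continuous_on UNIV clip"
    unfolding clip_def using K by (intro continuous_intros) auto
  have clip_le: "norm (clip z) \<le> K" for z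
    using K by (auto simp: clip_def max_def divide_simps)
  have clip_id: "clip z = z" if "norm z \<le> K" for z
    using K that by (simp add: clip_def max_def)
  define cut where "cut x = max 0 (min 1 (R + 1 - \<bar>x\<bar>))" for x :: real
  have cut_cont: "continuous_on UNIV cut" unfolding cut_def by (intro continuous_intros)
  have cut: "0 \<le> cut x" "cut x \<le> 1" "\<bar>x\<bar> \<le> R \<Longrightarrow> cut x = 1" "\<bar>x\<bar> > R + 1 \<Longrightarrow> cut x = 0" for x
    by (auto simp: cut_def)
  define h where "h n x = cut x *\<^sub>R clip (g n x)" for n x
  \<comment> \<open>Chosen so that B * gauss x is at least K wherever |x| \<le> R + 1, outside which
    the cutoff vanishes.\<close>
  define B where "B = K * exp ((R+1)\<^sup>2 / 2)"
  have h_le: "norm (h n x) \<le> B * gauss x" for n x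
  proof (cases "\<bar>x\<bar> > R + 1")
    case True
    then show ?thesis using K by (simp add: h_def cut B_def)
  next
    case False
    then have "x\<^sup>2 \<le> (R+1)\<^sup>2" by (auto simp: abs_le_square_iff[symmetric])
    then have "0 \<le> (R+1)\<^sup>2 / 2 + - x\<^sup>2 / 2" by simp
    then have "1 \<le> exp ((R+1)\<^sup>2 / 2) * gauss x"
      unfolding gauss_def exp_add[symmetric] by simp
    then have "K * 1 \<le> K * (exp ((R+1)\<^sup>2 / 2) * gauss x)" using K by (intro mult_left_mono) auto
    moreover have "norm (h n x) \<le> 1 * K"
      unfolding h_def norm_scaleR using cut[of x] by (intro mult_mono clip_le) auto
    ultimately show ?thesis by (simp add: B_def mult.assoc)
  qed
  have h_cont: "continuous_on UNIV (h n)" for n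
    unfolding h_def
    by (intro continuous_intros cut_cont continuous_on_compose2[OF clip_cont g_cont]) auto
  have h_nice: "nice (h n)" for n
    unfolding nice_def
  proof (intro conjI exI allI)
    show "continuous_on UNIV (h n)" by (rule h_cont)
    show "norm (h n x) \<le> 1 * K" for x
      unfolding h_def norm_scaleR using cut[of x] by (intro mult_mono clip_le) auto
    have "h n \<in> borel_measurable borel" using h_cont by (rule borel_measurable_continuous_onI)
    then show "integrable \<mu> (h n)"
      by (intro Bochner_Integration.integrable_bound[OF integrable_mult_right[OF integrable_gauss, of B]])
         (auto intro!: AE_I2 order_trans[OF h_le])
  qed
  have "AE x in lebesgue. x \<notin> N"
    by (rule AE_not_in) (use N in \<open>simp only: negligible_iff_null_sets\<close>)
  then have "AE x in lborel. x \<notin> N" by (simp only: AE_completion_iff)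
  then have "AE x in \<mu>. x \<notin> N" by (auto simp: AE_mu_iff)
  then have "AE x in \<mu>. (\<lambda>n. h n x) \<longlonglongrightarrow> f x"
  proof eventually_elim
    case (elim x)
    have "isCont clip (f x)" using clip_cont by (simp add: continuous_on_eq_continuous_at)
    then have "(\<lambda>n. clip (g n x)) \<longlonglongrightarrow> clip (f x)"
      by (rule isCont_tendsto_compose[OF _ g_lim[OF elim]])
    then have "(\<lambda>n. h n x) \<longlonglongrightarrow> cut x *\<^sub>R clip (f x)"
      unfolding h_def by (intro tendsto_intros)
    moreover have "cut x *\<^sub>R clip (f x) = f x"
      using clip_id[OF f_le_K, of x] cut(3)[of x] supp[of x] by (cases "\<bar>x\<bar> \<le> R") auto
    ultimately show ?case by simp
  qed
  with h_nice h_le show thesis by (intro that)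
qed

end

context wavelet_setup
begin

text \<open>Cauchy-Schwarz applied to differences makes the transforms converge at every point with
  positive coordinates, and Fatou bounds the energy of the limit. The reverse inequality is lost in
  this step, because no integrable majorant for the transforms is at hand.\<close>

lemma energy_limit_le:
  fixes g :: "nat \<Rightarrow> real \<Rightarrow> complex" and h :: "real \<Rightarrow> complex" and v :: "real \<Rightarrow> real"
  assumes g [measurable]: "\<And>n. g n \<in> borel_measurable borel" and h [measurable]: "h \<in> borel_measurable borel"
    and v [measurable]: "v \<in> borel_measurable borel"
    and lim: "AE x in \<mu>. (\<lambda>n. g n x) \<longlonglongrightarrow> h x"
    and le: "\<And>n. AE x in \<mu>. norm (g n x) \<le> v x"
    and fin: "(\<integral>\<^sup>+x. ennreal ((v x)\<^sup>2) \<partial>\<mu>) < \<infinity>"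
    and energy: "\<And>n. energy (g n) = sqnorm (g n)"
  shows "energy h \<le> sqnorm h"
proof -
  have g_fin: "sqnorm (g n) < \<infinity>" for n
    using sqnorm_le[OF le] fin by (rule le_less_trans)
  have "AE x in \<mu>. \<forall>n. norm (g n x) \<le> v x" using le by (simp add: AE_all_countable)
  with lim have h_le: "AE x in \<mu>. norm (h x) \<le> v x"
    by eventually_elim (auto intro: Lim_bounded[OF tendsto_norm])
  then have h_fin: "sqnorm h < \<infinity>"
    using sqnorm_le fin by (blast intro: le_less_trans)
  have sq_lim: "(\<lambda>n. sqnorm (g n)) \<longlonglongrightarrow> sqnorm h"
    by (rule sqnorm_tendsto[OF g h v lim le fin])
  \<comment> \<open>The difference is spelled with coefficients 1 and -1 to have the shape of
    \<open>wavelet_lincomb\<close>.\<close>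
  have diff_lim: "(\<lambda>n. sqnorm (\<lambda>x. 1 * g n x + (-1) * h x)) \<longlonglongrightarrow> sqnorm (\<lambda>x. 0)"
  proof (rule sqnorm_tendsto[where v="\<lambda>x. 2 * v x"])
    show "AE x in \<mu>. (\<lambda>n. 1 * g n x + (-1) * h x) \<longlonglongrightarrow> 0"
      using lim by eventually_elim (auto intro!: tendsto_eq_intros)
    show "AE x in \<mu>. norm (1 * g n x + (-1) * h x) \<le> 2 * v x" for n
      using le[of n] h_le by eventually_elim (auto intro: order_trans[OF norm_triangle_ineq4])
    have "(\<integral>\<^sup>+x. ennreal ((2 * v x)\<^sup>2) \<partial>\<mu>) = 4 * (\<integral>\<^sup>+x. ennreal ((v x)\<^sup>2) \<partial>\<mu>)"
      by (subst nn_integral_cmult[symmetric]) (auto simp: power_mult_distrib ennreal_mult)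
    then show "(\<integral>\<^sup>+x. ennreal ((2 * v x)\<^sup>2) \<partial>\<mu>) < \<infinity>"
      using fin by (simp add: ennreal_mult_less_top)
  qed measurable
  have W_lim: "(\<lambda>n. W (g n) p) \<longlonglongrightarrow> W h p" if p: "0 < fst p" "0 < snd p" for p
  proof -
    have "(\<lambda>n. ennreal (1 / c\<^sub>\<psi>) * (sqnorm (\<lambda>x. 1 * g n x + (-1) * h x) * sqnorm \<psi>)) \<longlonglongrightarrow> ennreal (1 / c\<^sub>\<psi>) * (sqnorm (\<lambda>x. 0) * sqnorm \<psi>)"
      using sqnorm_psi_finite
      by (intro ennreal_tendsto_cmult tendsto_mult_ennreal diff_lim tendsto_const) (auto simp: sqnorm_def)
    then have lim0: "(\<lambda>n. ennreal (1 / c\<^sub>\<psi>) * (sqnorm (\<lambda>x. 1 * g n x + (-1) * h x) * sqnorm \<psi>)) \<longlonglongrightarrow> 0"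
      by (simp add: sqnorm_def)
    have "ennreal ((norm (W (g n) p - W h p))\<^sup>2) \<le> ennreal (1 / c\<^sub>\<psi>) * (sqnorm (\<lambda>x. 1 * g n x + (-1) * h x) * sqnorm \<psi>)" for n
    proof -
      have "AE x in \<mu>. norm (1 * g n x + (-1) * h x) \<le> 2 * v x"
        using le[of n] h_le by eventually_elim (auto intro: order_trans[OF norm_triangle_ineq4])
      then have "sqnorm (\<lambda>x. 1 * g n x + (-1) * h x) \<le> (\<integral>\<^sup>+x. ennreal ((2 * v x)\<^sup>2) \<partial>\<mu>)"
        by (rule sqnorm_le)
      also have "\<dots> = 4 * (\<integral>\<^sup>+x. ennreal ((v x)\<^sup>2) \<partial>\<mu>)"
        by (subst nn_integral_cmult[symmetric]) (auto simp: power_mult_distrib ennreal_mult)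
      also have "\<dots> < \<infinity>"
        using fin by (simp add: ennreal_mult_less_top)
      finally have "sqnorm (\<lambda>x. 1 * g n x + (-1) * h x) < \<infinity>" .
      from wavelet_bound[OF _ this p] show ?thesis
        unfolding wavelet_lincomb[OF g h g_fin h_fin p] by simp
    qed
    then have "(\<lambda>n. ennreal ((norm (W (g n) p - W h p))\<^sup>2)) \<longlonglongrightarrow> 0"
      by (intro tendsto_sandwich[OF _ _ tendsto_const lim0]) auto
    then have "(\<lambda>n. ennreal ((norm (W (g n) p - W h p))\<^sup>2)) \<longlonglongrightarrow> ennreal 0" by simp
    then have "(\<lambda>n. (norm (W (g n) p - W h p))\<^sup>2) \<longlonglongrightarrow> 0"
      by (subst (asm) tendsto_ennreal_iff) auto
    then have "(\<lambda>n. sqrt ((norm (W (g n) p - W h p))\<^sup>2)) \<longlonglongrightarrow> sqrt 0"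
      by (rule tendsto_real_sqrt)
    then show ?thesis by (simp add: tendsto_norm_zero_iff LIM_zero_iff)
  qed
  have "energy h = (\<integral>\<^sup>+p. liminf (\<lambda>n. ennreal ((norm (W (g n) p))\<^sup>2)) \<partial>nu_alpha \<alpha>)"
    unfolding energy_def
  proof (rule nn_integral_cong_AE, use AE_nu_pos in eventually_elim)
    case (elim p)
    then have "(\<lambda>n. ennreal ((norm (W (g n) p))\<^sup>2)) \<longlonglongrightarrow> ennreal ((norm (W h p))\<^sup>2)"
      by (intro tendsto_ennrealI tendsto_intros W_lim) auto
    then show ?case by (rule lim_imp_Liminf[OF trivial_limit_sequentially, symmetric])
  qed
  also have "\<dots> \<le> liminf (\<lambda>n. \<integral>\<^sup>+p. ennreal ((norm (W (g n) p))\<^sup>2) \<partial>nu_alpha \<alpha>)"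
    by (rule nn_integral_liminf) measurable
  also have "\<dots> = liminf (\<lambda>n. sqnorm (g n))"
    by (simp only: energy_def[symmetric] energy)
  also have "\<dots> = sqnorm h"
    using sq_lim by (simp add: lim_imp_Liminf)
  finally show ?thesis .
qed

text \<open>The lower bound comes from the parallelogram inequality
  \<open>4 \<parallel>W h\<parallel>\<^sup>2 \<le> 2 \<parallel>W f\<parallel>\<^sup>2 + 2 \<parallel>W (2 h - f)\<parallel>\<^sup>2\<close>, which turns the upper bound for
  \<open>2 h - f\<close> into a lower bound for \<open>f\<close>.\<close>

lemma energy_limit:
  fixes g :: "nat \<Rightarrow> real \<Rightarrow> complex" and f :: "real \<Rightarrow> complex" and v :: "real \<Rightarrow> real"
  assumes C_meas: "\<And>h. h \<in> C \<Longrightarrow> h \<in> borel_measurable borel"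
    and C_energy: "\<And>h. h \<in> C \<Longrightarrow> energy h = sqnorm h"
    and C_diff: "\<And>h k. h \<in> C \<Longrightarrow> k \<in> C \<Longrightarrow> (\<lambda>x. 2 * h x + (-1) * k x) \<in> C"
    and g: "\<And>n. g n \<in> C" and f [measurable]: "f \<in> borel_measurable borel"
    and v [measurable]: "v \<in> borel_measurable borel"
    and lim: "AE x in \<mu>. (\<lambda>n. g n x) \<longlonglongrightarrow> f x"
    and le: "\<And>n. AE x in \<mu>. norm (g n x) \<le> v x"
    and fin: "(\<integral>\<^sup>+x. ennreal ((v x)\<^sup>2) \<partial>\<mu>) < \<infinity>"
  shows "energy f = sqnorm f"
proof (rule antisym)
  have gm [measurable]: "g n \<in> borel_measurable borel" for n using C_meas g .
  show up: "energy f \<le> sqnorm f"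
    by (rule energy_limit_le[OF gm f v lim le fin C_energy[OF g]])
  have g_fin: "sqnorm (g n) < \<infinity>" for n
    using sqnorm_le[OF le] fin by (rule le_less_trans)
  have "AE x in \<mu>. \<forall>n. norm (g n x) \<le> v x" using le by (simp add: AE_all_countable)
  with lim have f_le: "AE x in \<mu>. norm (f x) \<le> v x"
    by eventually_elim (auto intro: Lim_bounded[OF tendsto_norm])
  then have f_fin: "sqnorm f < \<infinity>"
    using sqnorm_le fin by (blast intro: le_less_trans)
  have sq_lim: "(\<lambda>n. sqnorm (g n)) \<longlonglongrightarrow> sqnorm f"
    by (rule sqnorm_tendsto[OF gm f v lim le fin])
  have fin3: "(\<integral>\<^sup>+x. ennreal ((3 * v x)\<^sup>2) \<partial>\<mu>) < \<infinity>"
  proof -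
    have "(\<integral>\<^sup>+x. ennreal ((3 * v x)\<^sup>2) \<partial>\<mu>) = 9 * (\<integral>\<^sup>+x. ennreal ((v x)\<^sup>2) \<partial>\<mu>)"
      by (subst nn_integral_cmult[symmetric]) (auto simp: power_mult_distrib ennreal_mult)
    then show ?thesis using fin by (simp add: ennreal_mult_less_top)
  qed
  have le3: "norm (2 * a + (-1) * b) \<le> 3 * r" if "norm a \<le> r" "norm b \<le> r" for a b :: complex and r
    using norm_triangle_ineq4[of "2 * a" b] that by (simp add: norm_mult)
  \<comment> \<open>For fixed n the functions \<open>2 * g n x + (-1) * g m x\<close> belong to C
    and converge as m grows, under the majorant 3 v, so the one-sided bound reaches the reflected
    function.\<close>
  have refl_le: "energy (\<lambda>x. 2 * g n x + (-1) * f x) \<le> sqnorm (\<lambda>x. 2 * g n x + (-1) * f x)" for n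
  proof (rule energy_limit_le[where g="\<lambda>m x. 2 * g n x + (-1) * g m x" and v="\<lambda>x. 3 * v x", OF _ _ _ _ _ fin3])
    show "energy (\<lambda>x. 2 * g n x + (-1) * g m x) = sqnorm (\<lambda>x. 2 * g n x + (-1) * g m x)" for m
      by (intro C_energy C_diff g)
    show "AE x in \<mu>. (\<lambda>m. 2 * g n x + (-1) * g m x) \<longlonglongrightarrow> 2 * g n x + (-1) * f x"
      using lim by eventually_elim (intro tendsto_intros)
    show "AE x in \<mu>. norm (2 * g n x + (-1) * g m x) \<le> 3 * v x" for m
      using le[of n] le[of m] by eventually_elim (rule le3)
  qed measurable
  have refl_lim: "(\<lambda>n. sqnorm (\<lambda>x. 2 * g n x + (-1) * f x)) \<longlonglongrightarrow> sqnorm (\<lambda>x. 2 * f x + (-1) * f x)"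
  proof (rule sqnorm_tendsto[where v="\<lambda>x. 3 * v x", OF _ _ _ _ _ fin3])
    show "AE x in \<mu>. (\<lambda>n. 2 * g n x + (-1) * f x) \<longlonglongrightarrow> 2 * f x + (-1) * f x"
      using lim by eventually_elim (intro tendsto_intros)
    show "AE x in \<mu>. norm (2 * g n x + (-1) * f x) \<le> 3 * v x" for n
      using le[of n] f_le by eventually_elim (rule le3)
  qed measurable
  have par: "2 * sqnorm (g n) \<le> energy f + sqnorm (\<lambda>x. 2 * g n x + (-1) * f x)" for n
  proof -
    have "2 * sqnorm (g n) = (\<integral>\<^sup>+p. 2 * ennreal ((norm (W (g n) p))\<^sup>2) \<partial>nu_alpha \<alpha>)"
      unfolding C_energy[OF g, symmetric] energy_def by (rule nn_integral_cmult[symmetric]) measurable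
    also have "\<dots> \<le> (\<integral>\<^sup>+p. ennreal ((norm (W f p))\<^sup>2) + ennreal ((norm (W (\<lambda>x. 2 * g n x + (-1) * f x) p))\<^sup>2) \<partial>nu_alpha \<alpha>)"
    proof (rule nn_integral_mono_AE, use AE_nu_pos in eventually_elim)
      case (elim p)
      let ?X = "W f p" and ?Y = "W (g n) p"
      have lin: "W (\<lambda>x. 2 * g n x + (-1) * f x) p = 2 * ?Y + (-1) * ?X"
        using elim by (intro wavelet_lincomb g_fin f_fin gm f) auto
      have "norm (2 * ?Y) \<le> norm ?X + norm (2 * ?Y + (-1) * ?X)"
        using norm_triangle_ineq[of ?X "2 * ?Y + (-1) * ?X"] by simp
      then have "(2 * norm ?Y)\<^sup>2 \<le> (norm ?X + norm (2 * ?Y + (-1) * ?X))\<^sup>2"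
        by (intro power_mono) (auto simp: norm_mult)
      also have "\<dots> \<le> 2 * (norm ?X)\<^sup>2 + 2 * (norm (2 * ?Y + (-1) * ?X))\<^sup>2"
        using zero_le_power2[of "norm ?X - norm (2 * ?Y + (-1) * ?X)"] unfolding power2_sum power2_diff by linarith
      finally have "2 * (norm ?Y)\<^sup>2 \<le> (norm ?X)\<^sup>2 + (norm (2 * ?Y + (-1) * ?X))\<^sup>2"
        by (simp add: power_mult_distrib)
      then have "ennreal (2 * (norm ?Y)\<^sup>2) \<le> ennreal ((norm ?X)\<^sup>2 + (norm (2 * ?Y + (-1) * ?X))\<^sup>2)"
        by (rule ennreal_leI)
      then show ?case unfolding lin by (simp add: ennreal_mult)
    qed
    also have "\<dots> = energy f + energy (\<lambda>x. 2 * g n x + (-1) * f x)"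
      unfolding energy_def by (rule nn_integral_add) measurable
    also have "\<dots> \<le> energy f + sqnorm (\<lambda>x. 2 * g n x + (-1) * f x)"
      by (intro add_left_mono refl_le)
    finally show ?thesis .
  qed
  \<comment> \<open>The reflected functions tend to 2 f - f = f, so in the limit twice the squared
    norm is at most the energy plus the squared norm; a finite norm can be cancelled.\<close>
  have "2 * sqnorm f \<le> energy f + sqnorm (\<lambda>x. 2 * f x + (-1) * f x)"
  proof (rule LIMSEQ_le)
    show "(\<lambda>n. 2 * sqnorm (g n)) \<longlonglongrightarrow> 2 * sqnorm f"
      by (intro ennreal_tendsto_cmult sq_lim) simp
    show "(\<lambda>n. energy f + sqnorm (\<lambda>x. 2 * g n x + (-1) * f x)) \<longlonglongrightarrow> energy f + sqnorm (\<lambda>x. 2 * f x + (-1) * f x)"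
      by (intro tendsto_add tendsto_const refl_lim)
  qed (use par in auto)
  moreover have "(\<lambda>x. 2 * f x + (-1) * f x) = f" by (simp add: fun_eq_iff)
  ultimately have "sqnorm f + sqnorm f \<le> sqnorm f + energy f"
    by (simp only: mult_2 add.commute[of "energy f"])
  then show "sqnorm f \<le> energy f"
    using f_fin unfolding ennreal_add_left_cancel_le by auto
qed

text \<open>\<open>energy_limit\<close> asks of its class, besides measurability and the isometry,
  only closure under 2 h - k. It serves twice: here for nice functions, and then for bounded
  functions of bounded support.\<close>

lemma energy_bounded_support:
  assumes f [measurable]: "f \<in> borel_measurable borel"
    and "\<And>x. norm (f x) \<le> M" "\<And>x. \<bar>x\<bar> > R \<Longrightarrow> f x = 0"
  shows "energy f = sqnorm f"
proof -
  from nice_approximation[OF assms] obtain h B where h: "\<And>n. nice (h n)"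
    "AE x in \<mu>. (\<lambda>n. h n x) \<longlonglongrightarrow> f x" "\<And>n x. norm (h n x) \<le> B * gauss x"
    by blast
  show ?thesis
    by (rule energy_limit[where C="{h. nice h}" and g=h and v="\<lambda>x. B * gauss x"])
       (use h in \<open>auto intro: nice_measurable energy_nice nice_lincomb[of _ _ 2 "-1", simplified] nn_integral_gauss_scaled_sq[simplified]\<close>)
qed

text \<open>Truncating both the argument and the values makes |f| itself the square-integrable
  majorant, and at each point the truncations eventually equal \<open>f\<close>.\<close>

theorem energy_eq_sqnorm:
  assumes f [measurable]: "f \<in> borel_measurable borel" and fin: "sqnorm f < \<infinity>"
  shows "energy f = sqnorm f"
proof (rule energy_limit[where v="\<lambda>x. norm (f x)"])
  let ?C = "{h. h \<in> borel_measurable borel \<and> (\<exists>M R. \<forall>x::real. norm (h x) \<le> M \<and> (\<bar>x\<bar> > R \<longrightarrow> h x = (0::complex)))}"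
  let ?g = "\<lambda>n x. if \<bar>x\<bar> \<le> real n \<and> norm (f x) \<le> real n then f x else 0"
  show "energy h = sqnorm h" if "h \<in> ?C" for h
    using that energy_bounded_support by blast
  show "(\<lambda>x. 2 * h x + (-1) * k x) \<in> ?C" if hk: "h \<in> ?C" "k \<in> ?C" for h k
  proof -
    obtain M R M' R' where *: "\<And>x. norm (h x) \<le> M" "\<And>x. \<bar>x\<bar> > R \<Longrightarrow> h x = 0"
        "\<And>x. norm (k x) \<le> M'" "\<And>x. \<bar>x\<bar> > R' \<Longrightarrow> k x = 0"
      using hk by blast
    have "norm (2 * h x + (-1) * k x) \<le> 2 * M + M'" for x
      using norm_triangle_ineq4[of "2 * h x" "k x"] *(1)[of x] *(3)[of x] by (simp add: norm_mult)
    moreover have "2 * h x + (-1) * k x = 0" if "\<bar>x\<bar> > max R R'" for x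
      using that *(2)[of x] *(4)[of x] by simp
    ultimately have "\<forall>x. norm (2 * h x + (-1) * k x) \<le> 2 * M + M' \<and> (\<bar>x\<bar> > max R R' \<longrightarrow> 2 * h x + (-1) * k x = 0)"
      by blast
    moreover have "(\<lambda>x. 2 * h x + (-1) * k x) \<in> borel_measurable borel" using hk by auto
    ultimately show ?thesis by blast
  qed
  show "?g n \<in> ?C" for n
  proof -
    have "\<forall>x. norm (?g n x) \<le> real n \<and> (\<bar>x\<bar> > real n \<longrightarrow> ?g n x = 0)" by auto
    moreover have "?g n \<in> borel_measurable borel" by measurable
    ultimately show ?thesis by blast
  qed
  show "AE x in \<mu>. (\<lambda>n. ?g n x) \<longlonglongrightarrow> f x"
  proof (intro AE_I2 tendsto_eventually)
    fix x
    obtain N where N: "max \<bar>x\<bar> (norm (f x)) \<le> real N" using real_arch_simple by blast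
    show "\<forall>\<^sub>F n in sequentially. ?g n x = f x"
    proof (rule eventually_sequentiallyI[of N])
      fix n assume "N \<le> n"
      then have "real N \<le> real n" by simp
      with N show "?g n x = f x" by auto
    qed
  qed
  show "(\<integral>\<^sup>+x. ennreal ((norm (f x))\<^sup>2) \<partial>\<mu>) < \<infinity>" using fin by (simp add: sqnorm_def)
qed auto


subsection \<open>The entropy inequality\<close>

lemma in_L2_measurable: "in_L2 \<alpha> f \<Longrightarrow> f \<in> borel_measurable borel"
  by (simp add: in_L2_def measurable_cong_sets[OF sets_mu refl])

lemma sqnorm_eq_L2norm:
  assumes [measurable]: "f \<in> borel_measurable borel" and fin: "sqnorm f < \<infinity>"
  shows "sqnorm f = ennreal ((L2norm \<alpha> f)\<^sup>2)"
proof -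
  have "integrable \<mu> (\<lambda>x. (norm (f x))\<^sup>2)"
    using fin by (intro integrableI_bounded) (auto simp: sqnorm_def)
  then have "sqnorm f = ennreal (\<integral>x. (norm (f x))\<^sup>2 \<partial>\<mu>)"
    unfolding sqnorm_def by (rule nn_integral_eq_integral) simp
  then show ?thesis by (simp add: L2norm_def)
qed

lemma sqnorm_eq_0_iff:
  assumes [measurable]: "f \<in> borel_measurable borel"
  shows "sqnorm f = 0 \<longleftrightarrow> (AE x in \<mu>. f x = 0)"
  unfolding sqnorm_def by (subst nn_integral_0_iff_AE) auto

end

lemma ent_ge:
  assumes "0 \<le> s" "s \<le> M"
  shows "ent s \<ge> - (s * ln M)"
proof (cases "s = 0")
  case False
  then have "ln s \<le> ln M" using assms by (intro ln_mono) auto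
  then have "s * ln s \<le> s * ln M" using assms by (intro mult_left_mono) auto
  then show ?thesis using False by (simp add: ent_def)
qed (simp add: ent_def)

lemma ent_measurable [measurable]: "ent \<in> borel_measurable borel"
  unfolding ent_def[abs_def] by measurable

text \<open>The entropy may be infinite and ln K may have either sign, so the pointwise bound is not
  integrated directly. It is rearranged until both sides are sums of nonnegative terms, integrated
  in \<open>ennreal\<close>, and rearranged back. A separate bound makes the negative part finite,
  so that the difference is meaningful.\<close>

lemma entropy_lower_bound:
  fixes S :: "'a \<Rightarrow> real"
  assumes [measurable]: "S \<in> borel_measurable M" and nonneg: "\<And>x. S x \<ge> 0"
    and le: "AE x in M. S x \<le> K" and int: "(\<integral>\<^sup>+x. ennreal (S x) \<partial>M) = ennreal N" and N: "N \<ge> 0"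
  shows "(\<integral>\<^sup>+x. ennreal (max 0 (- ent (S x))) \<partial>M) < \<infinity>
     \<and> enn2ereal (\<integral>\<^sup>+x. ennreal (max 0 (ent (S x))) \<partial>M) - enn2ereal (\<integral>\<^sup>+x. ennreal (max 0 (- ent (S x))) \<partial>M)
       \<ge> ereal (N * (- ln K))"
proof -
  let ?P = "\<integral>\<^sup>+x. ennreal (max 0 (ent (S x))) \<partial>M" and ?Q = "\<integral>\<^sup>+x. ennreal (max 0 (- ent (S x))) \<partial>M"
  \<comment> \<open>Positive and negative parts, with ln K = ?p - ?m.\<close>
  let ?p = "max 0 (ln K)" and ?m = "max 0 (- ln K)"
  have cmult: "(\<integral>\<^sup>+x. ennreal c * ennreal (S x) \<partial>M) = ennreal (c * N)" if "c \<ge> 0" for c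
    using that N by (subst nn_integral_cmult) (auto simp: int ennreal_mult)
  have "?Q \<le> (\<integral>\<^sup>+x. ennreal ?p * ennreal (S x) \<partial>M)"
  proof (rule nn_integral_mono_AE, use le in eventually_elim)
    case (elim x)
    have "- ent (S x) \<le> S x * ln K" using ent_ge[OF nonneg elim] by simp
    also have "\<dots> \<le> S x * ?p" using nonneg by (intro mult_left_mono) auto
    finally have "max 0 (- ent (S x)) \<le> ?p * S x" using nonneg[of x] by (simp add: mult.commute)
    then show ?case using nonneg by (simp add: ennreal_mult[symmetric] ennreal_leI)
  qed
  also have "\<dots> = ennreal (?p * N)" by (rule cmult) simp
  also have "\<dots> < \<infinity>" by simp
  finally have Q: "?Q < \<infinity>" .
  have "?Q + ennreal (?m * N) = (\<integral>\<^sup>+x. ennreal (max 0 (- ent (S x))) + ennreal ?m * ennreal (S x) \<partial>M)"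
    by (subst nn_integral_add) (auto simp: cmult)
  also have "\<dots> \<le> (\<integral>\<^sup>+x. ennreal (max 0 (ent (S x))) + ennreal ?p * ennreal (S x) \<partial>M)"
  proof (rule nn_integral_mono_AE, use le in eventually_elim)
    case (elim x)
    have "- (S x * ln K) = S x * ?m - S x * ?p" by (simp add: max_def algebra_simps)
    with ent_ge[OF nonneg elim] have "max 0 (- ent (S x)) + ?m * S x \<le> max 0 (ent (S x)) + ?p * S x"
      by (auto simp: max_def mult.commute split: if_splits)
    then have "ennreal (max 0 (- ent (S x)) + ?m * S x) \<le> ennreal (max 0 (ent (S x)) + ?p * S x)"
      by (rule ennreal_leI)
    then show ?case using nonneg[of x] by (simp add: ennreal_mult)
  qed
  also have "\<dots> = ?P + ennreal (?p * N)"
    by (subst nn_integral_add) (auto simp: cmult)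
  finally have main: "?Q + ennreal (?m * N) \<le> ?P + ennreal (?p * N)" .
  obtain q where q: "q \<ge> 0" "?Q = ennreal q" using Q by (cases "?Q") auto
  have "enn2ereal ?P - enn2ereal ?Q \<ge> ereal (N * (- ln K))"
  proof (cases "?P")
    case (real r)
    from main have "ennreal (q + ?m * N) \<le> ennreal (r + ?p * N)"
      using real q N by (simp add: ennreal_plus)
    then have "q + ?m * N \<le> r + ?p * N"
      using real q N by (subst (asm) ennreal_le_iff) auto
    then have "N * (- ln K) \<le> r - q"
      by (auto simp: max_def algebra_simps split: if_splits)
    then show ?thesis using real q by (simp add: enn2ereal_ennreal)
  next
    \<comment> \<open>An infinite positive part and a finite negative part have difference infinity,
      which is above every real bound.\<close>
    case top
    then show ?thesis using q by (simp add: enn2ereal_ennreal)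
  qed
  with Q show ?thesis by blast
qed

theorem mainTheorem10:
  fixes \<alpha> :: real and \<psi> f :: "real \<Rightarrow> complex"
  assumes "\<alpha> > -1/2"
    and "admissible \<alpha> \<psi>"
    and "(L2norm \<alpha> \<psi>)^2 \<le> c_psi \<alpha> \<psi>"
    and "in_L2 \<alpha> f"
    and "\<not> (AE x in mu_alpha \<alpha>. f x = 0)"
  shows "(\<integral>\<^sup>+p. ennreal (max 0 (- ent ((cmod (wavelet_transform \<alpha> \<psi> f p))^2))) \<partial>nu_alpha \<alpha>) < \<infinity>
     \<and> enn2ereal (\<integral>\<^sup>+p. ennreal (max 0 (ent ((cmod (wavelet_transform \<alpha> \<psi> f p))^2))) \<partial>nu_alpha \<alpha>)
       - enn2ereal (\<integral>\<^sup>+p. ennreal (max 0 (- ent ((cmod (wavelet_transform \<alpha> \<psi> f p))^2))) \<partial>nu_alpha \<alpha>)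
       \<ge> ereal ((L2norm \<alpha> f)^2 * ln (c_psi \<alpha> \<psi> / ((L2norm \<alpha> \<psi>)^2 * (L2norm \<alpha> f)^2)))"
proof -
  interpret wavelet_setup \<alpha> \<psi>
    using assms by unfold_locales auto
  have f [measurable]: "f \<in> borel_measurable borel" using assms(4) by (rule in_L2_measurable)
  have f_fin: "sqnorm f < \<infinity>" using assms(4) by (simp add: in_L2_def sqnorm_def)
  define N where "N = (L2norm \<alpha> f)\<^sup>2"
  define P where "P = (L2norm \<alpha> \<psi>)\<^sup>2"
  have N_eq: "sqnorm f = ennreal N" and P_eq: "sqnorm \<psi> = ennreal P"
    unfolding N_def P_def using sqnorm_eq_L2norm f f_fin psi_measurable sqnorm_psi_finite by blast+
  \<comment> \<open>Both functions are nonzero on a set of positive measure, so N and P are positive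
    and the quotient inside the logarithm can be inverted.\<close>
  have "sqnorm f \<noteq> 0" "sqnorm \<psi> \<noteq> 0"
    using assms(2,5) by (simp_all add: sqnorm_eq_0_iff admissible_def)
  then have NP: "N > 0" "P > 0"
    unfolding N_eq P_eq by (simp_all add: ennreal_eq_0_iff not_le)
  have "AE p in nu_alpha \<alpha>. (cmod (W f p))\<^sup>2 \<le> P * N / c\<^sub>\<psi>"
    using AE_nu_pos
  proof eventually_elim
    case (elim p)
    then have "ennreal ((cmod (W f p))\<^sup>2) \<le> ennreal (1 / c\<^sub>\<psi>) * (ennreal N * ennreal P)"
      using wavelet_bound[OF f f_fin, of p] by (simp only: N_eq P_eq)
    also have "\<dots> = ennreal (P * N / c\<^sub>\<psi>)"
      using NP c_psi_pos by (simp add: ennreal_mult[symmetric] mult_ac)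
    finally show ?case
      using NP c_psi_pos by (subst (asm) ennreal_le_iff) auto
  qed
  moreover have "(\<integral>\<^sup>+p. ennreal ((cmod (W f p))\<^sup>2) \<partial>nu_alpha \<alpha>) = ennreal N"
    using energy_eq_sqnorm[OF f f_fin] by (simp only: energy_def N_eq)
  moreover have "(\<lambda>p. (cmod (W f p))\<^sup>2) \<in> borel_measurable (nu_alpha \<alpha>)" by measurable
  ultimately have "(\<integral>\<^sup>+p. ennreal (max 0 (- ent ((cmod (W f p))\<^sup>2))) \<partial>nu_alpha \<alpha>) < \<infinity>
     \<and> enn2ereal (\<integral>\<^sup>+p. ennreal (max 0 (ent ((cmod (W f p))\<^sup>2))) \<partial>nu_alpha \<alpha>)
       - enn2ereal (\<integral>\<^sup>+p. ennreal (max 0 (- ent ((cmod (W f p))\<^sup>2))) \<partial>nu_alpha \<alpha>)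
       \<ge> ereal (N * (- ln (P * N / c\<^sub>\<psi>)))"
    using NP by (intro entropy_lower_bound) auto
  moreover have "- ln (P * N / c\<^sub>\<psi>) = ln (c\<^sub>\<psi> / (P * N))"
    using NP c_psi_pos by (simp add: ln_div)
  ultimately show ?thesis unfolding N_def P_def by (simp only:)
qed

end
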